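(* Let $A$ be a ring and $\mathcal{C}$ a Frobenius $A$-coring. Then the adjoint pair $(F,G)$, $$F:\mathcal{M}_{\mathcal{C}^*}\to\mathcal{M}^{\mathcal{C}},\ F(N)=N\otimes_{\mathcal{C}^*}\mathcal{C},\qquad G:\mathcal{M}^{\mathcal{C}}\to\mathcal{M}_{\mathcal{C}^*},\ G(M)=\mathrm{Hom}^{\mathcal{C}}(\mathcal{C},M),$$ is a pair of inverse equivalences.
   Context: An $A$-coring is an $A$-bimodule $\mathcal{C}$ with $A$-bimodule maps $\Delta:\mathcal{C}\to\mathcal{C}\otimes_A\mathcal{C}$, $\Delta(c)=c_{(1)}\otimes_A c_{(2)}$ (coassociative) and $\varepsilon:\mathcal{C}\to A$ (counit). Right $\mathcal{C}$-comodules are right $A$-modules with a right $A$-linear, coassociative, counital coaction; morphisms are right $A$-linear maps commuting with coactions; category $\mathcal{M}^{\mathcal{C}}$ with $\mathrm{Hom}^{\mathcal{C}}$. $\mathcal{C}^*=\mathrm{Hom}_A(\mathcal{C},A)$ (right $A$-linear maps) is a ring with $(f\#g)(c)=f(g(c_{(1)})c_{(2)})$; $\mathcal{C}$ is a left $\mathcal{C}^*$-module via $f\cdot c=f(c_{(1)})c_{(2)}$, which identifies $\mathcal{C}^*\cong\mathrm{End}^{\mathcal{C}}(\mathcal{C})$. $F(N)$ has the coaction induced by $\Delta$; $G(M)$ is a right $\mathcal{C}^*$-module via composition with the action on $\mathcal{C}$. The unit is $n\mapsto(c\mapsto n\otimes c)$, the counit is evaluation; $(F,G)$ is a pair of inverse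 equivalences if both are isomorphisms. $\mathcal{C}$ is Frobenius if the right adjoint $-\otimes_A\mathcal{C}$ of the forgetful functor $\mathcal{M}^{\mathcal{C}}\to\mathcal{M}_A$ is also a left adjoint of it; equivalently, there exist $z\in\mathcal{C}$ with $az=za$ for all $a\in A$ and an $A$-bimodule map $\theta:\mathcal{C}\otimes_A\mathcal{C}\to A$ with $c_{(1)}\theta(c_{(2)}\otimes_A d)=\theta(c\otimes_A d_{(1)})d_{(2)}$ and $\theta(z\otimes_A c)=\theta(c\otimes_A z)=\varepsilon(c)$ for all $c,d\in\mathcal{C}$. A Frobenius coring is finitely generated and projective as a left and as a right $A$-module. *)

theory Defs
  imports "HOL-Algebra.Free_Abelian_Groups" "HOL-Algebra.Ring"
begin

section \<open>Modules and bimodules over noncommutative rings\<close>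

text \<open>As in the library record \<open>module\<close>, the underlying abelian group is kept in a \<open>ring\<close> record
  of which only \<open>carrier\<close>, \<open>zero\<close> and \<open>add\<close> are used. The library locale \<open>module\<close> itself demands
  a commutative ring of scalars.\<close>

record ('s, 'm) rmod = "'m ring" +
  ract :: "['m, 's] \<Rightarrow> 'm" (infixl "\<triangleleft>\<index>" 70)

record ('r, 's, 'm) bimod = "('s, 'm) rmod" +
  lact :: "['r, 'm] \<Rightarrow> 'm" (infixr "\<triangleright>\<index>" 70)

locale right_module = R: ring R + M: abelian_group M for R (structure) and M (structure) +
  assumes ract_closed: "\<lbrakk>m \<in> carrier M; r \<in> carrier R\<rbrakk> \<Longrightarrow> m \<triangleleft>\<^bsub>M\<^esub> r \<in> carrier M"
    and ract_add_left: "\<lbrakk>m \<in> carrier M; n \<in> carrier M; r \<in> carrier R\<rbrakk> \<Longrightarrow>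
      (m \<oplus>\<^bsub>M\<^esub> n) \<triangleleft>\<^bsub>M\<^esub> r = m \<triangleleft>\<^bsub>M\<^esub> r \<oplus>\<^bsub>M\<^esub> n \<triangleleft>\<^bsub>M\<^esub> r"
    and ract_add_right: "\<lbrakk>m \<in> carrier M; r \<in> carrier R; s \<in> carrier R\<rbrakk> \<Longrightarrow>
      m \<triangleleft>\<^bsub>M\<^esub> (r \<oplus>\<^bsub>R\<^esub> s) = m \<triangleleft>\<^bsub>M\<^esub> r \<oplus>\<^bsub>M\<^esub> m \<triangleleft>\<^bsub>M\<^esub> s"
    and ract_assoc: "\<lbrakk>m \<in> carrier M; r \<in> carrier R; s \<in> carrier R\<rbrakk> \<Longrightarrow>
      m \<triangleleft>\<^bsub>M\<^esub> (r \<otimes>\<^bsub>R\<^esub> s) = (m \<triangleleft>\<^bsub>M\<^esub> r) \<triangleleft>\<^bsub>M\<^esub> s"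
    and ract_one: "m \<in> carrier M \<Longrightarrow> m \<triangleleft>\<^bsub>M\<^esub> \<one>\<^bsub>R\<^esub> = m"

locale bimodule = L: ring R + right_module S M
  for R (structure) and S (structure) and M (structure) +
  assumes lact_closed: "\<lbrakk>r \<in> carrier R; m \<in> carrier M\<rbrakk> \<Longrightarrow> r \<triangleright>\<^bsub>M\<^esub> m \<in> carrier M"
    and lact_add_right: "\<lbrakk>r \<in> carrier R; m \<in> carrier M; n \<in> carrier M\<rbrakk> \<Longrightarrow>
      r \<triangleright>\<^bsub>M\<^esub> (m \<oplus>\<^bsub>M\<^esub> n) = r \<triangleright>\<^bsub>M\<^esub> m \<oplus>\<^bsub>M\<^esub> r \<triangleright>\<^bsub>M\<^esub> n"
    and lact_add_left: "\<lbrakk>r \<in> carrier R; s \<in> carrier R; m \<in> carrier M\<rbrakk> \<Longrightarrow>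
      (r \<oplus>\<^bsub>R\<^esub> s) \<triangleright>\<^bsub>M\<^esub> m = r \<triangleright>\<^bsub>M\<^esub> m \<oplus>\<^bsub>M\<^esub> s \<triangleright>\<^bsub>M\<^esub> m"
    and lact_assoc: "\<lbrakk>r \<in> carrier R; s \<in> carrier R; m \<in> carrier M\<rbrakk> \<Longrightarrow>
      (r \<otimes>\<^bsub>R\<^esub> s) \<triangleright>\<^bsub>M\<^esub> m = r \<triangleright>\<^bsub>M\<^esub> (s \<triangleright>\<^bsub>M\<^esub> m)"
    and lact_one: "m \<in> carrier M \<Longrightarrow> \<one>\<^bsub>R\<^esub> \<triangleright>\<^bsub>M\<^esub> m = m"
    and lact_ract: "\<lbrakk>r \<in> carrier R; m \<in> carrier M; s \<in> carrier S\<rbrakk> \<Longrightarrow>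
      (r \<triangleright>\<^bsub>M\<^esub> m) \<triangleleft>\<^bsub>M\<^esub> s = r \<triangleright>\<^bsub>M\<^esub> (m \<triangleleft>\<^bsub>M\<^esub> s)"

definition regular_bimod :: "('a, 'z) ring_scheme \<Rightarrow> ('a, 'a, 'a) bimod" where
  "regular_bimod A = \<lparr>carrier = carrier A, mult = mult A, one = one A, zero = zero A, add = add A,
     ract = mult A, lact = mult A\<rparr>"

definition rmod_hom ::
  "('s, 'z) ring_scheme \<Rightarrow> ('s, 'm, 'y) rmod_scheme \<Rightarrow> ('s, 'n, 'x) rmod_scheme \<Rightarrow> ('m \<Rightarrow> 'n) set" where
  "rmod_hom S M N = {f \<in> carrier M \<rightarrow> carrier N.
     (\<forall>m\<in>carrier M. \<forall>n\<in>carrier M. f (m \<oplus>\<^bsub>M\<^esub> n) = f m \<oplus>\<^bsub>N\<^esub> f n) \<and>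
     (\<forall>m\<in>carrier M. \<forall>s\<in>carrier S. f (m \<triangleleft>\<^bsub>M\<^esub> s) = f m \<triangleleft>\<^bsub>N\<^esub> s)}"

definition bimod_hom ::
  "('r, 'w) ring_scheme \<Rightarrow> ('s, 'z) ring_scheme \<Rightarrow> ('r, 's, 'm, 'y) bimod_scheme \<Rightarrow>
    ('r, 's, 'n, 'x) bimod_scheme \<Rightarrow> ('m \<Rightarrow> 'n) set" where
  "bimod_hom R S M N = {f \<in> rmod_hom S M N.
     \<forall>r\<in>carrier R. \<forall>m\<in>carrier M. f (r \<triangleright>\<^bsub>M\<^esub> m) = r \<triangleright>\<^bsub>N\<^esub> f m}"

definition rmod_iso ::
  "('s, 'z) ring_scheme \<Rightarrow> ('s, 'm, 'y) rmod_scheme \<Rightarrow> ('s, 'n, 'x) rmod_scheme \<Rightarrow> ('m \<Rightarrow> 'n) set" where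
  "rmod_iso S M N = {f \<in> rmod_hom S M N. \<exists>g\<in>rmod_hom S N M.
     (\<forall>m\<in>carrier M. g (f m) = m) \<and> (\<forall>n\<in>carrier N. f (g n) = n)}"

section \<open>Tensor products\<close>

type_synonym ('m, 'n) tensor = "('m \<times> 'n \<Rightarrow>\<^sub>0 int) set"

definition tensor_relations ::
  "('r, 'w) ring_scheme \<Rightarrow> ('r, 'm, 'y) rmod_scheme \<Rightarrow> ('r, 's, 'n, 'x) bimod_scheme \<Rightarrow>
    ('m \<times> 'n \<Rightarrow>\<^sub>0 int) set" where
  "tensor_relations R M N =
     {frag_of (m \<oplus>\<^bsub>M\<^esub> m', n) - frag_of (m, n) - frag_of (m', n) | m m' n.
        m \<in> carrier M \<and> m' \<in> carrier M \<and> n \<in> carrier N} \<union>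
     {frag_of (m, n \<oplus>\<^bsub>N\<^esub> n') - frag_of (m, n) - frag_of (m, n') | m n n'.
        m \<in> carrier M \<and> n \<in> carrier N \<and> n' \<in> carrier N} \<union>
     {frag_of (m \<triangleleft>\<^bsub>M\<^esub> r, n) - frag_of (m, r \<triangleright>\<^bsub>N\<^esub> n) | m r n.
        m \<in> carrier M \<and> r \<in> carrier R \<and> n \<in> carrier N}"

definition tensor_kernel ::
  "('r, 'w) ring_scheme \<Rightarrow> ('r, 'm, 'y) rmod_scheme \<Rightarrow> ('r, 's, 'n, 'x) bimod_scheme \<Rightarrow>
    ('m \<times> 'n \<Rightarrow>\<^sub>0 int) set" where
  "tensor_kernel R M N =
     generate (free_Abelian_group (carrier M \<times> carrier N)) (tensor_relations R M N)"

definition tens ::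
  "('r, 'w) ring_scheme \<Rightarrow> ('r, 'm, 'y) rmod_scheme \<Rightarrow> ('r, 's, 'n, 'x) bimod_scheme \<Rightarrow>
    'm \<Rightarrow> 'n \<Rightarrow> ('m, 'n) tensor" where
  "tens R M N m n =
     tensor_kernel R M N #>\<^bsub>free_Abelian_group (carrier M \<times> carrier N)\<^esub> frag_of (m, n)"

definition tensor_group ::
  "('r, 'w) ring_scheme \<Rightarrow> ('r, 'm, 'y) rmod_scheme \<Rightarrow> ('r, 's, 'n, 'x) bimod_scheme \<Rightarrow>
    ('m, 'n) tensor ring" where
  "tensor_group R M N =
     (let Q = free_Abelian_group (carrier M \<times> carrier N) Mod tensor_kernel R M N
      in \<lparr>carrier = carrier Q, mult = undefined, one = undefined, zero = one Q, add = mult Q\<rparr>)"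

text \<open>The additive map induced on a tensor product by a balanced biadditive map \<open>\<beta>\<close> into the
  abelian group \<open>P\<close>: it sends \<open>\<Sum> m\<^sub>i \<otimes> n\<^sub>i\<close> to \<open>\<Sum> \<beta> m\<^sub>i n\<^sub>i\<close>, computed on any representative of the
  coset \<open>X\<close>. It is meaningful only for balanced biadditive \<open>\<beta>\<close>. It also renders Sweedler notation:
  an expression in \<open>c\<^sub>(\<^sub>1\<^sub>)\<close> and \<open>c\<^sub>(\<^sub>2\<^sub>)\<close> is \<open>tensor_lift P \<beta> (comul C c)\<close>.\<close>

definition tensor_lift :: "('p, 'z) ring_scheme \<Rightarrow> ('m \<Rightarrow> 'n \<Rightarrow> 'p) \<Rightarrow> ('m, 'n) tensor \<Rightarrow> 'p" where
  "tensor_lift P \<beta> X = the_elem ((\<lambda>w. finsum P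
     (\<lambda>k. [Poly_Mapping.lookup w k] \<cdot>\<^bsub>P\<^esub> \<beta> (fst k) (snd k)) (Poly_Mapping.keys w)) ` X)"

text \<open>For a right \<open>R\<close>-module \<open>M\<close> and an \<open>R\<close>-\<open>S\<close>-bimodule \<open>N\<close>, the right \<open>S\<close>-module \<open>M \<otimes>\<^sub>R N\<close>;
  if \<open>M\<close> is a \<open>Q\<close>-\<open>R\<close>-bimodule, the \<open>Q\<close>-\<open>S\<close>-bimodule \<open>M \<otimes>\<^sub>R N\<close>.\<close>

definition tensor ::
  "('r, 'w) ring_scheme \<Rightarrow> ('r, 'm, 'y) rmod_scheme \<Rightarrow> ('r, 's, 'n, 'x) bimod_scheme \<Rightarrow>
    ('s, ('m, 'n) tensor) rmod" where
  "tensor R M N = ring.extend (tensor_group R M N)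
     (rmod.fields (\<lambda>X s. tensor_lift (tensor_group R M N) (\<lambda>m n. tens R M N m (n \<triangleleft>\<^bsub>N\<^esub> s)) X))"

definition bitensor ::
  "('r, 'w) ring_scheme \<Rightarrow> ('q, 'r, 'm, 'y) bimod_scheme \<Rightarrow> ('r, 's, 'n, 'x) bimod_scheme \<Rightarrow>
    ('q, 's, ('m, 'n) tensor) bimod" where
  "bitensor R M N = rmod.extend (tensor R M N)
     (bimod.fields (\<lambda>q X. tensor_lift (tensor_group R M N) (\<lambda>m n. tens R M N (q \<triangleright>\<^bsub>M\<^esub> m) n) X))"

text \<open>\<open>f \<otimes> g : M \<otimes>\<^sub>R N \<rightarrow> M' \<otimes>\<^sub>R N'\<close>, and the canonical map
  \<open>(M \<otimes>\<^sub>R N) \<otimes>\<^sub>S P \<rightarrow> M \<otimes>\<^sub>R (N \<otimes>\<^sub>S P)\<close>.\<close>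

definition tensor_map ::
  "('r, 'w) ring_scheme \<Rightarrow> ('r, 'm2, 'y) rmod_scheme \<Rightarrow> ('r, 's, 'n2, 'x) bimod_scheme \<Rightarrow>
    ('m \<Rightarrow> 'm2) \<Rightarrow> ('n \<Rightarrow> 'n2) \<Rightarrow> ('m, 'n) tensor \<Rightarrow> ('m2, 'n2) tensor" where
  "tensor_map R M' N' f g = tensor_lift (tensor R M' N') (\<lambda>m n. tens R M' N' (f m) (g n))"

definition tensor_assoc ::
  "('r, 'w) ring_scheme \<Rightarrow> ('s, 'v) ring_scheme \<Rightarrow> ('r, 'm, 'y) rmod_scheme \<Rightarrow>
    ('r, 's, 'n, 'x) bimod_scheme \<Rightarrow> ('s, 't, 'p, 'u) bimod_scheme \<Rightarrow>
    (('m, 'n) tensor, 'p) tensor \<Rightarrow> ('m, ('n, 'p) tensor) tensor" where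
  "tensor_assoc R S M N P =
     tensor_lift (tensor R M (bitensor S N P)) (\<lambda>X p.
       tensor_lift (tensor R M (bitensor S N P)) (\<lambda>m n.
         tens R M (bitensor S N P) m (tens S N P n p)) X)"

section \<open>Corings and comodules\<close>

record ('a, 'c) cor = "('a, 'a, 'c) bimod" +
  comul :: "'c \<Rightarrow> ('c, 'c) tensor"
  counit :: "'c \<Rightarrow> 'a"

locale coring = bimodule A A C for A (structure) and C (structure) +
  assumes comul_hom: "comul C \<in> bimod_hom A A C (bitensor A C C)"
    and counit_hom: "counit C \<in> bimod_hom A A C (regular_bimod A)"
    and comul_coassoc: "c \<in> carrier C \<Longrightarrow>
      tensor_assoc A A C C C (tensor_map A (bitensor A C C) C (comul C) (\<lambda>x. x) (comul C c)) =
      tensor_map A C (bitensor A C C) (\<lambda>x. x) (comul C) (comul C c)"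
    and counit_left: "c \<in> carrier C \<Longrightarrow> tensor_lift C (\<lambda>x y. counit C x \<triangleright>\<^bsub>C\<^esub> y) (comul C c) = c"
    and counit_right: "c \<in> carrier C \<Longrightarrow> tensor_lift C (\<lambda>x y. x \<triangleleft>\<^bsub>C\<^esub> counit C y) (comul C c) = c"

record ('a, 'c, 'm) comod = "('a, 'm) rmod" +
  coact :: "'m \<Rightarrow> ('m, 'c) tensor"

locale right_comodule = coring A C + M: right_module A M
  for A (structure) and C (structure) and M (structure) +
  assumes coact_hom: "coact M \<in> rmod_hom A M (tensor A M C)"
    and coact_coassoc: "m \<in> carrier M \<Longrightarrow>
      tensor_assoc A A M C C (tensor_map A (tensor A M C) C (coact M) (\<lambda>x. x) (coact M m)) =
      tensor_map A M (bitensor A C C) (\<lambda>x. x) (comul C) (coact M m)"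
    and coact_counit: "m \<in> carrier M \<Longrightarrow>
      tensor_lift M (\<lambda>x c. x \<triangleleft>\<^bsub>M\<^esub> counit C c) (coact M m) = m"

definition comod_hom ::
  "('a, 'z) ring_scheme \<Rightarrow> ('a, 'c) cor \<Rightarrow> ('a, 'c, 'm) comod \<Rightarrow> ('a, 'c, 'n) comod \<Rightarrow> ('m \<Rightarrow> 'n) set"
  where "comod_hom A C M N = {f \<in> rmod_hom A M N.
     \<forall>m\<in>carrier M. coact N (f m) = tensor_map A N C f (\<lambda>c. c) (coact M m)}"

definition comod_iso ::
  "('a, 'z) ring_scheme \<Rightarrow> ('a, 'c) cor \<Rightarrow> ('a, 'c, 'm) comod \<Rightarrow> ('a, 'c, 'n) comod \<Rightarrow> ('m \<Rightarrow> 'n) set"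
  where "comod_iso A C M N = {f \<in> comod_hom A C M N. \<exists>g\<in>comod_hom A C N M.
     (\<forall>m\<in>carrier M. g (f m) = m) \<and> (\<forall>n\<in>carrier N. f (g n) = n)}"

definition regular_comod :: "('a, 'c) cor \<Rightarrow> ('a, 'c, 'c) comod" where
  "regular_comod C = \<lparr>carrier = carrier C, mult = mult C, one = one C, zero = zero C, add = add C,
     ract = ract C, coact = comul C\<rparr>"

text \<open>A Frobenius coring, given by a Casimir-type pair \<open>(z, \<theta>)\<close>. The adjunction between
  the forgetful functor and \<open>\<hyphen> \<otimes>\<^sub>A C\<close> quantifies over modules with carriers in all types and
  cannot be a hypothesis in HOL; this elementwise form is the equivalent one.\<close>

definition frobenius_coring :: "('a, 'z) ring_scheme \<Rightarrow> ('a, 'c) cor \<Rightarrow> bool" where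
  "frobenius_coring A C \<longleftrightarrow> coring A C \<and>
     (\<exists>z\<in>carrier C. \<exists>\<theta>\<in>bimod_hom A A (bitensor A C C) (regular_bimod A).
        (\<forall>a\<in>carrier A. a \<triangleright>\<^bsub>C\<^esub> z = z \<triangleleft>\<^bsub>C\<^esub> a) \<and>
        (\<forall>c\<in>carrier C. \<forall>d\<in>carrier C.
           tensor_lift C (\<lambda>x y. x \<triangleleft>\<^bsub>C\<^esub> \<theta> (tens A C C y d)) (comul C c) =
           tensor_lift C (\<lambda>x y. \<theta> (tens A C C c x) \<triangleright>\<^bsub>C\<^esub> y) (comul C d)) \<and>
        (\<forall>c\<in>carrier C. \<theta> (tens A C C z c) = counit C c \<and> \<theta> (tens A C C c z) = counit C c))"

section \<open>The dual ring and the functors\<close>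

text \<open>The left action \<open>f \<cdot> c = f(c\<^sub>(\<^sub>1\<^sub>)) c\<^sub>(\<^sub>2\<^sub>)\<close>, and \<open>C\<^sup>*\<close> with product
  \<open>(f # g)(c) = f(g(c\<^sub>(\<^sub>1\<^sub>)) c\<^sub>(\<^sub>2\<^sub>))\<close>. Elements of \<open>C\<^sup>*\<close> and of \<open>Hom\<^sup>C(C, M)\<close> are taken
  \<open>extensional\<close>, so that a map on the carrier of \<open>C\<close> is a single element.\<close>

definition dual_act :: "('a, 'c) cor \<Rightarrow> ('c \<Rightarrow> 'a) \<Rightarrow> 'c \<Rightarrow> 'c" where
  "dual_act C f c = tensor_lift C (\<lambda>x y. f x \<triangleright>\<^bsub>C\<^esub> y) (comul C c)"

definition dual_ring :: "('a, 'z) ring_scheme \<Rightarrow> ('a, 'c) cor \<Rightarrow> ('c \<Rightarrow> 'a) ring" where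
  "dual_ring A C = \<lparr>
     carrier = rmod_hom A C (regular_bimod A) \<inter> extensional (carrier C),
     mult = (\<lambda>f g. \<lambda>c\<in>carrier C. f (dual_act C g c)),
     one = (\<lambda>c\<in>carrier C. counit C c),
     zero = (\<lambda>c\<in>carrier C. \<zero>\<^bsub>A\<^esub>),
     add = (\<lambda>f g. \<lambda>c\<in>carrier C. f c \<oplus>\<^bsub>A\<^esub> g c)\<rparr>"

definition dual_bimod :: "('a, 'c) cor \<Rightarrow> ('c \<Rightarrow> 'a, 'a, 'c) bimod" where
  "dual_bimod C = \<lparr>carrier = carrier C, mult = mult C, one = one C, zero = zero C, add = add C,
     ract = ract C, lact = dual_act C\<rparr>"

text \<open>\<open>F N = N \<otimes>\<^bsub>C\<^sup>*\<^esub> C\<close> with coaction \<open>n \<otimes> c \<mapsto> (n \<otimes> c\<^sub>(\<^sub>1\<^sub>)) \<otimes> c\<^sub>(\<^sub>2\<^sub>)\<close>.\<close>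

definition F_obj ::
  "('a, 'z) ring_scheme \<Rightarrow> ('a, 'c) cor \<Rightarrow> ('c \<Rightarrow> 'a, 'n) rmod \<Rightarrow> ('a, 'c, ('n, 'c) tensor) comod" where
  "F_obj A C N = (let T = tensor (dual_ring A C) N (dual_bimod C) in
     rmod.extend T (comod.fields
       (tensor_lift (tensor A T C) (\<lambda>n c.
          tensor_lift (tensor A T C) (\<lambda>x y.
            tens A T C (tens (dual_ring A C) N (dual_bimod C) n x) y) (comul C c)))))"

definition F_map ::
  "('a, 'z) ring_scheme \<Rightarrow> ('a, 'c) cor \<Rightarrow> ('c \<Rightarrow> 'a, 'n2) rmod \<Rightarrow> ('n \<Rightarrow> 'n2) \<Rightarrow>
    ('n, 'c) tensor \<Rightarrow> ('n2, 'c) tensor" where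
  "F_map A C N' f = tensor_map (dual_ring A C) N' (dual_bimod C) f (\<lambda>c. c)"

definition G_obj ::
  "('a, 'z) ring_scheme \<Rightarrow> ('a, 'c) cor \<Rightarrow> ('a, 'c, 'm) comod \<Rightarrow> ('c \<Rightarrow> 'a, 'c \<Rightarrow> 'm) rmod" where
  "G_obj A C M = \<lparr>
     carrier = comod_hom A C (regular_comod C) M \<inter> extensional (carrier C),
     mult = undefined, one = undefined,
     zero = (\<lambda>c\<in>carrier C. \<zero>\<^bsub>M\<^esub>),
     add = (\<lambda>h k. \<lambda>c\<in>carrier C. h c \<oplus>\<^bsub>M\<^esub> k c),
     ract = (\<lambda>h f. \<lambda>c\<in>carrier C. h (dual_act C f c))\<rparr>"

definition G_map :: "('a, 'c) cor \<Rightarrow> ('m \<Rightarrow> 'm2) \<Rightarrow> ('c \<Rightarrow> 'm) \<Rightarrow> ('c \<Rightarrow> 'm2)" where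
  "G_map C f h = (\<lambda>c\<in>carrier C. f (h c))"

definition FG_unit ::
  "('a, 'z) ring_scheme \<Rightarrow> ('a, 'c) cor \<Rightarrow> ('c \<Rightarrow> 'a, 'n) rmod \<Rightarrow> 'n \<Rightarrow> 'c \<Rightarrow> ('n, 'c) tensor" where
  "FG_unit A C N n = (\<lambda>c\<in>carrier C. tens (dual_ring A C) N (dual_bimod C) n c)"

definition FG_counit :: "('a, 'c, 'm) comod \<Rightarrow> ('c \<Rightarrow> 'm, 'c) tensor \<Rightarrow> 'm" where
  "FG_counit M = tensor_lift M (\<lambda>h c. h c)"

end

theory Submission
  imports Defs
begin

text \<open>
  The idea is that a Frobenius coring is free of rank one over its dual ring. Let \<open>z\<close> and \<open>\<theta>\<close> be
  the Frobenius data. For \<open>c\<close> in \<open>C\<close> put \<open>\<phi>\<^sub>c = \<theta>(c \<otimes> -)\<close>, an element of \<open>C\<^sup>*\<close>. The Casimir identity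
  \<open>c\<^sub>(\<^sub>1\<^sub>) \<theta>(c\<^sub>(\<^sub>2\<^sub>) \<otimes> d) = \<theta>(c \<otimes> d\<^sub>(\<^sub>1\<^sub>)) d\<^sub>(\<^sub>2\<^sub>)\<close> and \<open>\<theta>(z \<otimes> c) = \<theta>(c \<otimes> z) = \<epsilon>(c)\<close> give
  \<open>\<phi>\<^sub>c \<cdot> z = c\<close> and \<open>\<phi>\<^bsub>f \<cdot> z\<^esub> = f\<close>, so \<open>f \<mapsto> f \<cdot> z\<close> is an isomorphism of left \<open>C\<^sup>*\<close>-modules from
  \<open>C\<^sup>*\<close> to \<open>C\<close> (\<open>coord_act_z\<close>, \<open>coord_dual_act_z\<close>). Hence every element of \<open>N \<otimes> C\<close> over \<open>C\<^sup>*\<close> is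
  \<open>n \<otimes> z\<close> for exactly one \<open>n\<close> in \<open>N\<close> (\<open>tens_first_coord\<close>, \<open>first_coord_tens_z\<close>).

  On the other side, a comodule map \<open>h : C \<rightarrow> M\<close> is determined by its value at \<open>z\<close>, and every
  \<open>m\<close> in \<open>M\<close> is such a value: the map is \<open>c \<mapsto> m\<^sub>(\<^sub>0\<^sub>) \<theta>(m\<^sub>(\<^sub>1\<^sub>) \<otimes> c)\<close>. That it is colinear
  (\<open>colin_at_colinear\<close>) follows from coassociativity of \<open>M\<close> and the Casimir identity; that it takes
  the value \<open>m\<close> at \<open>z\<close> is the counit axiom of \<open>M\<close> (\<open>colin_at_z\<close>), and \<open>colin_at_eval_z\<close> is
      uniqueness.

  So evaluation at \<open>z\<close> identifies \<open>Hom\<^sup>C(C, M)\<close> with \<open>M\<close>, and \<open>n \<mapsto> n \<otimes> z\<close> identifies \<open>N\<close> with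
  \<open>N \<otimes> C\<close>. Under these identifications the unit and the counit of the adjunction become identities,
  which yields explicit inverses: \<open>k \<mapsto> k(z) = n \<otimes> z \<mapsto> n\<close> for the unit, and
  \<open>m \<mapsto> h\<^sub>m \<otimes> z\<close>, with \<open>h\<^sub>m\<close> the comodule map of value \<open>m\<close> at \<open>z\<close>, for the counit.

  Tensor products are handled through their universal property. Sweedler expressions are induced
      maps
  \<open>tensor_lift P \<beta>\<close> applied to a coproduct or coaction; they are compared by checking additive maps
  on pure tensors (\<open>tensor_ext\<close>), and coassociativity enters as \<open>sweedler_coassoc\<close>.
\<close>

section \<open>Additive and balanced maps\<close>

text \<open>Group homomorphisms between the additive groups of two structures. As with all maps here,
  nothing is said about values outside the carrier.\<close>

definition additive :: "('p, 'x) ring_scheme \<Rightarrow> ('q, 'y) ring_scheme \<Rightarrow> ('p \<Rightarrow> 'q) \<Rightarrow> bool" where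
  "additive P Q f \<longleftrightarrow> (\<forall>x\<in>carrier P. f x \<in> carrier Q) \<and>
     (\<forall>x\<in>carrier P. \<forall>y\<in>carrier P. f (x \<oplus>\<^bsub>P\<^esub> y) = f x \<oplus>\<^bsub>Q\<^esub> f y)"

lemma additiveI:
  assumes "\<And>x. x \<in> carrier P \<Longrightarrow> f x \<in> carrier Q"
    and "\<And>x y. \<lbrakk>x \<in> carrier P; y \<in> carrier P\<rbrakk> \<Longrightarrow> f (x \<oplus>\<^bsub>P\<^esub> y) = f x \<oplus>\<^bsub>Q\<^esub> f y"
  shows "additive P Q f"
  using assms by (auto simp: additive_def)

lemma additive_closed: "additive P Q f \<Longrightarrow> x \<in> carrier P \<Longrightarrow> f x \<in> carrier Q"
  by (auto simp: additive_def)

lemma additive_add: "additive P Q f \<Longrightarrow> x \<in> carrier P \<Longrightarrow> y \<in> carrier P \<Longrightarrow> f (x \<oplus>\<^bsub>P\<^esub> y) = f x \<oplus>\<^bsub>Q\<^esub> f y"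
  by (auto simp: additive_def)

lemma additive_comp: "additive P Q f \<Longrightarrow> additive Q U g \<Longrightarrow> additive P U (\<lambda>x. g (f x))"
  by (auto simp: additive_def)

lemma additive_id: "additive P P (\<lambda>x. x)"
  by (auto simp: additive_def)

lemma additive_group_hom:
  assumes "abelian_group P" "abelian_group Q" "additive P Q f"
  shows "group_hom (add_monoid P) (add_monoid Q) f"
  using assms by (intro group_hom.intro group_hom_axioms.intro homI)
    (auto simp: additive_def abelian_group.a_group)

lemma additive_zero:
  assumes "abelian_group P" "abelian_group Q" "additive P Q f"
  shows "f \<zero>\<^bsub>P\<^esub> = \<zero>\<^bsub>Q\<^esub>"
  using group_hom.hom_one[OF additive_group_hom[OF assms]] by simp

lemma additive_neg:
  assumes "abelian_group P" "abelian_group Q" "additive P Q f" "x \<in> carrier P"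
  shows "f (\<ominus>\<^bsub>P\<^esub> x) = \<ominus>\<^bsub>Q\<^esub> f x"
  using group_hom.hom_inv[OF additive_group_hom[OF assms(1-3)]] assms(4) by (simp add: a_inv_def)

lemma additive_plus:
  assumes "abelian_group Q" "additive P Q f" "additive P Q g"
  shows "additive P Q (\<lambda>x. f x \<oplus>\<^bsub>Q\<^esub> g x)"
proof -
  interpret Q: abelian_group Q by fact
  show ?thesis using assms(2,3) by (auto simp: additive_def Q.a_ac)
qed

text \<open>Balanced biadditive maps \<open>M \<times> N \<rightarrow> P\<close> over \<open>R\<close>. Of \<open>N\<close> only the left action of \<open>R\<close>
  matters, of \<open>P\<close> only the additive group.\<close>

definition balanced ::
  "('r, 'w) ring_scheme \<Rightarrow> ('r, 'm, 'y) rmod_scheme \<Rightarrow> ('r, 's, 'n, 'x) bimod_scheme \<Rightarrow>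
    ('p, 'v) ring_scheme \<Rightarrow> ('m \<Rightarrow> 'n \<Rightarrow> 'p) \<Rightarrow> bool" where
  "balanced R M N P \<beta> \<longleftrightarrow>
     (\<forall>n\<in>carrier N. additive M P (\<lambda>m. \<beta> m n)) \<and>
     (\<forall>m\<in>carrier M. additive N P (\<beta> m)) \<and>
     (\<forall>m\<in>carrier M. \<forall>r\<in>carrier R. \<forall>n\<in>carrier N. \<beta> (m \<triangleleft>\<^bsub>M\<^esub> r) n = \<beta> m (r \<triangleright>\<^bsub>N\<^esub> n))"

lemma balancedI:
  assumes "\<And>n. n \<in> carrier N \<Longrightarrow> additive M P (\<lambda>m. \<beta> m n)"
    and "\<And>m. m \<in> carrier M \<Longrightarrow> additive N P (\<beta> m)"
    and "\<And>m r n. \<lbrakk>m \<in> carrier M; r \<in> carrier R; n \<in> carrier N\<rbrakk> \<Longrightarrow> \<beta> (m \<triangleleft>\<^bsub>M\<^esub> r) n = \<beta> m (r \<triangleright>\<^bsub>N\<^esub> n)"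
  shows "balanced R M N P \<beta>"
  using assms by (auto simp: balanced_def)

lemma balancedD:
  assumes "balanced R M N P \<beta>"
  shows "n \<in> carrier N \<Longrightarrow> additive M P (\<lambda>m. \<beta> m n)"
    and "m \<in> carrier M \<Longrightarrow> additive N P (\<beta> m)"
    and "\<lbrakk>m \<in> carrier M; r \<in> carrier R; n \<in> carrier N\<rbrakk> \<Longrightarrow> \<beta> (m \<triangleleft>\<^bsub>M\<^esub> r) n = \<beta> m (r \<triangleright>\<^bsub>N\<^esub> n)"
    and "\<lbrakk>m \<in> carrier M; n \<in> carrier N\<rbrakk> \<Longrightarrow> \<beta> m n \<in> carrier P"
  using assms by (auto simp: balanced_def additive_def)

lemma balanced_comp:
  assumes "balanced R M N P \<beta>" "additive P Q f"
  shows "balanced R M N Q (\<lambda>m n. f (\<beta> m n))"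
  using assms by (auto simp: balanced_def intro: additive_comp)

lemma balanced_plus:
  assumes "abelian_group P" "balanced R M N P \<beta>" "balanced R M N P \<gamma>"
  shows "balanced R M N P (\<lambda>m n. \<beta> m n \<oplus>\<^bsub>P\<^esub> \<gamma> m n)"
  using assms by (auto simp: balanced_def intro: additive_plus)

section \<open>Bimodules over rings of different types\<close>

text \<open>Bimodules as in \<open>bimodule\<close>, but with separate element types for the two rings, as
  required for \<open>C\<close> as a bimodule over \<open>C\<^sup>*\<close> and \<open>A\<close>.\<close>

locale bimod_over = L: ring R + right_module S M
  for R :: "('r, 'w) ring_scheme" (structure) and S :: "('s, 'v) ring_scheme" (structure)
    and M :: "('r, 's, 'm, 'x) bimod_scheme" (structure) +
  assumes lact_closed: "\<lbrakk>r \<in> carrier R; m \<in> carrier M\<rbrakk> \<Longrightarrow> r \<triangleright>\<^bsub>M\<^esub> m \<in> carrier M"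
    and lact_add_right: "\<lbrakk>r \<in> carrier R; m \<in> carrier M; n \<in> carrier M\<rbrakk> \<Longrightarrow>
      r \<triangleright>\<^bsub>M\<^esub> (m \<oplus>\<^bsub>M\<^esub> n) = r \<triangleright>\<^bsub>M\<^esub> m \<oplus>\<^bsub>M\<^esub> r \<triangleright>\<^bsub>M\<^esub> n"
    and lact_add_left: "\<lbrakk>r \<in> carrier R; r' \<in> carrier R; m \<in> carrier M\<rbrakk> \<Longrightarrow>
      (r \<oplus>\<^bsub>R\<^esub> r') \<triangleright>\<^bsub>M\<^esub> m = r \<triangleright>\<^bsub>M\<^esub> m \<oplus>\<^bsub>M\<^esub> r' \<triangleright>\<^bsub>M\<^esub> m"
    and lact_assoc: "\<lbrakk>r \<in> carrier R; r' \<in> carrier R; m \<in> carrier M\<rbrakk> \<Longrightarrow>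
      (r \<otimes>\<^bsub>R\<^esub> r') \<triangleright>\<^bsub>M\<^esub> m = r \<triangleright>\<^bsub>M\<^esub> (r' \<triangleright>\<^bsub>M\<^esub> m)"
    and lact_one: "m \<in> carrier M \<Longrightarrow> \<one>\<^bsub>R\<^esub> \<triangleright>\<^bsub>M\<^esub> m = m"
    and lact_ract: "\<lbrakk>r \<in> carrier R; m \<in> carrier M; s \<in> carrier S\<rbrakk> \<Longrightarrow>
      (r \<triangleright>\<^bsub>M\<^esub> m) \<triangleleft>\<^bsub>M\<^esub> s = r \<triangleright>\<^bsub>M\<^esub> (m \<triangleleft>\<^bsub>M\<^esub> s)"

lemma bimodule_imp_bimod_over: "bimodule R S M \<Longrightarrow> bimod_over R S M"
  by (simp add: bimodule_def bimod_over_def bimodule_axioms_def bimod_over_axioms_def)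

lemma rmod_hom_additive: "f \<in> rmod_hom S M N \<Longrightarrow> additive M N f"
  by (auto simp: rmod_hom_def additive_def)

lemma rmod_homI:
  assumes "additive M N f"
    "\<And>m s. \<lbrakk>m \<in> carrier M; s \<in> carrier S\<rbrakk> \<Longrightarrow> f (m \<triangleleft>\<^bsub>M\<^esub> s) = f m \<triangleleft>\<^bsub>N\<^esub> s"
  shows "f \<in> rmod_hom S M N"
  using assms by (auto simp: rmod_hom_def additive_def)

lemma rmod_hom_ract:
  "\<lbrakk>f \<in> rmod_hom S M N; m \<in> carrier M; s \<in> carrier S\<rbrakk> \<Longrightarrow> f (m \<triangleleft>\<^bsub>M\<^esub> s) = f m \<triangleleft>\<^bsub>N\<^esub> s"
  by (auto simp: rmod_hom_def)

lemma rmod_hom_closed: "\<lbrakk>f \<in> rmod_hom S M N; m \<in> carrier M\<rbrakk> \<Longrightarrow> f m \<in> carrier N"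
  by (auto simp: rmod_hom_def)

lemma rmod_hom_comp:
  assumes "f \<in> rmod_hom S M N" "g \<in> rmod_hom S N P"
  shows "(\<lambda>x. g (f x)) \<in> rmod_hom S M P"
  by (rule rmod_homI[OF additive_comp[OF assms[THEN rmod_hom_additive]]])
    (simp add: rmod_hom_ract[OF assms(1)] rmod_hom_ract[OF assms(2)] rmod_hom_closed[OF assms(1)])

lemma rmod_hom_restrict:
  assumes "right_module S M" "f \<in> rmod_hom S M N" "\<And>m. m \<in> carrier M \<Longrightarrow> g m = f m"
  shows "g \<in> rmod_hom S M N"
proof -
  interpret M: right_module S M by fact
  show ?thesis using assms(2,3) by (auto simp: rmod_hom_def M.ract_closed)
qed

lemma rmod_hom_plus:
  assumes "right_module S N" "f \<in> rmod_hom S M N" "g \<in> rmod_hom S M N"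
  shows "(\<lambda>m. f m \<oplus>\<^bsub>N\<^esub> g m) \<in> rmod_hom S M N"
proof -
  interpret N: right_module S N by fact
  show ?thesis
    by (rule rmod_homI[OF additive_plus[OF N.M.abelian_group_axioms assms(2,3)[THEN
        rmod_hom_additive]]])
      (simp add: rmod_hom_ract[OF assms(2)] rmod_hom_ract[OF assms(3)] N.ract_add_left
        rmod_hom_closed[OF assms(2)] rmod_hom_closed[OF assms(3)])
qed

lemma rmod_hom_inverse:
  assumes "right_module S M" "right_module S N" and f: "f \<in> rmod_hom S M N"
    and g: "\<And>n. n \<in> carrier N \<Longrightarrow> g n \<in> carrier M"
    and gf: "\<And>m. m \<in> carrier M \<Longrightarrow> g (f m) = m" and fg: "\<And>n. n \<in> carrier N \<Longrightarrow> f (g n) = n"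
  shows "g \<in> rmod_hom S N M"
proof (rule rmod_homI)
  interpret M: right_module S M by fact
  interpret N: right_module S N by fact
  show "additive N M g"
  proof (rule additiveI[OF g])
    fix x y assume "x \<in> carrier N" "y \<in> carrier N"
    then have "g (x \<oplus>\<^bsub>N\<^esub> y) = g (f (g x \<oplus>\<^bsub>M\<^esub> g y))" by (simp add: additive_add[OF
        rmod_hom_additive[OF f]] g fg)
    then show "g (x \<oplus>\<^bsub>N\<^esub> y) = g x \<oplus>\<^bsub>M\<^esub> g y" using \<open>x \<in> _\<close> \<open>y \<in> _\<close> by (simp add: gf g)
  qed
  fix n s assume n: "n \<in> carrier N" and s: "s \<in> carrier S"
  then have "g (n \<triangleleft>\<^bsub>N\<^esub> s) = g (f (g n \<triangleleft>\<^bsub>M\<^esub> s))" by (simp add: rmod_hom_ract[OF f] g fg)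
  then show "g (n \<triangleleft>\<^bsub>N\<^esub> s) = g n \<triangleleft>\<^bsub>M\<^esub> s" using n s by (simp add: gf g M.ract_closed)
qed

lemma rmod_isoI:
  assumes "right_module S M" "right_module S N" "f \<in> rmod_hom S M N"
    and "\<And>n. n \<in> carrier N \<Longrightarrow> g n \<in> carrier M"
    and "\<And>m. m \<in> carrier M \<Longrightarrow> g (f m) = m" and "\<And>n. n \<in> carrier N \<Longrightarrow> f (g n) = n"
  shows "f \<in> rmod_iso S M N"
  using rmod_hom_inverse[OF assms] assms(3,5,6) by (auto simp: rmod_iso_def)

lemma (in right_module) additive_ract: "r \<in> carrier R \<Longrightarrow> additive M M (\<lambda>m. m \<triangleleft>\<^bsub>M\<^esub> r)"
  by (intro additiveI ract_closed ract_add_left)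

lemma (in right_module) additive_ract_right: "m \<in> carrier M \<Longrightarrow> additive R M (\<lambda>r. m \<triangleleft>\<^bsub>M\<^esub> r)"
  by (intro additiveI ract_closed ract_add_right)

lemma (in bimod_over) additive_lact: "r \<in> carrier R \<Longrightarrow> additive M M (\<lambda>m. r \<triangleright>\<^bsub>M\<^esub> m)"
  by (intro additiveI lact_closed lact_add_right)

lemma (in bimod_over) additive_lact_left: "m \<in> carrier M \<Longrightarrow> additive R M (\<lambda>r. r \<triangleright>\<^bsub>M\<^esub> m)"
  by (intro additiveI lact_closed lact_add_left)

lemma right_moduleI:
  assumes "ring R" "abelian_group M"
    and "\<And>r. r \<in> carrier R \<Longrightarrow> additive M M (\<lambda>m. m \<triangleleft>\<^bsub>M\<^esub> r)"
    and "\<And>m. m \<in> carrier M \<Longrightarrow> additive R M (\<lambda>r. m \<triangleleft>\<^bsub>M\<^esub> r)"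
    and "\<And>m r s. \<lbrakk>m \<in> carrier M; r \<in> carrier R; s \<in> carrier R\<rbrakk> \<Longrightarrow>
      m \<triangleleft>\<^bsub>M\<^esub> (r \<otimes>\<^bsub>R\<^esub> s) = (m \<triangleleft>\<^bsub>M\<^esub> r) \<triangleleft>\<^bsub>M\<^esub> s"
    and "\<And>m. m \<in> carrier M \<Longrightarrow> m \<triangleleft>\<^bsub>M\<^esub> \<one>\<^bsub>R\<^esub> = m"
  shows "right_module R M"
  using assms by (auto intro!: right_module.intro right_module_axioms.intro simp: additive_def)

lemma bimod_overI:
  assumes "ring R" "right_module S M"
    and "\<And>r. r \<in> carrier R \<Longrightarrow> additive M M (\<lambda>m. r \<triangleright>\<^bsub>M\<^esub> m)"
    and "\<And>m. m \<in> carrier M \<Longrightarrow> additive R M (\<lambda>r. r \<triangleright>\<^bsub>M\<^esub> m)"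
    and "\<And>m r s. \<lbrakk>m \<in> carrier M; r \<in> carrier R; s \<in> carrier R\<rbrakk> \<Longrightarrow>
      (r \<otimes>\<^bsub>R\<^esub> s) \<triangleright>\<^bsub>M\<^esub> m = r \<triangleright>\<^bsub>M\<^esub> (s \<triangleright>\<^bsub>M\<^esub> m)"
    and "\<And>m. m \<in> carrier M \<Longrightarrow> \<one>\<^bsub>R\<^esub> \<triangleright>\<^bsub>M\<^esub> m = m"
    and "\<And>m r s. \<lbrakk>r \<in> carrier R; m \<in> carrier M; s \<in> carrier S\<rbrakk> \<Longrightarrow> (r \<triangleright>\<^bsub>M\<^esub> m) \<triangleleft>\<^bsub>M\<^esub> s = r \<triangleright>\<^bsub>M\<^esub> (m
        \<triangleleft>\<^bsub>M\<^esub> s)"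
  shows "bimod_over R S M"
  using assms by (auto intro!: bimod_over.intro bimod_over_axioms.intro simp: additive_def)

section \<open>The tensor product and its universal property\<close>

text \<open>The additive extension of \<open>b\<close> to formal integer combinations. By definition,
  \<open>tensor_lift P \<beta>\<close> takes the common value of this extension on a coset.\<close>

definition frag_eval :: "('p, 'v) ring_scheme \<Rightarrow> ('k \<Rightarrow> 'p) \<Rightarrow> ('k \<Rightarrow>\<^sub>0 int) \<Rightarrow> 'p" where
  "frag_eval P b w = finsum P (\<lambda>k. [Poly_Mapping.lookup w k] \<cdot>\<^bsub>P\<^esub> b k) (Poly_Mapping.keys w)"

lemma frag_eval_superset:
  assumes "abelian_group P" "b ` S \<subseteq> carrier P" "finite K" "Poly_Mapping.keys w \<subseteq> K" "K \<subseteq> S"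
  shows "frag_eval P b w = finsum P (\<lambda>k. [Poly_Mapping.lookup w k] \<cdot>\<^bsub>P\<^esub> b k) K"
proof -
  interpret P: abelian_group P by fact
  have z: "[(0::int)] \<cdot>\<^bsub>P\<^esub> y = \<zero>\<^bsub>P\<^esub>" for y by (simp add: add_pow_def)
  show ?thesis unfolding frag_eval_def using assms(2-5)
    by (intro P.add.finprod_mono_neutral_cong_left)
      (auto simp: in_keys_iff z intro!: P.add.int_pow_closed)
qed

lemma frag_eval_hom:
  assumes "abelian_group P" "b ` S \<subseteq> carrier P"
  shows "frag_eval P b \<in> hom (free_Abelian_group S) (add_monoid P)"
proof (rule homI)
  interpret P: abelian_group P by fact
  fix v w assume "v \<in> carrier (free_Abelian_group S)" "w \<in> carrier (free_Abelian_group S)"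
  then have vw: "Poly_Mapping.keys v \<subseteq> S" "Poly_Mapping.keys w \<subseteq> S" by auto
  show "frag_eval P b v \<in> carrier (add_monoid P)"
    unfolding frag_eval_def using assms vw by (auto intro!: P.finsum_closed P.add.int_pow_closed)
  let ?K = "Poly_Mapping.keys v \<union> Poly_Mapping.keys w"
  have b: "b k \<in> carrier P" if "k \<in> ?K" for k using that vw assms(2) by auto
  have "frag_eval P b (v + w) = finsum P (\<lambda>k. [Poly_Mapping.lookup (v + w) k] \<cdot>\<^bsub>P\<^esub> b k) ?K"
    using vw assms(2) by (intro frag_eval_superset[OF assms(1)] keys_add) auto
  also have "\<dots> = finsum P (\<lambda>k. [Poly_Mapping.lookup v k] \<cdot>\<^bsub>P\<^esub> b k \<oplus>\<^bsub>P\<^esub> [Poly_Mapping.lookup w k]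
      \<cdot>\<^bsub>P\<^esub> b k) ?K"
    using b by (intro P.finsum_cong) (auto simp: lookup_add P.add.int_pow_mult simp_implies_def)
  also have "\<dots> = finsum P (\<lambda>k. [Poly_Mapping.lookup v k] \<cdot>\<^bsub>P\<^esub> b k) ?K \<oplus>\<^bsub>P\<^esub> finsum P (\<lambda>k.
      [Poly_Mapping.lookup w k] \<cdot>\<^bsub>P\<^esub> b k) ?K"
    using b by (intro P.finsum_addf) auto
  also have "\<dots> = frag_eval P b v \<oplus>\<^bsub>P\<^esub> frag_eval P b w"
    using vw assms(2) by (subst (1 2) frag_eval_superset[OF assms(1), where K="?K"]) auto
  finally show "frag_eval P b (v \<otimes>\<^bsub>free_Abelian_group S\<^esub> w) = frag_eval P b v \<otimes>\<^bsub>add_monoid P\<^esub>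
      frag_eval P b w"
    by simp
qed

lemma frag_eval_of:
  assumes "abelian_group P" "b k \<in> carrier P"
  shows "frag_eval P b (frag_of k) = b k"
proof -
  interpret P: abelian_group P by fact
  show ?thesis unfolding frag_eval_def using assms(2) by (simp add: P.add.int_pow_1)
qed

text \<open>A right \<open>R\<close>-module \<open>M\<close> and an \<open>R\<close>-\<open>S\<close>-bimodule \<open>N\<close>; \<open>T\<close> is the abelian group \<open>M \<otimes>\<^sub>R N\<close>,
  and \<open>cls w\<close> is the element represented by the formal combination \<open>w\<close>.\<close>

locale tensor_product = M: right_module R M + N: bimod_over R S N
  for R :: "('r, 'w) ring_scheme" (structure) and S :: "('s, 'v) ring_scheme" (structure)
    and M :: "('r, 'm, 'y) rmod_scheme" (structure) and N :: "('r, 's, 'n, 'x) bimod_scheme"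
        (structure)
begin

abbreviation "FM \<equiv> free_Abelian_group (carrier M \<times> carrier N)"
abbreviation "K \<equiv> tensor_kernel R M N"
abbreviation "T \<equiv> tensor_group R M N"

sublocale FM: comm_group FM
  by (rule abelian_free_Abelian_group)

lemma tensor_relations_carrier: "tensor_relations R M N \<subseteq> carrier FM"
proof -
  have d2: "v - w \<in> carrier FM" if "v \<in> carrier FM" "w \<in> carrier FM" for v w
    using that keys_diff[of v w] by auto
  have f: "frag_of (m, n) \<in> carrier FM" if "m \<in> carrier M" "n \<in> carrier N" for m n
    using that by simp
  show ?thesis
    unfolding tensor_relations_def
    by (auto simp del: carrier_free_Abelian_group_iff
        intro!: d2 f M.ract_closed N.lact_closed M.M.a_closed N.M.a_closed)
qed

lemma kernel_subgroup: "subgroup K FM"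
  unfolding tensor_kernel_def by (rule FM.generate_is_subgroup[OF tensor_relations_carrier])

lemma kernel_normal: "K \<lhd> FM"
  using kernel_subgroup by (rule FM.subgroup_imp_normal)

lemma relation_in_kernel: "x \<in> tensor_relations R M N \<Longrightarrow> x \<in> K"
  unfolding tensor_kernel_def by (rule generate.incl)

lemma abelian_group_tensor_group: "abelian_group T"
proof -
  interpret Q: comm_group "FM Mod K"
    using kernel_subgroup by (rule FM.abelian_FactGroup)
  have "add_monoid T = FM Mod K"
    by (simp add: tensor_group_def Let_def FactGroup_def)
  then have "comm_group (add_monoid T)" using Q.comm_group_axioms by simp
  then show ?thesis
    by (intro abelian_group.intro abelian_group_axioms.intro abelian_monoid.intro) (simp_all add:
        comm_group.axioms)
qed

sublocale T: abelian_group T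
  by (rule abelian_group_tensor_group)

abbreviation "cls w \<equiv> K #>\<^bsub>FM\<^esub> w"

lemma carrier_tensor_group: "carrier T = cls ` carrier FM"
  by (simp add: tensor_group_def Let_def carrier_FactGroup)

lemma cls_closed: "w \<in> carrier FM \<Longrightarrow> cls w \<in> carrier T"
  by (simp only: carrier_tensor_group) (rule imageI)

lemma cls_add:
  assumes "v \<in> carrier FM" "w \<in> carrier FM" shows "cls (v + w) = cls v \<oplus>\<^bsub>T\<^esub> cls w"
proof -
  interpret normal K FM by (rule kernel_normal)
  show ?thesis using rcos_sum[OF assms] by (simp add: tensor_group_def Let_def)
qed

lemma cls_eq_0: "v \<in> K \<Longrightarrow> cls v = \<zero>\<^bsub>T\<^esub>"
  using FM.coset_join2[OF _ kernel_subgroup] subgroup.mem_carrier[OF kernel_subgroup]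
  by (simp add: tensor_group_def Let_def)

lemma group_hom_cls: "group_hom FM (add_monoid T) cls"
  by (intro group_hom.intro group_hom_axioms.intro homI)
    (simp_all only: mult_free_Abelian_group FM.is_group T.a_group cls_add cls_closed
        monoid_record_simps)

lemma cls_diff:
  assumes "v \<in> carrier FM" "w \<in> carrier FM" shows "cls (v - w) = cls v \<ominus>\<^bsub>T\<^esub> cls w"
proof -
  interpret h: group_hom FM "add_monoid T" cls by (rule group_hom_cls)
  have w: "- w \<in> carrier FM" using FM.inv_closed[OF assms(2)] assms(2) by simp
  have "cls (- w) = \<ominus>\<^bsub>T\<^esub> cls w" using h.hom_inv[OF assms(2)] assms(2) by (simp add: a_inv_def)
  then show ?thesis using cls_add[OF assms(1) w] by (simp add: a_minus_def)
qed

lemma frag_carrier: "m \<in> carrier M \<Longrightarrow> n \<in> carrier N \<Longrightarrow> frag_of (m, n) \<in> carrier FM"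
  by simp

lemma tens_closed: "m \<in> carrier M \<Longrightarrow> n \<in> carrier N \<Longrightarrow> tens R M N m n \<in> carrier T"
  unfolding tens_def by (rule cls_closed[OF frag_carrier])

lemma cls_eqI:
  assumes "v - w \<in> K" "v \<in> carrier FM" "w \<in> carrier FM"
  shows "cls v = cls w"
proof -
  have "cls v = cls ((v - w) + w)" by simp
  also have "\<dots> = cls (v - w) \<oplus>\<^bsub>T\<^esub> cls w"
    using assms subgroup.mem_carrier[OF kernel_subgroup] by (intro cls_add)
  also have "\<dots> = cls w" using assms by (simp add: cls_eq_0 cls_closed del:
      carrier_free_Abelian_group_iff)
  finally show ?thesis .
qed

lemma tens_add_left:
  assumes "m \<in> carrier M" "m' \<in> carrier M" "n \<in> carrier N"
  shows "tens R M N (m \<oplus>\<^bsub>M\<^esub> m') n = tens R M N m n \<oplus>\<^bsub>T\<^esub> tens R M N m' n"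
proof -
  have "frag_of (m \<oplus>\<^bsub>M\<^esub> m', n) - (frag_of (m, n) + frag_of (m', n)) \<in> K"
    unfolding diff_diff_eq[symmetric] using assms
    by (intro relation_in_kernel) (auto simp: tensor_relations_def)
  moreover have "frag_of (m, n) + frag_of (m', n) \<in> carrier FM"
    using FM.m_closed[OF frag_carrier[OF assms(1,3)] frag_carrier[OF assms(2,3)]]
    by (simp del: carrier_free_Abelian_group_iff)
  ultimately have "tens R M N (m \<oplus>\<^bsub>M\<^esub> m') n = cls (frag_of (m, n) + frag_of (m', n))"
    unfolding tens_def using assms by (intro cls_eqI frag_carrier M.M.a_closed)
  then show ?thesis unfolding tens_def using cls_add[OF frag_carrier frag_carrier] assms by simp
qed

lemma tens_add_right:
  assumes "m \<in> carrier M" "n' \<in> carrier N" "n \<in> carrier N"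
  shows "tens R M N m (n \<oplus>\<^bsub>N\<^esub> n') = tens R M N m n \<oplus>\<^bsub>T\<^esub> tens R M N m n'"
proof -
  have "frag_of (m, n \<oplus>\<^bsub>N\<^esub> n') - (frag_of (m, n) + frag_of (m, n')) \<in> K"
    unfolding diff_diff_eq[symmetric] using assms
    by (intro relation_in_kernel) (auto simp: tensor_relations_def)
  moreover have "frag_of (m, n) + frag_of (m, n') \<in> carrier FM"
    using FM.m_closed[OF frag_carrier[OF assms(1,3)] frag_carrier[OF assms(1,2)]]
    by (simp del: carrier_free_Abelian_group_iff)
  ultimately have "tens R M N m (n \<oplus>\<^bsub>N\<^esub> n') = cls (frag_of (m, n) + frag_of (m, n'))"
    unfolding tens_def using assms by (intro cls_eqI frag_carrier N.M.a_closed)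
  then show ?thesis unfolding tens_def using cls_add[OF frag_carrier frag_carrier] assms by simp
qed

lemma tens_ract_left:
  assumes "m \<in> carrier M" "r \<in> carrier R" "n \<in> carrier N"
  shows "tens R M N (m \<triangleleft>\<^bsub>M\<^esub> r) n = tens R M N m (r \<triangleright>\<^bsub>N\<^esub> n)"
proof -
  have "frag_of (m \<triangleleft>\<^bsub>M\<^esub> r, n) - frag_of (m, r \<triangleright>\<^bsub>N\<^esub> n) \<in> K"
    using assms by (intro relation_in_kernel) (auto simp: tensor_relations_def)
  then show ?thesis
    unfolding tens_def using assms by (intro cls_eqI frag_carrier M.ract_closed N.lact_closed)
qed

lemma tens_balanced: "balanced R M N T (tens R M N)"
  by (intro balancedI additiveI tens_closed tens_add_left tens_add_right tens_ract_left)

lemma tens_neg_left: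
  assumes "m \<in> carrier M" "n \<in> carrier N"
  shows "tens R M N (\<ominus>\<^bsub>M\<^esub> m) n = \<ominus>\<^bsub>T\<^esub> tens R M N m n"
  using additive_neg[OF M.M.abelian_group_axioms abelian_group_tensor_group
      balancedD(1)[OF tens_balanced assms(2)] assms(1)] .

lemma tens_zero_left:
  assumes "n \<in> carrier N"
  shows "tens R M N \<zero>\<^bsub>M\<^esub> n = \<zero>\<^bsub>T\<^esub>"
  using additive_zero[OF M.M.abelian_group_axioms abelian_group_tensor_group
      balancedD(1)[OF tens_balanced assms]] .

text \<open>Negatives are absorbed into the left factor, so the sums of pure tensors are all of
  \<open>M \<otimes>\<^sub>R N\<close>.\<close>

lemma tensor_induct [consumes 1, case_names tens add]:
  assumes X: "X \<in> carrier T"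
    and t: "\<And>m n. \<lbrakk>m \<in> carrier M; n \<in> carrier N\<rbrakk> \<Longrightarrow> Q (tens R M N m n)"
    and a: "\<And>X Y. \<lbrakk>X \<in> carrier T; Y \<in> carrier T; Q X; Q Y\<rbrakk> \<Longrightarrow> Q (X \<oplus>\<^bsub>T\<^esub> Y)"
  shows "Q X"
proof -
  from X obtain w where w: "w \<in> carrier FM" "X = cls w"
    unfolding carrier_tensor_group by (rule imageE)
  have z: "Q \<zero>\<^bsub>T\<^esub>" using t[OF M.M.zero_closed N.M.zero_closed] by (simp add: tens_zero_left)
  have "Poly_Mapping.keys w \<subseteq> carrier M \<times> carrier N" using w(1) by simp
  then have "w \<in> carrier FM \<and> Q (cls w) \<and> Q (\<ominus>\<^bsub>T\<^esub> cls w)"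
  proof (induction w rule: frag_induction)
    case zero
    have "cls 0 = \<zero>\<^bsub>T\<^esub>" using cls_eq_0 subgroup.one_closed[OF kernel_subgroup] by simp
    moreover have "\<ominus>\<^bsub>T\<^esub> \<zero>\<^bsub>T\<^esub> = \<zero>\<^bsub>T\<^esub>" using T.r_neg[OF T.zero_closed] by simp
    then have "Q (\<ominus>\<^bsub>T\<^esub> \<zero>\<^bsub>T\<^esub>)" using z by (simp only:)
    ultimately show ?case using z by simp
  next
    case (one k)
    then obtain m n where "k = (m, n)" "m \<in> carrier M" "n \<in> carrier N" by auto
    then show ?case using t[of m n] t[of "\<ominus>\<^bsub>M\<^esub> m" n] tens_neg_left by (simp add: tens_def)
  next
    case (diff v w)
    then have c: "v \<in> carrier FM" "w \<in> carrier FM" by blast+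
    have "v - w \<in> carrier FM" using c keys_diff[of v w] by auto
    moreover have "cls (v - w) = cls v \<oplus>\<^bsub>T\<^esub> \<ominus>\<^bsub>T\<^esub> cls w" using cls_diff[OF c] by (simp add:
        a_minus_def)
    moreover have "\<ominus>\<^bsub>T\<^esub> cls (v - w) = \<ominus>\<^bsub>T\<^esub> cls v \<oplus>\<^bsub>T\<^esub> cls w"
      using c by (simp add: \<open>cls (v - w) = _\<close> T.minus_add cls_closed del:
          carrier_free_Abelian_group_iff)
    ultimately show ?case using diff a c
      by (auto intro!: a cls_closed T.a_inv_closed simp del: carrier_free_Abelian_group_iff)
  qed
  then show ?thesis using w(2) by simp
qed

text \<open>The extension of a balanced map vanishes on the defining relations, so it is constant
  on cosets.\<close>

lemma lift_cls:
  assumes P: "abelian_group P" and \<beta>: "balanced R M N P \<beta>" and w: "w \<in> carrier FM"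
  shows "tensor_lift P \<beta> (cls w) = frag_eval P (\<lambda>k. \<beta> (fst k) (snd k)) w"
proof -
  interpret P: abelian_group P by fact
  let ?e = "frag_eval P (\<lambda>k. \<beta> (fst k) (snd k))"
  have im: "(\<lambda>k. \<beta> (fst k) (snd k)) ` (carrier M \<times> carrier N) \<subseteq> carrier P"
    using balancedD(4)[OF \<beta>] by auto
  interpret h: group_hom FM "add_monoid P" ?e
    by (intro group_hom.intro group_hom_axioms.intro FM.is_group P.a_group frag_eval_hom P im)
  have fr: "?e (frag_of (m, n)) = \<beta> m n" if "m \<in> carrier M" "n \<in> carrier N" for m n
    using frag_eval_of[OF P, of "\<lambda>k. \<beta> (fst k) (snd k)" "(m, n)"] balancedD(4)[OF \<beta> that] by simp
  have minus: "v - w \<in> carrier FM \<and> ?e (v - w) = ?e v \<ominus>\<^bsub>P\<^esub> ?e w"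
    if "v \<in> carrier FM" "w \<in> carrier FM" for v w
    using h.hom_mult[OF that(1) FM.inv_closed[OF that(2)]] h.hom_inv[OF that(2)]
      FM.m_closed[OF that(1) FM.inv_closed[OF that(2)]] that
    by (simp add: a_minus_def a_inv_def)
  have "tensor_relations R M N \<subseteq> kernel FM (add_monoid P) ?e"
  proof
    fix x assume "x \<in> tensor_relations R M N"
    then consider
      (l) m m' n where "x = frag_of (m \<oplus>\<^bsub>M\<^esub> m', n) - frag_of (m, n) - frag_of (m', n)"
        "m \<in> carrier M" "m' \<in> carrier M" "n \<in> carrier N"
      | (r) m n n' where "x = frag_of (m, n \<oplus>\<^bsub>N\<^esub> n') - frag_of (m, n) - frag_of (m, n')"
        "m \<in> carrier M" "n \<in> carrier N" "n' \<in> carrier N"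
      | (b) m r n where "x = frag_of (m \<triangleleft>\<^bsub>M\<^esub> r, n) - frag_of (m, r \<triangleright>\<^bsub>N\<^esub> n)"
        "m \<in> carrier M" "r \<in> carrier R" "n \<in> carrier N"
      unfolding tensor_relations_def by blast
    then have "x \<in> carrier FM \<and> ?e x = \<zero>\<^bsub>P\<^esub>"
    proof cases
      case l
      have c: "\<beta> m n \<in> carrier P" "\<beta> m' n \<in> carrier P" using l balancedD(4)[OF \<beta>] by auto
      show ?thesis using l minus frag_carrier fr c balancedD(1)[OF \<beta>, of n]
        by (simp add: additive_def P.minus_eq P.a_ac P.r_neg P.r_neg2 P.minus_add del:
            carrier_free_Abelian_group_iff)
    next
      case r
      have c: "\<beta> m n \<in> carrier P" "\<beta> m n' \<in> carrier P" using r balancedD(4)[OF \<beta>] by auto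
      show ?thesis using r minus frag_carrier fr c balancedD(2)[OF \<beta>, of m]
        by (simp add: additive_def P.minus_eq P.a_ac P.r_neg P.r_neg2 P.minus_add del:
            carrier_free_Abelian_group_iff)
    next
      case b
      then show ?thesis using minus frag_carrier fr balancedD(3,4)[OF \<beta>] M.ract_closed N.lact_closed
        by (simp add: P.minus_eq P.r_neg del: carrier_free_Abelian_group_iff)
    qed
    then show "x \<in> kernel FM (add_monoid P) ?e" by (simp add: kernel_def)
  qed
  then have "K \<subseteq> kernel FM (add_monoid P) ?e"
    unfolding tensor_kernel_def by (intro FM.generate_subgroup_incl h.subgroup_kernel)
  then have k: "?e v = \<zero>\<^bsub>P\<^esub>" "v \<in> carrier FM" if "v \<in> K" for v using that by (auto simp: kernel_def)
  have "?e ` cls w = {?e w}"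
  proof -
    have "?e (v \<otimes>\<^bsub>FM\<^esub> w) = ?e w" if "v \<in> K" for v
      using h.hom_mult[OF k(2)[OF that] w] k(1)[OF that] h.hom_closed[OF w] by simp
    moreover have "w \<in> cls w" using FM.rcos_self[OF w kernel_subgroup] .
    ultimately show ?thesis by (fastforce simp: r_coset_def simp del: mult_free_Abelian_group)
  qed
  then show ?thesis unfolding tensor_lift_def frag_eval_def by simp
qed

lemma lift_tens:
  assumes P: "abelian_group P" and \<beta>: "balanced R M N P \<beta>" and "m \<in> carrier M" "n \<in> carrier N"
  shows "tensor_lift P \<beta> (tens R M N m n) = \<beta> m n"
  using assms lift_cls[OF P \<beta> frag_carrier] frag_eval_of[OF P, of "\<lambda>k. \<beta> (fst k) (snd k)" "(m,
      n)"] balancedD(4)[OF \<beta>]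
  by (simp add: tens_def)

lemma lift_additive:
  assumes P: "abelian_group P" and \<beta>: "balanced R M N P \<beta>"
  shows "additive T P (tensor_lift P \<beta>)"
proof -
  have im: "(\<lambda>k. \<beta> (fst k) (snd k)) ` (carrier M \<times> carrier N) \<subseteq> carrier P"
    using balancedD(4)[OF \<beta>] by auto
  note h = frag_eval_hom[OF P im]
  show ?thesis
  proof (rule additiveI)
    fix X assume "X \<in> carrier T"
    then obtain v where v: "v \<in> carrier FM" "X = cls v" unfolding carrier_tensor_group by (rule
        imageE)
    then show "tensor_lift P \<beta> X \<in> carrier P" using lift_cls[OF P \<beta>] hom_in_carrier[OF h] by simp
    fix Y assume "Y \<in> carrier T"
    then obtain w where w: "w \<in> carrier FM" "Y = cls w" unfolding carrier_tensor_group by (rule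
        imageE)
    have "X \<oplus>\<^bsub>T\<^esub> Y = cls (v + w)" "v + w \<in> carrier FM"
      using cls_add v w FM.m_closed[OF v(1) w(1)] by simp_all
    then show "tensor_lift P \<beta> (X \<oplus>\<^bsub>T\<^esub> Y) = tensor_lift P \<beta> X \<oplus>\<^bsub>P\<^esub> tensor_lift P \<beta> Y"
      using v w lift_cls[OF P \<beta>] hom_mult[OF h v(1) w(1)] by simp
  qed
qed

text \<open>Additive maps on a tensor product agree if they agree on pure tensors.\<close>

lemma tensor_ext:
  assumes "additive T P f" "additive T P g" "X \<in> carrier T"
    and "\<And>m n. \<lbrakk>m \<in> carrier M; n \<in> carrier N\<rbrakk> \<Longrightarrow> f (tens R M N m n) = g (tens R M N m n)"
  shows "f X = g X"
  using assms(3) by (induction X rule: tensor_induct) (use assms in \<open>auto simp: additive_def\<close>)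

end

section \<open>Module structures on a tensor product and calculus of induced maps\<close>

lemma tensor_simps [simp]:
  "carrier (tensor R M N) = carrier (tensor_group R M N)"
  "add (tensor R M N) = add (tensor_group R M N)"
  "zero (tensor R M N) = zero (tensor_group R M N)"
  "carrier (bitensor R L N) = carrier (tensor_group R L N)"
  "add (bitensor R L N) = add (tensor_group R L N)"
  "zero (bitensor R L N) = zero (tensor_group R L N)"
  "ract (bitensor R L N) = ract (tensor R L N)"
  by (simp_all add: tensor_def bitensor_def ring.defs rmod.defs bimod.defs)

lemma tensor_ract:
  "X \<triangleleft>\<^bsub>tensor R M N\<^esub> s = tensor_lift (tensor_group R M N) (\<lambda>m n. tens R M N m (n \<triangleleft>\<^bsub>N\<^esub> s)) X"
  by (simp add: tensor_def ring.defs rmod.defs)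

lemma bitensor_lact:
  "q \<triangleright>\<^bsub>bitensor R M N\<^esub> X = tensor_lift (tensor_group R M N) (\<lambda>m n. tens R M N (q \<triangleright>\<^bsub>M\<^esub> m) n) X"
  by (simp add: bitensor_def rmod.defs bimod.defs)

lemma abelian_group_cong:
  assumes "abelian_group P" "carrier Q = carrier P" "add Q = add P" "zero Q = zero P"
  shows "abelian_group Q"
  using abelian_groupE[OF assms(1)] assms(2-4) by (intro abelian_groupI) simp_all

lemma tensor_additive [simp]:
  "additive (tensor R M N) P = additive (tensor_group R M N) P"
  "additive (bitensor R L N) P = additive (tensor_group R L N) P"
  "additive Q (tensor R M N) = additive Q (tensor_group R M N)"
  "additive Q (bitensor R L N) = additive Q (tensor_group R L N)"
  by (simp_all add: additive_def fun_eq_iff)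

lemma tensor_balanced [simp]:
  "balanced R' M' N' (tensor R M N) = balanced R' M' N' (tensor_group R M N)"
  "balanced R' M' N' (bitensor R L N) = balanced R' M' N' (tensor_group R L N)"
  by (simp_all add: balanced_def fun_eq_iff)

text \<open>An induced map depends on its target only through the additive group.\<close>

lemma tensor_lift_struct_cong:
  assumes "carrier P = carrier Q" "add P = add Q" "zero P = zero Q"
  shows "tensor_lift P = tensor_lift Q"
  by (intro ext) (simp add: assms tensor_lift_def finsum_def add_pow_def finprod_def int_pow_def
      nat_pow_def m_inv_def Let_def cong: if_cong)

lemma tensor_lift_tensor [simp]:
  "tensor_lift (tensor R M N) = tensor_lift (tensor_group R M N)"
  "tensor_lift (bitensor R L N) = tensor_lift (tensor_group R L N)"
  by (rule tensor_lift_struct_cong; simp)+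

context tensor_product
begin

lemma balanced_cong:
  assumes "balanced R M N P \<beta>"
    and "\<And>m n. \<lbrakk>m \<in> carrier M; n \<in> carrier N\<rbrakk> \<Longrightarrow> \<gamma> m n = \<beta> m n"
  shows "balanced R M N P \<gamma>"
  using assms M.ract_closed N.lact_closed M.M.a_closed N.M.a_closed
  by (auto simp: balanced_def additive_def)

lemma lift_closed:
  "\<lbrakk>abelian_group P; balanced R M N P \<beta>; X \<in> carrier T\<rbrakk> \<Longrightarrow> tensor_lift P \<beta> X \<in> carrier P"
  by (rule additive_closed[OF lift_additive])

lemma lift_unique:
  assumes "abelian_group P" "balanced R M N P \<beta>" "additive T P f" "X \<in> carrier T"
    and "\<And>m n. \<lbrakk>m \<in> carrier M; n \<in> carrier N\<rbrakk> \<Longrightarrow> f (tens R M N m n) = \<beta> m n"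
  shows "f X = tensor_lift P \<beta> X"
  by (rule tensor_ext[OF assms(3) lift_additive[OF assms(1,2)] assms(4)])
    (simp add: lift_tens[OF assms(1,2)] assms(5))

lemma lift_cong:
  assumes "abelian_group P" "balanced R M N P \<beta>" "X \<in> carrier T"
    and "\<And>m n. \<lbrakk>m \<in> carrier M; n \<in> carrier N\<rbrakk> \<Longrightarrow> \<gamma> m n = \<beta> m n"
  shows "tensor_lift P \<gamma> X = tensor_lift P \<beta> X"
proof -
  have g: "balanced R M N P \<gamma>" by (rule balanced_cong[OF assms(2,4)])
  show ?thesis
    by (rule lift_unique[OF assms(1,2) lift_additive[OF assms(1) g] assms(3)])
      (simp add: lift_tens[OF assms(1) g] assms(4))
qed

lemma lift_comp:
  assumes "abelian_group P" "abelian_group Q" "balanced R M N P \<beta>" "additive P Q f" "X \<in> carrier T"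
  shows "f (tensor_lift P \<beta> X) = tensor_lift Q (\<lambda>m n. f (\<beta> m n)) X"
  by (rule lift_unique[OF assms(2) balanced_comp[OF assms(3,4)] additive_comp[OF lift_additive[OF
      assms(1,3)] assms(4)] assms(5)])
    (simp add: lift_tens[OF assms(1,3)])

lemma lift_plus:
  assumes "abelian_group P" "balanced R M N P \<beta>" "balanced R M N P \<gamma>" "X \<in> carrier T"
  shows "tensor_lift P (\<lambda>m n. \<beta> m n \<oplus>\<^bsub>P\<^esub> \<gamma> m n) X = tensor_lift P \<beta> X \<oplus>\<^bsub>P\<^esub> tensor_lift P \<gamma> X"
  by (rule sym, rule lift_unique[OF assms(1) balanced_plus[OF assms(1-3)]
        additive_plus[OF assms(1) lift_additive[OF assms(1,2)] lift_additive[OF assms(1,3)]]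
            assms(4)])
    (simp add: lift_tens assms)

lemma lift_id: "X \<in> carrier T \<Longrightarrow> tensor_lift T (tens R M N) X = X"
  by (rule lift_unique[symmetric, OF abelian_group_tensor_group tens_balanced additive_id]) simp_all

text \<open>Induced maps depend additively on parameters: this is what makes nested Sweedler
  expressions balanced.\<close>

lemma additive_lift_param:
  assumes P: "abelian_group P" and U: "abelian_group U" and X: "X \<in> carrier T"
    and b: "\<And>u. u \<in> carrier U \<Longrightarrow> balanced R M N P (\<gamma> u)"
    and a: "\<And>m n. \<lbrakk>m \<in> carrier M; n \<in> carrier N\<rbrakk> \<Longrightarrow> additive U P (\<lambda>u. \<gamma> u m n)"
  shows "additive U P (\<lambda>u. tensor_lift P (\<gamma> u) X)"
proof (rule additiveI)
  interpret U: abelian_group U by fact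
  show "tensor_lift P (\<gamma> u) X \<in> carrier P" if "u \<in> carrier U" for u
    by (rule lift_closed[OF P b[OF that] X])
  fix u v assume uv: "u \<in> carrier U" "v \<in> carrier U"
  have "tensor_lift P (\<gamma> (u \<oplus>\<^bsub>U\<^esub> v)) X = tensor_lift P (\<lambda>m n. \<gamma> u m n \<oplus>\<^bsub>P\<^esub> \<gamma> v m n) X"
    by (rule lift_cong[OF P balanced_plus[OF P b[OF uv(1)] b[OF uv(2)]] X]) (rule additive_add[OF
        a uv])
  then show "tensor_lift P (\<gamma> (u \<oplus>\<^bsub>U\<^esub> v)) X = tensor_lift P (\<gamma> u) X \<oplus>\<^bsub>P\<^esub> tensor_lift P (\<gamma> v) X"
    using lift_plus[OF P b[OF uv(1)] b[OF uv(2)] X] by simp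
qed

lemma balanced_tens_right:
  assumes "s \<in> carrier S"
  shows "balanced R M N T (\<lambda>m n. tens R M N m (n \<triangleleft>\<^bsub>N\<^esub> s))"
  using assms by (intro balancedI additiveI)
    (auto simp: N.ract_closed tens_closed tens_add_left tens_add_right N.ract_add_left
        tens_ract_left N.lact_ract)

lemma tens_ract: "\<lbrakk>m \<in> carrier M; n \<in> carrier N; s \<in> carrier S\<rbrakk> \<Longrightarrow>
    tens R M N m n \<triangleleft>\<^bsub>tensor R M N\<^esub> s = tens R M N m (n \<triangleleft>\<^bsub>N\<^esub> s)"
  by (simp add: tensor_ract lift_tens abelian_group_tensor_group balanced_tens_right)

lemma abelian_group_tensor: "abelian_group (tensor R M N)"
  by (rule abelian_group_cong[OF abelian_group_tensor_group]) simp_all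

lemma additive_tensor_ract: "s \<in> carrier S \<Longrightarrow> additive T T (\<lambda>X. X \<triangleleft>\<^bsub>tensor R M N\<^esub> s)"
  unfolding tensor_ract by (intro lift_additive abelian_group_tensor_group balanced_tens_right)

lemma additive_tensor_ract_right:
  assumes "X \<in> carrier T" shows "additive S T (\<lambda>s. X \<triangleleft>\<^bsub>tensor R M N\<^esub> s)"
  unfolding tensor_ract
  by (rule additive_lift_param[OF abelian_group_tensor_group N.R.abelian_group_axioms assms
      balanced_tens_right])
    (simp_all add: additive_def tens_closed N.ract_closed N.ract_add_right tens_add_right)

lemma right_module_tensor: "right_module S (tensor R M N)"
proof (rule right_moduleI[OF N.R.ring_axioms abelian_group_tensor]; simp)
  fix s t X assume "s \<in> carrier S" "t \<in> carrier S" and X: "X \<in> carrier T"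
  then show "X \<triangleleft>\<^bsub>tensor R M N\<^esub> (s \<otimes>\<^bsub>S\<^esub> t) = X \<triangleleft>\<^bsub>tensor R M N\<^esub> s \<triangleleft>\<^bsub>tensor R M N\<^esub> t"
    by (intro tensor_ext[OF additive_tensor_ract additive_comp[OF additive_tensor_ract
        additive_tensor_ract] X])
      (simp_all add: tens_ract N.ract_closed N.ract_assoc)
next
  fix X assume X: "X \<in> carrier T"
  show "X \<triangleleft>\<^bsub>tensor R M N\<^esub> \<one>\<^bsub>S\<^esub> = X"
    by (intro tensor_ext[OF additive_tensor_ract additive_id X]) (simp_all add: tens_ract
        N.ract_one)
qed (simp_all add: additive_tensor_ract additive_tensor_ract_right)

lemma lift_ract:
  assumes "abelian_group P" "balanced R M N P \<beta>" "X \<in> carrier T" "s \<in> carrier S"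
  shows "tensor_lift P \<beta> (X \<triangleleft>\<^bsub>tensor R M N\<^esub> s) = tensor_lift P (\<lambda>m n. \<beta> m (n \<triangleleft>\<^bsub>N\<^esub> s)) X"
  unfolding tensor_ract
  by (subst lift_comp[OF abelian_group_tensor_group assms(1) balanced_tens_right[OF assms(4)]
      lift_additive[OF assms(1,2)] assms(3)],
      rule lift_cong[symmetric, OF assms(1) balanced_comp[OF balanced_tens_right[OF assms(4)]
          lift_additive[OF assms(1,2)]] assms(3)])
    (simp add: lift_tens assms N.ract_closed)

end

lemma tensor_productI: "right_module R M \<Longrightarrow> bimod_over R S N \<Longrightarrow> tensor_product R S M N"
  by (rule tensor_product.intro)

lemma balanced_lift_param:
  assumes t: "tensor_product R S M N" and t': "tensor_product R' S' M' N'" and P: "abelian_group P"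
    and X: "X \<in> carrier (tensor_group R M N)"
    and b: "\<And>u v. \<lbrakk>u \<in> carrier M'; v \<in> carrier N'\<rbrakk> \<Longrightarrow> balanced R M N P (\<gamma> u v)"
    and b': "\<And>m n. \<lbrakk>m \<in> carrier M; n \<in> carrier N\<rbrakk> \<Longrightarrow> balanced R' M' N' P (\<lambda>u v. \<gamma> u v m n)"
  shows "balanced R' M' N' P (\<lambda>u v. tensor_lift P (\<gamma> u v) X)"
proof -
  interpret t: tensor_product R S M N by fact
  interpret t': tensor_product R' S' M' N' by fact
  show ?thesis
  proof (rule balancedI)
    show "additive M' P (\<lambda>u. tensor_lift P (\<gamma> u v) X)" if "v \<in> carrier N'" for v
      using that b balancedD(1)[OF b']
      by (intro t.additive_lift_param[OF P t'.M.M.abelian_group_axioms X]) auto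
    show "additive N' P (\<lambda>v. tensor_lift P (\<gamma> u v) X)" if "u \<in> carrier M'" for u
      using that b balancedD(2)[OF b']
      by (intro t.additive_lift_param[OF P t'.N.M.abelian_group_axioms X]) auto
    show "tensor_lift P (\<gamma> (u \<triangleleft>\<^bsub>M'\<^esub> r) v) X = tensor_lift P (\<gamma> u (r \<triangleright>\<^bsub>N'\<^esub> v)) X"
      if "u \<in> carrier M'" "r \<in> carrier R'" "v \<in> carrier N'" for u r v
      using that b balancedD(3)[OF b'] t'.N.lact_closed by (intro t.lift_cong[OF P _ X]) auto
  qed
qed

text \<open>The order of two independent Sweedler sums may be interchanged.\<close>

lemma lift_swap:
  assumes t: "tensor_product R S M N" and t': "tensor_product R' S' M' N'" and P: "abelian_group P"
    and X: "X \<in> carrier (tensor_group R M N)" and Y: "Y \<in> carrier (tensor_group R' M' N')"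
    and b: "\<And>u v. \<lbrakk>u \<in> carrier M'; v \<in> carrier N'\<rbrakk> \<Longrightarrow> balanced R M N P (\<lambda>m n. \<gamma> m n u v)"
    and b': "\<And>m n. \<lbrakk>m \<in> carrier M; n \<in> carrier N\<rbrakk> \<Longrightarrow> balanced R' M' N' P (\<gamma> m n)"
  shows "tensor_lift P (\<lambda>m n. tensor_lift P (\<gamma> m n) Y) X =
    tensor_lift P (\<lambda>u v. tensor_lift P (\<lambda>m n. \<gamma> m n u v) X) Y"
proof -
  interpret t: tensor_product R S M N by fact
  interpret t': tensor_product R' S' M' N' by fact
  have bal: "balanced R' M' N' P (\<lambda>u v. tensor_lift P (\<lambda>m n. \<gamma> m n u v) X)"
    by (rule balanced_lift_param[OF t t' P X b b'])
  define f where "f = (\<lambda>Y. tensor_lift P (\<lambda>m n. tensor_lift P (\<gamma> m n) Y) X)"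
  have "additive (tensor_group R' M' N') P f"
    unfolding f_def
    by (intro t.additive_lift_param[OF P t'.abelian_group_tensor_group X] balanced_lift_param[OF
        t' t P _ b' b]
        t'.lift_additive[OF P b'])
  then have "f Y = tensor_lift P (\<lambda>u v. tensor_lift P (\<lambda>m n. \<gamma> m n u v) X) Y"
  proof (rule t'.lift_unique[OF P bal _ Y])
    fix u v assume uv: "u \<in> carrier M'" "v \<in> carrier N'"
    then show "f (tens R' M' N' u v) = tensor_lift P (\<lambda>m n. \<gamma> m n u v) X"
      unfolding f_def by (intro t.lift_cong[OF P b X]) (auto simp: t'.lift_tens[OF P b'])
  qed
  then show ?thesis by (simp add: f_def)
qed

text \<open>The bimodule structure of \<open>M \<otimes>\<^sub>R N\<close> when \<open>M\<close> is a bimodule as well.\<close>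

locale bitensor_product = M: bimod_over Q R M + N: bimod_over R S N
  for Q :: "('q, 'u) ring_scheme" (structure) and R :: "('r, 'w) ring_scheme" (structure)
    and S :: "('s, 'v) ring_scheme" (structure) and M :: "('q, 'r, 'm, 'y) bimod_scheme" (structure)
    and N :: "('r, 's, 'n, 'x) bimod_scheme" (structure)
begin

sublocale tensor_product R S M N
  by unfold_locales

lemma balanced_tens_left:
  assumes "q \<in> carrier Q"
  shows "balanced R M N T (\<lambda>m n. tens R M N (q \<triangleright>\<^bsub>M\<^esub> m) n)"
  using assms by (intro balancedI additiveI)
    (auto simp: M.lact_closed tens_closed tens_add_left tens_add_right M.lact_add_right
        M.lact_ract tens_ract_left[symmetric])

lemma tens_lact: "\<lbrakk>q \<in> carrier Q; m \<in> carrier M; n \<in> carrier N\<rbrakk> \<Longrightarrow>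
    q \<triangleright>\<^bsub>bitensor R M N\<^esub> tens R M N m n = tens R M N (q \<triangleright>\<^bsub>M\<^esub> m) n"
  by (simp add: bitensor_lact lift_tens abelian_group_tensor_group balanced_tens_left)

lemma additive_tensor_lact: "q \<in> carrier Q \<Longrightarrow> additive T T (\<lambda>X. q \<triangleright>\<^bsub>bitensor R M N\<^esub> X)"
  unfolding bitensor_lact by (intro lift_additive abelian_group_tensor_group balanced_tens_left)

lemma additive_tensor_lact_left:
  assumes "X \<in> carrier T" shows "additive Q T (\<lambda>q. q \<triangleright>\<^bsub>bitensor R M N\<^esub> X)"
  unfolding bitensor_lact
  by (rule additive_lift_param[OF abelian_group_tensor_group M.L.abelian_group_axioms assms
      balanced_tens_left])
    (simp_all add: additive_def tens_closed M.lact_closed M.lact_add_left tens_add_left)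

lemma abelian_group_bitensor: "abelian_group (bitensor R M N)"
  by (rule abelian_group_cong[OF abelian_group_tensor_group]) simp_all

lemma right_module_bitensor: "right_module S (bitensor R M N)"
proof -
  interpret r: right_module S "tensor R M N" by (rule right_module_tensor)
  show ?thesis
    using additive_tensor_ract additive_tensor_ract_right r.ract_assoc r.ract_one
    by (intro right_moduleI[OF N.R.ring_axioms abelian_group_bitensor]) simp_all
qed

lemma bimod_over_bitensor: "bimod_over Q S (bitensor R M N)"
proof (rule bimod_overI[OF M.L.ring_axioms right_module_bitensor]; simp)
  fix s t X assume "s \<in> carrier Q" "t \<in> carrier Q" and X: "X \<in> carrier T"
  then show "(s \<otimes>\<^bsub>Q\<^esub> t) \<triangleright>\<^bsub>bitensor R M N\<^esub> X = s \<triangleright>\<^bsub>bitensor R M N\<^esub> t \<triangleright>\<^bsub>bitensor R M N\<^esub> X"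
    by (intro tensor_ext[OF additive_tensor_lact additive_comp[OF additive_tensor_lact
        additive_tensor_lact] X])
      (simp_all add: tens_lact M.lact_closed M.lact_assoc)
next
  fix X assume X: "X \<in> carrier T"
  show "\<one>\<^bsub>Q\<^esub> \<triangleright>\<^bsub>bitensor R M N\<^esub> X = X"
    by (intro tensor_ext[OF additive_tensor_lact additive_id X]) (simp_all add: tens_lact
        M.lact_one)
next
  fix q s X assume qs: "q \<in> carrier Q" "s \<in> carrier S" and X: "X \<in> carrier T"
  then show "(q \<triangleright>\<^bsub>bitensor R M N\<^esub> X) \<triangleleft>\<^bsub>tensor R M N\<^esub> s = q \<triangleright>\<^bsub>bitensor R M N\<^esub> (X \<triangleleft>\<^bsub>tensor R M N\<^esub> s)"
    by (intro tensor_ext[OF additive_comp[OF additive_tensor_lact additive_tensor_ract]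
          additive_comp[OF additive_tensor_ract additive_tensor_lact] X])
      (simp_all add: tens_lact tens_ract M.lact_closed N.ract_closed)
qed (simp_all add: additive_tensor_lact additive_tensor_lact_left)

lemma lift_lact:
  assumes "abelian_group P" "balanced R M N P \<beta>" "X \<in> carrier T" "q \<in> carrier Q"
  shows "tensor_lift P \<beta> (q \<triangleright>\<^bsub>bitensor R M N\<^esub> X) = tensor_lift P (\<lambda>m n. \<beta> (q \<triangleright>\<^bsub>M\<^esub> m) n) X"
  unfolding bitensor_lact
  by (subst lift_comp[OF abelian_group_tensor_group assms(1) balanced_tens_left[OF assms(4)]
      lift_additive[OF assms(1,2)] assms(3)],
      rule lift_cong[symmetric, OF assms(1) balanced_comp[OF balanced_tens_left[OF assms(4)]
          lift_additive[OF assms(1,2)]] assms(3)])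
    (simp add: lift_tens assms M.lact_closed)

end

lemma bitensor_productI: "bimod_over Q R M \<Longrightarrow> bimod_over R S N \<Longrightarrow> bitensor_product Q R S M N"
  by (rule bitensor_product.intro)

section \<open>Tensor products of maps and associativity\<close>

lemma tensor_map_eq:
  "tensor_map R M N f g = tensor_lift (tensor_group R M N) (\<lambda>m n. tens R M N (f m) (g n))"
  by (simp add: tensor_map_def)

text \<open>Tensor products see of the left factor only its right module structure.\<close>

lemma tensor_left_cong:
  assumes "carrier M = carrier M'" "add M = add M'" "ract M = ract M'"
  shows "tensor_group R M N = tensor_group R M' N"
    and "tens R M N = tens R M' N"
    and "tensor R M N = tensor R M' N"
    and "tensor_map R M N = tensor_map R M' N"
    and "tensor_assoc R S M N P = tensor_assoc R S M' N P"
proof -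
  show g: "tensor_group R M N = tensor_group R M' N" and t: "tens R M N = tens R M' N" for N
    using assms by (simp_all add: tens_def tensor_group_def tensor_kernel_def tensor_relations_def
        fun_eq_iff)
  show "tensor R M N = tensor R M' N" for N
    by (simp add: tensor_def g t)
  show "tensor_map R M N = tensor_map R M' N"
    by (simp add: tensor_map_eq g t fun_eq_iff)
  show "tensor_assoc R S M N P = tensor_assoc R S M' N P"
    by (simp add: tensor_assoc_def g t fun_eq_iff)
qed

lemma tensor_map_bitensor_left:
  "tensor_map R (bitensor R L N) M = tensor_map R (tensor R L N) M"
  by (rule tensor_left_cong) simp_all

text \<open>A trilinear map \<open>L \<times> M \<times> N \<rightarrow> P\<close> for a right \<open>R\<close>-module \<open>L\<close>, an \<open>R\<close>-\<open>S\<close>-bimodule \<open>M\<close>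
  and a left \<open>S\<close>-module \<open>N\<close>, with values in an abelian group.\<close>

definition trilinear ::
  "('r, 'w) ring_scheme \<Rightarrow> ('s, 'w2) ring_scheme \<Rightarrow> ('r, 'l, 'y) rmod_scheme \<Rightarrow>
    ('r, 's, 'm, 'x) bimod_scheme \<Rightarrow> ('s, 't, 'n, 'u) bimod_scheme \<Rightarrow> ('p, 'v) ring_scheme \<Rightarrow>
    ('l \<Rightarrow> 'm \<Rightarrow> 'n \<Rightarrow> 'p) \<Rightarrow> bool" where
  "trilinear R S L M N P t \<longleftrightarrow> (\<forall>n\<in>carrier N. balanced R L M P (\<lambda>l m. t l m n)) \<and>
     (\<forall>l\<in>carrier L. balanced S M N P (t l))"

lemma trilinearI:
  assumes "\<And>m n. \<lbrakk>m \<in> carrier M; n \<in> carrier N\<rbrakk> \<Longrightarrow> additive L P (\<lambda>l. t l m n)"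
    and "\<And>l n. \<lbrakk>l \<in> carrier L; n \<in> carrier N\<rbrakk> \<Longrightarrow> additive M P (\<lambda>m. t l m n)"
    and "\<And>l m. \<lbrakk>l \<in> carrier L; m \<in> carrier M\<rbrakk> \<Longrightarrow> additive N P (t l m)"
    and "\<And>l r m n. \<lbrakk>l \<in> carrier L; r \<in> carrier R; m \<in> carrier M; n \<in> carrier N\<rbrakk> \<Longrightarrow>
      t (l \<triangleleft>\<^bsub>L\<^esub> r) m n = t l (r \<triangleright>\<^bsub>M\<^esub> m) n"
    and "\<And>l s m n. \<lbrakk>l \<in> carrier L; s \<in> carrier S; m \<in> carrier M; n \<in> carrier N\<rbrakk> \<Longrightarrow>
      t l (m \<triangleleft>\<^bsub>M\<^esub> s) n = t l m (s \<triangleright>\<^bsub>N\<^esub> n)"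
  shows "trilinear R S L M N P t"
  unfolding trilinear_def balanced_def using assms by blast

lemma trilinearD:
  assumes "trilinear R S L M N P t"
  shows "n \<in> carrier N \<Longrightarrow> balanced R L M P (\<lambda>l m. t l m n)"
    and "l \<in> carrier L \<Longrightarrow> balanced S M N P (t l)"
    and "\<lbrakk>m \<in> carrier M; n \<in> carrier N\<rbrakk> \<Longrightarrow> additive L P (\<lambda>l. t l m n)"
    and "\<lbrakk>l \<in> carrier L; n \<in> carrier N\<rbrakk> \<Longrightarrow> additive M P (\<lambda>m. t l m n)"
    and "\<lbrakk>l \<in> carrier L; m \<in> carrier M\<rbrakk> \<Longrightarrow> additive N P (t l m)"
    and "\<lbrakk>l \<in> carrier L; r \<in> carrier R; m \<in> carrier M; n \<in> carrier N\<rbrakk> \<Longrightarrow> t (l \<triangleleft>\<^bsub>L\<^esub> r) m n = t l (r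
        \<triangleright>\<^bsub>M\<^esub> m) n"
    and "\<lbrakk>l \<in> carrier L; s \<in> carrier S; m \<in> carrier M; n \<in> carrier N\<rbrakk> \<Longrightarrow> t l (m \<triangleleft>\<^bsub>M\<^esub> s) n = t l m
        (s \<triangleright>\<^bsub>N\<^esub> n)"
  using assms unfolding trilinear_def balanced_def by blast+

text \<open>The two bracketings \<open>(L \<otimes>\<^sub>R M) \<otimes>\<^sub>S N\<close> and \<open>L \<otimes>\<^sub>R (M \<otimes>\<^sub>S N)\<close>.\<close>

locale triple_tensor = L: right_module R L + M: bimod_over R S M + N: bimod_over S Q N
  for R :: "('r, 'w) ring_scheme" (structure) and S :: "('s, 'v) ring_scheme" (structure)
    and Q :: "('q, 'u) ring_scheme" (structure) and L :: "('r, 'l, 'k) rmod_scheme" (structure)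
    and M :: "('r, 's, 'm, 'y) bimod_scheme" (structure) and N :: "('s, 'q, 'n, 'x) bimod_scheme"
        (structure)
begin

sublocale LM: tensor_product R S L M by unfold_locales
sublocale MN: bitensor_product R S Q M N by unfold_locales
sublocale L_MN: tensor_product R Q L "bitensor S M N"
  by (rule tensor_productI[OF L.right_module_axioms MN.bimod_over_bitensor])
sublocale LM_N: tensor_product S Q "tensor R L M" N
  by (rule tensor_productI[OF LM.right_module_tensor N.bimod_over_axioms])

lemma balanced_lift_left:
  assumes P: "abelian_group P" and t: "trilinear R S L M N P t"
  shows "balanced S (tensor R L M) N P (\<lambda>X n. tensor_lift P (\<lambda>l m. t l m n) X)"
proof (rule balancedI)
  fix n assume n: "n \<in> carrier N"
  show "additive (tensor R L M) P (\<lambda>X. tensor_lift P (\<lambda>l m. t l m n) X)"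
    using LM.lift_additive[OF P trilinearD(1)[OF t n]] by simp
next
  fix X assume X: "X \<in> carrier (tensor R L M)"
  show "additive N P (\<lambda>n. tensor_lift P (\<lambda>l m. t l m n) X)"
    using X trilinearD(1,5)[OF t]
    by (intro LM.additive_lift_param[OF P N.M.abelian_group_axioms]) auto
next
  fix X r n assume X: "X \<in> carrier (tensor R L M)" and r: "r \<in> carrier S" and n: "n \<in> carrier N"
  have "tensor_lift P (\<lambda>l m. t l m n) (X \<triangleleft>\<^bsub>tensor R L M\<^esub> r) = tensor_lift P (\<lambda>l m. t l (m \<triangleleft>\<^bsub>M\<^esub> r)
      n) X"
    using X r n by (intro LM.lift_ract[OF P trilinearD(1)[OF t]]) auto
  also have "\<dots> = tensor_lift P (\<lambda>l m. t l m (r \<triangleright>\<^bsub>N\<^esub> n)) X"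
    using X r n trilinearD(7)[OF t] by (intro LM.lift_cong[OF P trilinearD(1)[OF t]]) (auto simp:
        N.lact_closed)
  finally show "tensor_lift P (\<lambda>l m. t l m n) (X \<triangleleft>\<^bsub>tensor R L M\<^esub> r) = tensor_lift P (\<lambda>l m. t l m
      (r \<triangleright>\<^bsub>N\<^esub> n)) X" .
qed

lemma balanced_lift_right:
  assumes P: "abelian_group P" and t: "trilinear R S L M N P t"
  shows "balanced R L (bitensor S M N) P (\<lambda>l. tensor_lift P (t l))"
proof (rule balancedI)
  fix l assume l: "l \<in> carrier L"
  show "additive (bitensor S M N) P (tensor_lift P (t l))"
    using MN.lift_additive[OF P trilinearD(2)[OF t l]] by simp
next
  fix X assume X: "X \<in> carrier (bitensor S M N)"
  show "additive L P (\<lambda>l. tensor_lift P (t l) X)"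
    using X trilinearD(2,3)[OF t]
    by (intro MN.additive_lift_param[OF P L.M.abelian_group_axioms]) auto
next
  fix X r l assume X: "X \<in> carrier (bitensor S M N)" and r: "r \<in> carrier R" and l: "l \<in> carrier L"
  have "tensor_lift P (t l) (r \<triangleright>\<^bsub>bitensor S M N\<^esub> X) = tensor_lift P (\<lambda>m n. t l (r \<triangleright>\<^bsub>M\<^esub> m) n) X"
    using X r l by (intro MN.lift_lact[OF P trilinearD(2)[OF t]]) auto
  also have "\<dots> = tensor_lift P (t (l \<triangleleft>\<^bsub>L\<^esub> r)) X"
    using X r l trilinearD(6)[OF t] by (intro MN.lift_cong[OF P trilinearD(2)[OF t]]) (auto simp:
        L.ract_closed)
  finally show "tensor_lift P (t (l \<triangleleft>\<^bsub>L\<^esub> r)) X = tensor_lift P (t l) (r \<triangleright>\<^bsub>bitensor S M N\<^esub> X)" by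
      simp
qed

lemma trilinear_tens: "trilinear R S L M N L_MN.T (\<lambda>l m n. tens R L (bitensor S M N) l (tens S M N
    m n))"
  unfolding trilinear_def
proof (intro conjI ballI)
  fix n assume n: "n \<in> carrier N"
  show "balanced R L M L_MN.T (\<lambda>l m. tens R L (bitensor S M N) l (tens S M N m n))"
  proof (rule balancedI)
    show "additive M L_MN.T (\<lambda>m. tens R L (bitensor S M N) l (tens S M N m n))" if "l \<in> carrier L"
        for l
      using additive_comp[OF balancedD(1)[OF MN.tens_balanced n]] balancedD(2)[OF
          L_MN.tens_balanced that] by simp
    show "additive L L_MN.T (\<lambda>l. tens R L (bitensor S M N) l (tens S M N m n))" if "m \<in> carrier M"
        for m
      using balancedD(1)[OF L_MN.tens_balanced] MN.tens_closed[OF that n] by simp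
    show "tens R L (bitensor S M N) (l \<triangleleft>\<^bsub>L\<^esub> r) (tens S M N m n) = tens R L (bitensor S M N) l
        (tens S M N (r \<triangleright>\<^bsub>M\<^esub> m) n)"
      if "l \<in> carrier L" "r \<in> carrier R" "m \<in> carrier M" for l r m
      using that n L_MN.tens_ract_left[of l r "tens S M N m n"] by (simp add: MN.tens_lact
          MN.tens_closed)
  qed
next
  fix l assume "l \<in> carrier L"
  then have "additive MN.T L_MN.T (tens R L (bitensor S M N) l)"
    using balancedD(2)[OF L_MN.tens_balanced] by simp
  then show "balanced S M N L_MN.T (\<lambda>m n. tens R L (bitensor S M N) l (tens S M N m n))"
    by (rule balanced_comp[OF MN.tens_balanced])
qed

lemma tensor_assoc_eq:
  "tensor_assoc R S L M N = tensor_lift L_MN.T (\<lambda>X n. tensor_lift L_MN.T (\<lambda>l m.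
     tens R L (bitensor S M N) l (tens S M N m n)) X)"
  by (simp add: tensor_assoc_def)

lemma additive_tensor_assoc: "additive LM_N.T L_MN.T (tensor_assoc R S L M N)"
  unfolding tensor_assoc_eq
  by (rule LM_N.lift_additive[OF L_MN.abelian_group_tensor_group
        balanced_lift_left[OF L_MN.abelian_group_tensor_group trilinear_tens]])

lemma tensor_assoc_tens:
  assumes "X \<in> carrier LM.T" "n \<in> carrier N"
  shows "tensor_assoc R S L M N (tens S (tensor R L M) N X n) =
    tensor_lift L_MN.T (\<lambda>l m. tens R L (bitensor S M N) l (tens S M N m n)) X"
  unfolding tensor_assoc_eq using assms
  by (intro LM_N.lift_tens[OF L_MN.abelian_group_tensor_group
        balanced_lift_left[OF L_MN.abelian_group_tensor_group trilinear_tens]]) auto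

text \<open>A trilinear map factors through either bracketing, compatibly with the associativity map.\<close>

lemma lift_tensor_assoc:
  assumes P: "abelian_group P" and t: "trilinear R S L M N P t" and W: "W \<in> carrier LM_N.T"
  shows "tensor_lift P (\<lambda>l. tensor_lift P (t l)) (tensor_assoc R S L M N W) =
    tensor_lift P (\<lambda>X n. tensor_lift P (\<lambda>l m. t l m n) X) W"
proof (rule LM_N.lift_unique[OF P balanced_lift_left[OF P t] _ W])
  note br = balanced_lift_right[OF P t]
  note G = L_MN.abelian_group_tensor_group
  let ?f = "tensor_lift P (\<lambda>l. tensor_lift P (t l))"
  have f: "additive L_MN.T P ?f" by (rule L_MN.lift_additive[OF P br])
  show "additive LM_N.T P (\<lambda>W. ?f (tensor_assoc R S L M N W))"
    by (rule additive_comp[OF additive_tensor_assoc f])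
  fix X n assume X: "X \<in> carrier (tensor R L M)" and n: "n \<in> carrier N"
  have "?f (tensor_assoc R S L M N (tens S (tensor R L M) N X n)) =
      ?f (tensor_lift L_MN.T (\<lambda>l m. tens R L (bitensor S M N) l (tens S M N m n)) X)"
    using X n by (simp add: tensor_assoc_tens)
  also have "\<dots> = tensor_lift P (\<lambda>l m. ?f (tens R L (bitensor S M N) l (tens S M N m n))) X"
    using X by (intro LM.lift_comp[OF G P trilinearD(1)[OF trilinear_tens n] f]) simp
  also have "\<dots> = tensor_lift P (\<lambda>l m. t l m n) X"
    using X n by (intro LM.lift_cong[OF P trilinearD(1)[OF t n]])
      (simp_all add: L_MN.lift_tens[OF P br] MN.tens_closed MN.lift_tens[OF P trilinearD(2)[OF t]])
  finally show "?f (tensor_assoc R S L M N (tens S (tensor R L M) N X n)) = tensor_lift P (\<lambda>l m. t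
      l m n) X" .
qed

end

lemma triple_tensorI:
  "\<lbrakk>right_module R L; bimod_over R S M; bimod_over S Q N\<rbrakk> \<Longrightarrow> triple_tensor R S Q L M N"
  by (rule triple_tensor.intro)

text \<open>\<open>f \<otimes> g\<close> is well defined for linear \<open>f\<close> and \<open>g\<close>. Only linearity over the ring of the tensor
  product is needed.\<close>

lemma tensor_map_balanced:
  assumes t: "tensor_product R S M N" and t': "tensor_product R S' M' N'"
    and f: "f \<in> rmod_hom R M M'" and g: "additive N N' g"
    and gl: "\<And>r n. \<lbrakk>r \<in> carrier R; n \<in> carrier N\<rbrakk> \<Longrightarrow> g (r \<triangleright>\<^bsub>N\<^esub> n) = r \<triangleright>\<^bsub>N'\<^esub> g n"
  shows "balanced R M N (tensor_group R M' N') (\<lambda>m n. tens R M' N' (f m) (g n))"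
proof -
  interpret t': tensor_product R S' M' N' by fact
  show ?thesis
  proof (rule balancedI)
    show "additive M t'.T (\<lambda>m. tens R M' N' (f m) (g n))" if "n \<in> carrier N" for n
      using additive_comp[OF rmod_hom_additive[OF f] balancedD(1)[OF t'.tens_balanced]]
          additive_closed[OF g that] by simp
    show "additive N t'.T (\<lambda>n. tens R M' N' (f m) (g n))" if "m \<in> carrier M" for m
      using additive_comp[OF g balancedD(2)[OF t'.tens_balanced]] rmod_hom_closed[OF f that] by simp
    show "tens R M' N' (f (m \<triangleleft>\<^bsub>M\<^esub> r)) (g n) = tens R M' N' (f m) (g (r \<triangleright>\<^bsub>N\<^esub> n))"
      if "m \<in> carrier M" "r \<in> carrier R" "n \<in> carrier N" for m r n
      using that f g gl t'.tens_ract_left by (simp add: rmod_hom_closed rmod_hom_ract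
          additive_closed)
  qed
qed

section \<open>Corings and the dual ring\<close>

lemma regular_bimod_simps [simp]:
  "carrier (regular_bimod A) = carrier A" "add (regular_bimod A) = add A"
  "ract (regular_bimod A) = mult A" "lact (regular_bimod A) = mult A"
  by (simp_all add: regular_bimod_def)

lemma bimod_homD:
  assumes "f \<in> bimod_hom R S M N"
  shows "f \<in> rmod_hom S M N"
    and "\<lbrakk>r \<in> carrier R; m \<in> carrier M\<rbrakk> \<Longrightarrow> f (r \<triangleright>\<^bsub>M\<^esub> m) = r \<triangleright>\<^bsub>N\<^esub> f m"
  using assms by (auto simp: bimod_hom_def)

text \<open>Corings given by a record without further fields, the form in which \<open>dual_act\<close> and
  \<open>dual_ring\<close> take them. \<open>CC.T\<close> is \<open>C \<otimes>\<^sub>A C\<close>.\<close>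

locale base_coring = coring A C
  for A :: "('a, 'z) ring_scheme" (structure) and C :: "('a, 'c) cor" (structure)
begin

sublocale C: bimod_over A A C
  by (rule bimodule_imp_bimod_over[OF bimodule_axioms])

sublocale CC: bitensor_product A A A C C
  by (rule bitensor_productI[OF C.bimod_over_axioms C.bimod_over_axioms])

lemmas abelian_group_A = L.abelian_group_axioms
lemmas abelian_group_C = M.abelian_group_axioms

lemma comul_rmod_hom: "comul C \<in> rmod_hom A C (tensor A C C)"
  using bimod_homD(1)[OF comul_hom] by (simp add: rmod_hom_def)

lemma additive_comul: "additive C CC.T (comul C)"
  using rmod_hom_additive[OF comul_rmod_hom] by simp

lemma comul_closed: "c \<in> carrier C \<Longrightarrow> comul C c \<in> carrier CC.T"
  using additive_comul by (rule additive_closed)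

lemma comul_ract: "\<lbrakk>c \<in> carrier C; a \<in> carrier A\<rbrakk> \<Longrightarrow> comul C (c \<triangleleft>\<^bsub>C\<^esub> a) = comul C c \<triangleleft>\<^bsub>tensor A C C\<^esub>
    a"
  by (rule rmod_hom_ract[OF comul_rmod_hom])

lemma comul_lact: "\<lbrakk>c \<in> carrier C; a \<in> carrier A\<rbrakk> \<Longrightarrow> comul C (a \<triangleright>\<^bsub>C\<^esub> c) = a \<triangleright>\<^bsub>bitensor A C C\<^esub> comul
    C c"
  by (rule bimod_homD(2)[OF comul_hom])

text \<open>Coassociativity in Sweedler form, for an \<open>A\<close>-linear coassociative map
  \<open>\<rho> : M \<rightarrow> M \<otimes>\<^sub>A C\<close>: both bracketings of \<open>t m\<^sub>(\<^sub>0\<^sub>) m\<^sub>(\<^sub>1\<^sub>) m\<^sub>(\<^sub>2\<^sub>)\<close> agree for trilinear \<open>t\<close>.\<close>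

lemma sweedler_coassoc:
  assumes M: "right_module A M" and \<rho>: "\<rho> \<in> rmod_hom A M (tensor A M C)" and m: "m \<in> carrier M"
    and co: "tensor_assoc A A M C C (tensor_map A (tensor A M C) C \<rho> (\<lambda>x. x) (\<rho> m)) =
      tensor_map A M (bitensor A C C) (\<lambda>x. x) (comul C) (\<rho> m)"
    and P: "abelian_group P" and t: "trilinear A A M C C P t"
  shows "tensor_lift P (\<lambda>x y. tensor_lift P (\<lambda>u v. t u v y) (\<rho> x)) (\<rho> m) =
    tensor_lift P (\<lambda>x y. tensor_lift P (t x) (comul C y)) (\<rho> m)"
proof -
  interpret MCC: triple_tensor A A A M C C
    using M C.bimod_over_axioms C.bimod_over_axioms by (rule triple_tensorI)
  have \<rho>m: "\<rho> x \<in> carrier MCC.LM.T" if "x \<in> carrier M" for x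
    using rmod_hom_closed[OF \<rho> that] by simp
  have b1: "balanced A M C MCC.LM_N.T (\<lambda>x y. tens A (tensor A M C) C (\<rho> x) y)"
    by (rule tensor_map_balanced[OF MCC.LM.tensor_product_axioms MCC.LM_N.tensor_product_axioms \<rho>
        additive_id]) simp
  have id: "(\<lambda>x. x) \<in> rmod_hom A M M" by (auto simp: rmod_hom_def)
  have b2: "balanced A M C MCC.L_MN.T (\<lambda>x y. tens A M (bitensor A C C) x (comul C y))"
    by (rule tensor_map_balanced[OF MCC.LM.tensor_product_axioms MCC.L_MN.tensor_product_axioms id])
      (simp_all add: additive_comul comul_lact)
  note G1 = MCC.LM_N.abelian_group_tensor_group
  note G2 = MCC.L_MN.abelian_group_tensor_group
  note br = MCC.balanced_lift_right[OF P t]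
  note bl = MCC.balanced_lift_left[OF P t]
  \<comment> \<open>The map induced by \<open>t\<close> on \<open>M \<otimes> (C \<otimes> C)\<close> is applied to both sides of coassociativity.\<close>
  let ?f = "tensor_lift P (\<lambda>l. tensor_lift P (t l))"
  let ?W = "tensor_map A (tensor A M C) C \<rho> (\<lambda>x. x) (\<rho> m)"
  have W: "?W \<in> carrier MCC.LM_N.T"
    unfolding tensor_map_eq by (rule MCC.LM.lift_closed[OF G1 b1 \<rho>m[OF m]])
  have "?f (tensor_assoc A A M C C ?W) = tensor_lift P (\<lambda>X n. tensor_lift P (\<lambda>l m. t l m n) X) ?W"
    by (rule MCC.lift_tensor_assoc[OF P t W])
  also have "\<dots> = tensor_lift P (\<lambda>x y. tensor_lift P (\<lambda>X n. tensor_lift P (\<lambda>l m. t l m n) X) (tens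
      A (tensor A M C) C (\<rho> x) y)) (\<rho> m)"
    unfolding tensor_map_eq by (rule MCC.LM.lift_comp[OF G1 P b1 MCC.LM_N.lift_additive[OF P bl]
        \<rho>m[OF m]])
  also have "\<dots> = tensor_lift P (\<lambda>x y. tensor_lift P (\<lambda>u v. t u v y) (\<rho> x)) (\<rho> m)"
    by (rule MCC.LM.lift_cong[symmetric, OF P balanced_comp[OF b1 MCC.LM_N.lift_additive[OF P bl]]
        \<rho>m[OF m]])
      (simp add: MCC.LM_N.lift_tens[OF P bl] \<rho>m)
  finally have 1: "?f (tensor_assoc A A M C C ?W) = tensor_lift P (\<lambda>x y. tensor_lift P (\<lambda>u v. t u
      v y) (\<rho> x)) (\<rho> m)" .
  have "?f (tensor_map A M (bitensor A C C) (\<lambda>x. x) (comul C) (\<rho> m)) = tensor_lift P (\<lambda>x y. ?f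
      (tens A M (bitensor A C C) x (comul C y))) (\<rho> m)"
    unfolding tensor_map_eq by (rule MCC.LM.lift_comp[OF G2 P b2 MCC.L_MN.lift_additive[OF P br]
        \<rho>m[OF m]])
  also have "\<dots> = tensor_lift P (\<lambda>x y. tensor_lift P (t x) (comul C y)) (\<rho> m)"
    by (rule MCC.LM.lift_cong[symmetric, OF P balanced_comp[OF b2 MCC.L_MN.lift_additive[OF P br]]
        \<rho>m[OF m]])
      (simp add: MCC.L_MN.lift_tens[OF P br] comul_closed)
  finally show ?thesis using 1 co by simp
qed

lemma sweedler_comul:
  assumes "c \<in> carrier C" "abelian_group P" "trilinear A A C C C P t"
  shows "tensor_lift P (\<lambda>x y. tensor_lift P (\<lambda>u v. t u v y) (comul C x)) (comul C c) =
    tensor_lift P (\<lambda>x y. tensor_lift P (t x) (comul C y)) (comul C c)"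
proof (rule sweedler_coassoc[OF right_module_axioms comul_rmod_hom assms(1) _ assms(2,3)])
  show "tensor_assoc A A C C C (tensor_map A (tensor A C C) C (comul C) (\<lambda>x. x) (comul C c)) =
      tensor_map A C (bitensor A C C) (\<lambda>x. x) (comul C) (comul C c)"
    using comul_coassoc[OF assms(1)] by (simp add: tensor_map_bitensor_left)
qed

text \<open>Right \<open>A\<close>-linear functionals on \<open>C\<close>, not required to be extensional; \<open>C\<^sup>*\<close> consists of the
  extensional ones.\<close>

abbreviation "functionals \<equiv> rmod_hom A C (regular_bimod A)"

lemma counit_functional: "counit C \<in> functionals"
  using counit_hom by (rule bimod_homD(1))

lemma counit_lact: "\<lbrakk>a \<in> carrier A; c \<in> carrier C\<rbrakk> \<Longrightarrow> counit C (a \<triangleright>\<^bsub>C\<^esub> c) = a \<otimes>\<^bsub>A\<^esub> counit C c"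
  using bimod_homD(2)[OF counit_hom] by simp

lemma functional_closed: "f \<in> functionals \<Longrightarrow> c \<in> carrier C \<Longrightarrow> f c \<in> carrier A"
  by (auto simp: rmod_hom_def)

lemma functional_additive: "f \<in> functionals \<Longrightarrow> additive C A f"
  using rmod_hom_additive[of f A C "regular_bimod A"] by (simp add: additive_def)

lemma functional_ract: "f \<in> functionals \<Longrightarrow> c \<in> carrier C \<Longrightarrow> a \<in> carrier A \<Longrightarrow> f (c \<triangleleft>\<^bsub>C\<^esub> a) = f c \<otimes>\<^bsub>A\<^esub> a"
  by (auto simp: rmod_hom_def)

lemma balanced_dual_act:
  assumes f: "f \<in> functionals" shows "balanced A C C C (\<lambda>x y. f x \<triangleright>\<^bsub>C\<^esub> y)"
  using additive_comp[OF functional_additive[OF f] C.additive_lact_left] C.additive_lact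
      functional_closed[OF f]
  by (intro balancedI) (simp_all add: functional_ract[OF f] lact_assoc)

lemma additive_dual_act: "f \<in> functionals \<Longrightarrow> additive C C (dual_act C f)"
  unfolding dual_act_def
  by (rule additive_comp[OF additive_comul CC.lift_additive[OF abelian_group_C balanced_dual_act]])

lemma dual_act_closed: "f \<in> functionals \<Longrightarrow> c \<in> carrier C \<Longrightarrow> dual_act C f c \<in> carrier C"
  by (rule additive_closed[OF additive_dual_act])

lemma dual_act_ract:
  assumes f: "f \<in> functionals" and c: "c \<in> carrier C" and a: "a \<in> carrier A"
  shows "dual_act C f (c \<triangleleft>\<^bsub>C\<^esub> a) = dual_act C f c \<triangleleft>\<^bsub>C\<^esub> a"
proof -
  note b = balanced_dual_act[OF f]
  have "dual_act C f (c \<triangleleft>\<^bsub>C\<^esub> a) = tensor_lift C (\<lambda>x y. f x \<triangleright>\<^bsub>C\<^esub> (y \<triangleleft>\<^bsub>C\<^esub> a)) (comul C c)"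
    unfolding dual_act_def comul_ract[OF c a] by (rule CC.lift_ract[OF abelian_group_C b
        comul_closed[OF c] a])
  also have "\<dots> = tensor_lift C (\<lambda>x y. (f x \<triangleright>\<^bsub>C\<^esub> y) \<triangleleft>\<^bsub>C\<^esub> a) (comul C c)"
    by (rule CC.lift_cong[OF abelian_group_C balanced_comp[OF b additive_ract[OF a]]
        comul_closed[OF c]])
      (simp add: lact_ract functional_closed[OF f] a)
  also have "\<dots> = dual_act C f c \<triangleleft>\<^bsub>C\<^esub> a"
    unfolding dual_act_def
    by (rule CC.lift_comp[symmetric, OF abelian_group_C abelian_group_C b additive_ract[OF a]
        comul_closed[OF c]])
  finally show ?thesis .
qed

lemma dual_act_rmod_hom: "f \<in> functionals \<Longrightarrow> dual_act C f \<in> rmod_hom A C C"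
  by (rule rmod_homI[OF additive_dual_act dual_act_ract])

text \<open>The action of a functional is right colinear:
  \<open>\<Delta>(f \<cdot> c) = f \<cdot> c\<^sub>(\<^sub>1\<^sub>) \<otimes> c\<^sub>(\<^sub>2\<^sub>)\<close>; thus \<open>f \<cdot> -\<close> is an endomorphism of the right comodule \<open>C\<close>.\<close>

lemma comul_dual_act:
  assumes f: "f \<in> functionals" and c: "c \<in> carrier C"
  shows "comul C (dual_act C f c) = tensor_lift CC.T (\<lambda>x y. tens A C C (dual_act C f x) y) (comul
      C c)"
proof -
  note b = balanced_dual_act[OF f]
  note G = CC.abelian_group_tensor_group
  have t: "trilinear A A C C C CC.T (\<lambda>x u v. tens A C C (f x \<triangleright>\<^bsub>C\<^esub> u) v)"
  proof (rule trilinearI)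
    show "additive C CC.T (\<lambda>x. tens A C C (f x \<triangleright>\<^bsub>C\<^esub> u) v)" if "u \<in> carrier C" "v \<in> carrier C" for
        u v
      using additive_comp[OF balancedD(1)[OF b that(1)] balancedD(1)[OF CC.tens_balanced that(2)]] .
    show "additive C CC.T (\<lambda>u. tens A C C (f x \<triangleright>\<^bsub>C\<^esub> u) v)" if "x \<in> carrier C" "v \<in> carrier C" for
        x v
      using additive_comp[OF balancedD(2)[OF b that(1)] balancedD(1)[OF CC.tens_balanced that(2)]] .
    show "additive C CC.T (tens A C C (f x \<triangleright>\<^bsub>C\<^esub> u))" if "x \<in> carrier C" "u \<in> carrier C" for x u
      using balancedD(2)[OF CC.tens_balanced balancedD(4)[OF b that]] .
  qed (simp_all add: functional_closed f functional_ract lact_closed ract_closed lact_assoc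
        CC.tens_ract_left[symmetric] lact_ract)
  have "comul C (dual_act C f c) = tensor_lift CC.T (\<lambda>x y. comul C (f x \<triangleright>\<^bsub>C\<^esub> y)) (comul C c)"
    unfolding dual_act_def by (rule CC.lift_comp[OF abelian_group_C G b additive_comul
        comul_closed[OF c]])
  also have "\<dots> = tensor_lift CC.T (\<lambda>x y. tensor_lift CC.T (\<lambda>u v. tens A C C (f x \<triangleright>\<^bsub>C\<^esub> u) v) (comul
      C y)) (comul C c)"
  proof (rule CC.lift_cong[symmetric, OF G balanced_comp[OF b additive_comul] comul_closed[OF c]])
    fix x y assume "x \<in> carrier C" "y \<in> carrier C"
    then show "tensor_lift CC.T (\<lambda>u v. tens A C C (f x \<triangleright>\<^bsub>C\<^esub> u) v) (comul C y) = comul C (f x \<triangleright>\<^bsub>C\<^esub>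
        y)"
      by (simp add: comul_lact functional_closed[OF f] bitensor_lact)
  qed
  also have "\<dots> = tensor_lift CC.T (\<lambda>x y. tensor_lift CC.T (\<lambda>u v. tens A C C (f u \<triangleright>\<^bsub>C\<^esub> v) y) (comul
      C x)) (comul C c)"
    by (rule sweedler_comul[symmetric, OF c G t])
  also have "\<dots> = tensor_lift CC.T (\<lambda>x y. tens A C C (dual_act C f x) y) (comul C c)"
  proof (rule CC.lift_cong[OF G _ comul_closed[OF c]])
    show "balanced A C C CC.T (\<lambda>x y. tens A C C (dual_act C f x) y)"
      by (rule tensor_map_balanced[OF CC.tensor_product_axioms CC.tensor_product_axioms
          dual_act_rmod_hom[OF f] additive_id]) simp
    show "tensor_lift CC.T (\<lambda>u v. tens A C C (f u \<triangleright>\<^bsub>C\<^esub> v) y) (comul C x) = tens A C C (dual_act C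
        f x) y"
      if "x \<in> carrier C" "y \<in> carrier C" for x y
      unfolding dual_act_def
      by (rule CC.lift_comp[symmetric, OF abelian_group_C G b balancedD(1)[OF CC.tens_balanced
          that(2)] comul_closed[OF that(1)]])
  qed
  finally show ?thesis .
qed

lemma dual_act_dual_act:
  assumes f: "f \<in> functionals" and g: "g \<in> functionals" and c: "c \<in> carrier C"
  shows "dual_act C f (dual_act C g c) = tensor_lift C (\<lambda>x y. f (dual_act C g x) \<triangleright>\<^bsub>C\<^esub> y) (comul C
      c)"
proof -
  note b = balanced_dual_act[OF f]
  have b2: "balanced A C C CC.T (\<lambda>x y. tens A C C (dual_act C g x) y)"
    by (rule tensor_map_balanced[OF CC.tensor_product_axioms CC.tensor_product_axioms
        dual_act_rmod_hom[OF g] additive_id]) simp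
  note la = CC.lift_additive[OF abelian_group_C b]
  show ?thesis
    unfolding dual_act_def[of _ f] comul_dual_act[OF g c]
    by (subst CC.lift_comp[OF CC.abelian_group_tensor_group abelian_group_C b2 la comul_closed[OF
        c]],
        rule CC.lift_cong[symmetric, OF abelian_group_C balanced_comp[OF b2 la] comul_closed[OF c]])
      (simp add: CC.lift_tens[OF abelian_group_C b] dual_act_closed[OF g])
qed

lemma balanced_counit_right: "balanced A C C C (\<lambda>x y. x \<triangleleft>\<^bsub>C\<^esub> counit C y)"
  using additive_comp[OF functional_additive[OF counit_functional] additive_ract_right]
      additive_ract
    functional_closed[OF counit_functional]
  by (intro balancedI) (simp_all add: counit_lact ract_assoc)

lemma counit_dual_act:
  assumes f: "f \<in> functionals" and c: "c \<in> carrier C"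
  shows "counit C (dual_act C f c) = f c"
proof -
  note b = balanced_counit_right
  have "counit C (dual_act C f c) = tensor_lift A (\<lambda>x y. counit C (f x \<triangleright>\<^bsub>C\<^esub> y)) (comul C c)"
    unfolding dual_act_def
    by (rule CC.lift_comp[OF abelian_group_C abelian_group_A balanced_dual_act[OF f]
        functional_additive[OF counit_functional] comul_closed[OF c]])
  also have "\<dots> = tensor_lift A (\<lambda>x y. f (x \<triangleleft>\<^bsub>C\<^esub> counit C y)) (comul C c)"
    by (rule CC.lift_cong[OF abelian_group_A balanced_comp[OF b functional_additive[OF f]]
        comul_closed[OF c]])
      (simp add: counit_lact functional_ract functional_closed f counit_functional)
  also have "\<dots> = f (tensor_lift C (\<lambda>x y. x \<triangleleft>\<^bsub>C\<^esub> counit C y) (comul C c))"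
    by (rule CC.lift_comp[symmetric, OF abelian_group_C abelian_group_A b functional_additive[OF
        f] comul_closed[OF c]])
  finally show ?thesis using counit_right[OF c] by simp
qed

text \<open>Only the values on the carrier matter, so functionals may be replaced by their
  extensional restrictions.\<close>

lemma dual_act_restrict:
  assumes f: "f \<in> functionals" and c: "c \<in> carrier C" and g: "\<And>x. x \<in> carrier C \<Longrightarrow> g x = f x"
  shows "dual_act C g c = dual_act C f c"
  unfolding dual_act_def
  by (rule CC.lift_cong[OF abelian_group_C balanced_dual_act[OF f] comul_closed[OF c]]) (simp add:
      g)

lemma functional_restrict: "f \<in> functionals \<Longrightarrow> (\<And>x. x \<in> carrier C \<Longrightarrow> g x = f x) \<Longrightarrow> g \<in> functionals"
  by (auto simp: rmod_hom_def ract_closed)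

lemma functional_comp: "g \<in> functionals \<Longrightarrow> f \<in> functionals \<Longrightarrow> (\<lambda>c. f (dual_act C g c)) \<in> functionals"
  by (rule rmod_hom_comp[OF dual_act_rmod_hom])

lemma functional_add: "f \<in> functionals \<Longrightarrow> g \<in> functionals \<Longrightarrow> (\<lambda>c. f c \<oplus>\<^bsub>A\<^esub> g c) \<in> functionals"
  using additive_plus[OF abelian_group_A functional_additive functional_additive, of f g]
  by (intro rmod_homI) (simp_all add: additive_def functional_ract functional_closed L.l_distr)

lemma functional_zero: "(\<lambda>c. \<zero>\<^bsub>A\<^esub>) \<in> functionals"
  by (auto simp: rmod_hom_def)

lemma functional_neg: "f \<in> functionals \<Longrightarrow> (\<lambda>c. \<ominus>\<^bsub>A\<^esub> f c) \<in> functionals"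
  by (rule rmod_homI)
    (simp_all add: additive_def functional_ract functional_closed L.l_minus additive_add[OF
        functional_additive] L.minus_add)

abbreviation "D \<equiv> dual_ring A C"

lemma dual_ring_simps [simp]:
  "f \<in> carrier D \<longleftrightarrow> f \<in> functionals \<and> f \<in> extensional (carrier C)"
  "\<one>\<^bsub>D\<^esub> = (\<lambda>c\<in>carrier C. counit C c)"
  "\<zero>\<^bsub>D\<^esub> = (\<lambda>c\<in>carrier C. \<zero>\<^bsub>A\<^esub>)"
  "f \<otimes>\<^bsub>D\<^esub> g = (\<lambda>c\<in>carrier C. f (dual_act C g c))"
  "f \<oplus>\<^bsub>D\<^esub> g = (\<lambda>c\<in>carrier C. f c \<oplus>\<^bsub>A\<^esub> g c)"
  by (simp_all add: dual_ring_def)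

lemma restrict_functional: "f \<in> functionals \<Longrightarrow> restrict f (carrier C) \<in> functionals"
  by (erule functional_restrict) simp

lemma dual_act_add:
  assumes f: "f \<in> functionals" and g: "g \<in> functionals" and c: "c \<in> carrier C"
  shows "dual_act C (f \<oplus>\<^bsub>D\<^esub> g) c = dual_act C f c \<oplus>\<^bsub>C\<^esub> dual_act C g c"
proof -
  have "dual_act C (f \<oplus>\<^bsub>D\<^esub> g) c = tensor_lift C (\<lambda>x y. (f x \<triangleright>\<^bsub>C\<^esub> y) \<oplus>\<^bsub>C\<^esub> (g x \<triangleright>\<^bsub>C\<^esub> y)) (comul C c)"
    unfolding dual_act_def
    by (rule CC.lift_cong[OF abelian_group_C balanced_plus[OF abelian_group_C balanced_dual_act[OF
        f] balanced_dual_act[OF g]] comul_closed[OF c]])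
      (simp add: lact_add_left functional_closed f g)
  then show ?thesis
    unfolding dual_act_def by (simp add: CC.lift_plus[OF abelian_group_C balanced_dual_act[OF f]
        balanced_dual_act[OF g] comul_closed[OF c]])
qed

lemma dual_act_mult:
  assumes f: "f \<in> functionals" and g: "g \<in> functionals" and c: "c \<in> carrier C"
  shows "dual_act C (f \<otimes>\<^bsub>D\<^esub> g) c = dual_act C f (dual_act C g c)"
  using dual_act_restrict[OF functional_comp[OF g f] c, of "f \<otimes>\<^bsub>D\<^esub> g"] dual_act_dual_act[OF f g c]
  by (simp add: dual_act_def)

lemma dual_act_one:
  assumes c: "c \<in> carrier C"
  shows "dual_act C \<one>\<^bsub>D\<^esub> c = c"
  using dual_act_restrict[OF counit_functional c, of "\<one>\<^bsub>D\<^esub>"] counit_left[OF c] by (simp add: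
      dual_act_def)

lemma ring_dual: "ring D"
proof (rule ringI)
  show "abelian_group D"
  proof (rule abelian_groupI)
    fix f assume f: "f \<in> carrier D"
    then have "(\<lambda>c\<in>carrier C. \<ominus>\<^bsub>A\<^esub> f c) \<in> carrier D" by (simp add: restrict_functional
        functional_neg)
    moreover have "(\<lambda>c\<in>carrier C. \<ominus>\<^bsub>A\<^esub> f c) \<oplus>\<^bsub>D\<^esub> f = \<zero>\<^bsub>D\<^esub>"
      using f by (auto simp: functional_closed L.l_neg)
    ultimately show "\<exists>g\<in>carrier D. g \<oplus>\<^bsub>D\<^esub> f = \<zero>\<^bsub>D\<^esub>" by blast
    show "\<zero>\<^bsub>D\<^esub> \<oplus>\<^bsub>D\<^esub> f = f"
      using f by (auto intro!: extensionalityI[of _ "carrier C"] simp: functional_closed)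
  qed (auto simp: restrict_functional functional_add functional_zero functional_closed L.a_ac)
  show "Group.monoid D"
  proof (rule monoidI)
    fix f g h assume "f \<in> carrier D" "g \<in> carrier D" "h \<in> carrier D"
    then show "f \<otimes>\<^bsub>D\<^esub> g \<otimes>\<^bsub>D\<^esub> h = f \<otimes>\<^bsub>D\<^esub> (g \<otimes>\<^bsub>D\<^esub> h)"
      using dual_act_mult[of g h] by (auto simp: dual_act_closed)
  next
    fix f assume f: "f \<in> carrier D"
    show "\<one>\<^bsub>D\<^esub> \<otimes>\<^bsub>D\<^esub> f = f"
      using f by (auto intro!: extensionalityI[of _ "carrier C"] simp: dual_act_closed
          counit_dual_act)
    show "f \<otimes>\<^bsub>D\<^esub> \<one>\<^bsub>D\<^esub> = f"
      using f dual_act_one by (auto intro!: extensionalityI[of _ "carrier C"])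
  qed (auto simp: restrict_functional functional_comp counit_functional)
next
  fix f g h assume fgh: "f \<in> carrier D" "g \<in> carrier D" "h \<in> carrier D"
  then show "(f \<oplus>\<^bsub>D\<^esub> g) \<otimes>\<^bsub>D\<^esub> h = f \<otimes>\<^bsub>D\<^esub> h \<oplus>\<^bsub>D\<^esub> g \<otimes>\<^bsub>D\<^esub> h"
    by (auto simp: dual_act_closed)
  show "h \<otimes>\<^bsub>D\<^esub> (f \<oplus>\<^bsub>D\<^esub> g) = h \<otimes>\<^bsub>D\<^esub> f \<oplus>\<^bsub>D\<^esub> h \<otimes>\<^bsub>D\<^esub> g"
    using fgh dual_act_add[of f g] additive_add[OF functional_additive[of h]] by (auto simp:
        dual_act_closed)
qed

lemma dual_bimod_simps [simp]:
  "carrier (dual_bimod C) = carrier C" "add (dual_bimod C) = add C" "zero (dual_bimod C) = zero C"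
  "ract (dual_bimod C) = ract C" "lact (dual_bimod C) = dual_act C"
  by (simp_all add: dual_bimod_def)

lemma bimod_over_dual: "bimod_over D A (dual_bimod C)"
proof (rule bimod_overI[OF ring_dual])
  have ag: "abelian_group (dual_bimod C)" by (rule abelian_group_cong[OF abelian_group_C]) simp_all
  show "right_module A (dual_bimod C)"
    by (rule right_moduleI[OF L.ring_axioms ag])
      (simp_all add: additive_def ract_closed ract_add_left ract_add_right ract_assoc ract_one)
  show "additive (dual_bimod C) (dual_bimod C) (\<lambda>m. f \<triangleright>\<^bsub>dual_bimod C\<^esub> m)" if "f \<in> carrier D" for f
    using additive_dual_act[of f] that by (simp add: additive_def)
  show "additive D (dual_bimod C) (\<lambda>f. f \<triangleright>\<^bsub>dual_bimod C\<^esub> m)" if "m \<in> carrier (dual_bimod C)" for m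
    using that dual_act_add dual_act_closed by (auto intro!: additiveI simp del: dual_ring_simps(5))
  show "(f \<otimes>\<^bsub>D\<^esub> g) \<triangleright>\<^bsub>dual_bimod C\<^esub> m = f \<triangleright>\<^bsub>dual_bimod C\<^esub> (g \<triangleright>\<^bsub>dual_bimod C\<^esub> m)"
    if "m \<in> carrier (dual_bimod C)" "f \<in> carrier D" "g \<in> carrier D" for m f g
    using that dual_act_mult by (simp del: dual_ring_simps(4))
  show "\<one>\<^bsub>D\<^esub> \<triangleright>\<^bsub>dual_bimod C\<^esub> m = m" if "m \<in> carrier (dual_bimod C)" for m
    using that dual_act_one by (simp del: dual_ring_simps(2))
qed (simp add: dual_act_ract)

end

section \<open>Linear maps of the left factor\<close>

lemma tensor_map_left_tens:
  assumes "tensor_product R S M N" "tensor_product R S M' N" "f \<in> rmod_hom R M M'"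
    and "m \<in> carrier M" "n \<in> carrier N"
  shows "tensor_map R M' N f (\<lambda>x. x) (tens R M N m n) = tens R M' N (f m) n"
  unfolding tensor_map_eq using assms
  by (intro tensor_product.lift_tens[OF assms(1)] tensor_map_balanced additive_id
      tensor_product.abelian_group_tensor_group) simp_all

lemma tensor_map_left_additive:
  assumes "tensor_product R S M N" "tensor_product R S M' N" "f \<in> rmod_hom R M M'"
  shows "additive (tensor_group R M N) (tensor_group R M' N) (tensor_map R M' N f (\<lambda>x. x))"
  unfolding tensor_map_eq using assms
  by (intro tensor_product.lift_additive[OF assms(1)] tensor_map_balanced additive_id
      tensor_product.abelian_group_tensor_group) simp_all

lemma tensor_map_left_hom:
  assumes t: "tensor_product R S M N" and t': "tensor_product R S M' N" and f: "f \<in> rmod_hom R M M'"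
  shows "tensor_map R M' N f (\<lambda>x. x) \<in> rmod_hom S (tensor R M N) (tensor R M' N)"
proof (rule rmod_homI)
  interpret t: tensor_product R S M N by fact
  interpret t': tensor_product R S M' N by fact
  note a = tensor_map_left_additive[OF t t' f]
  show "additive (tensor R M N) (tensor R M' N) (tensor_map R M' N f (\<lambda>x. x))" using a by simp
  fix X s assume "X \<in> carrier (tensor R M N)" and s: "s \<in> carrier S"
  then have X: "X \<in> carrier t.T" by simp
  show "tensor_map R M' N f (\<lambda>x. x) (X \<triangleleft>\<^bsub>tensor R M N\<^esub> s) = tensor_map R M' N f (\<lambda>x. x) X \<triangleleft>\<^bsub>tensor
      R M' N\<^esub> s"
    by (rule t.tensor_ext[OF additive_comp[OF t.additive_tensor_ract[OF s] a] additive_comp[OF a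
        t'.additive_tensor_ract[OF s]] X])
      (simp add: t.tens_ract t'.tens_ract tensor_map_left_tens[OF t t' f] t.N.ract_closed s
          rmod_hom_closed[OF f])
qed

lemma tensor_map_left_cong:
  assumes t: "tensor_product R S M N" and t': "tensor_product R S M' N" and f: "f \<in> rmod_hom R M M'"
    and X: "X \<in> carrier (tensor_group R M N)" and g: "\<And>m. m \<in> carrier M \<Longrightarrow> g m = f m"
  shows "tensor_map R M' N g (\<lambda>x. x) X = tensor_map R M' N f (\<lambda>x. x) X"
  unfolding tensor_map_eq using assms
  by (intro tensor_product.lift_cong[OF t] tensor_map_balanced[OF t t'] additive_id
      tensor_product.abelian_group_tensor_group[OF t']) simp_all

lemma lift_tensor_map_left:
  assumes t: "tensor_product R S M N" and t': "tensor_product R S M' N" and f: "f \<in> rmod_hom R M M'"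
    and P: "abelian_group P" and \<beta>: "balanced R M' N P \<beta>" and X: "X \<in> carrier (tensor_group R M N)"
  shows "tensor_lift P \<beta> (tensor_map R M' N f (\<lambda>x. x) X) = tensor_lift P (\<lambda>m n. \<beta> (f m) n) X"
proof -
  interpret t: tensor_product R S M N by fact
  interpret t': tensor_product R S M' N by fact
  have b: "balanced R M N P (\<lambda>m n. \<beta> (f m) n)"
    using balancedD[OF \<beta>] additive_comp[OF rmod_hom_additive[OF f] balancedD(1)[OF \<beta>]]
    by (intro balancedI) (simp_all add: rmod_hom_closed[OF f] rmod_hom_ract[OF f])
  show ?thesis
    by (rule t.lift_unique[OF P b additive_comp[OF tensor_map_left_additive[OF t t' f]
        t'.lift_additive[OF P \<beta>]] X])
      (simp add: tensor_map_left_tens[OF t t' f] t'.lift_tens[OF P \<beta>] rmod_hom_closed[OF f])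
qed

lemma tensor_map_left_comp:
  assumes t: "tensor_product R S M N" and t': "tensor_product R S M' N" and t'': "tensor_product R
      S M'' N"
    and f: "f \<in> rmod_hom R M M'" and g: "g \<in> rmod_hom R M' M''" and X: "X \<in> carrier (tensor_group
        R M N)"
  shows "tensor_map R M'' N g (\<lambda>x. x) (tensor_map R M' N f (\<lambda>x. x) X) = tensor_map R M'' N (\<lambda>m. g
      (f m)) (\<lambda>x. x) X"
  unfolding tensor_map_eq[of R M'' N]
  by (intro lift_tensor_map_left[OF t t' f tensor_product.abelian_group_tensor_group[OF t''] _ X]
      tensor_map_balanced[OF t' t'' g additive_id]) simp

lemma tensor_map_left_id:
  assumes t: "tensor_product R S M N" and X: "X \<in> carrier (tensor_group R M N)"
  shows "tensor_map R M N (\<lambda>x. x) (\<lambda>x. x) X = X"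
  unfolding tensor_map_eq by (rule tensor_product.lift_id[OF t X])

lemma trilinear_left_comp:
  assumes f: "f \<in> rmod_hom R L' L" and t: "trilinear R S L M N P t"
  shows "trilinear R S L' M N P (\<lambda>l. t (f l))"
  using trilinearD[OF t] additive_comp[OF rmod_hom_additive[OF f] trilinearD(3)[OF t]]
  by (intro trilinearI) (simp_all add: rmod_hom_closed[OF f] rmod_hom_ract[OF f])

section \<open>The functor from modules over the dual ring to comodules\<close>

text \<open>A right \<open>C\<^sup>*\<close>-module \<open>N\<close>. Here \<open>NC\<close> is \<open>N \<otimes> C\<close> over \<open>C\<^sup>*\<close> with pure tensors \<open>tn n c\<close>,
  and \<open>\<rho>F\<close> is the coaction of \<open>F N\<close>; \<open>F.T\<close> is the abelian group \<open>N \<otimes> C\<close>, and \<open>FC.T\<close> is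
  \<open>(N \<otimes> C) \<otimes>\<^sub>A C\<close>.\<close>

locale dual_module = base_coring A C + N: right_module "dual_ring A C" N
  for A :: "('a, 'z) ring_scheme" (structure) and C :: "('a, 'c) cor" (structure)
    and N :: "('c \<Rightarrow> 'a, 'n) rmod" (structure)
begin

sublocale F: tensor_product "dual_ring A C" A N "dual_bimod C"
  by (rule tensor_productI[OF N.right_module_axioms bimod_over_dual])

abbreviation "NC \<equiv> tensor (dual_ring A C) N (dual_bimod C)"
abbreviation "tn \<equiv> tens (dual_ring A C) N (dual_bimod C)"
abbreviation "\<rho>F \<equiv> coact (F_obj A C N)"

sublocale FC: tensor_product A A NC C
  by (rule tensor_productI[OF F.right_module_tensor C.bimod_over_axioms])

lemma F_obj_simps [simp]:
  "carrier (F_obj A C N) = carrier F.T" "add (F_obj A C N) = add F.T" "zero (F_obj A C N) = zero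
      F.T"
  "ract (F_obj A C N) = ract NC"
  by (simp_all add: F_obj_def Let_def rmod.defs comod.defs)

text \<open>The coaction sends \<open>n \<otimes> c\<close> to the image of \<open>\<Delta> c\<close> under \<open>(n \<otimes> -) \<otimes> C\<close>.\<close>

lemma coact_F_obj: "\<rho>F = tensor_lift FC.T (\<lambda>n c. tensor_map A NC C (tn n) (\<lambda>x. x) (comul C c))"
  by (simp add: F_obj_def Let_def rmod.defs comod.defs tensor_map_eq)

lemmas F_obj_left_cong [simp] = tensor_left_cong[of "F_obj A C N" NC, OF F_obj_simps(1)[folded
    tensor_simps(1)] F_obj_simps(2)[folded tensor_simps(2)] F_obj_simps(4)]

lemma tn_hom: "n \<in> carrier N \<Longrightarrow> tn n \<in> rmod_hom A C NC"
  using balancedD(2)[OF F.tens_balanced, of n]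
  by (intro rmod_homI) (simp_all add: additive_def F.tens_ract)

text \<open>The coaction is well defined over \<open>C\<^sup>*\<close> because the maps \<open>f \<cdot> -\<close> are colinear.\<close>

lemma balanced_coact_F: "balanced D N (dual_bimod C) FC.T (\<lambda>n c. tensor_map A NC C (tn n) (\<lambda>x. x)
    (comul C c))"
proof (rule balancedI)
  note G = FC.abelian_group_tensor_group
  have b: "balanced A C C FC.T (\<lambda>x y. tens A NC C (tn n x) y)" if "n \<in> carrier N" for n
    by (rule tensor_map_balanced[OF CC.tensor_product_axioms FC.tensor_product_axioms tn_hom[OF
        that] additive_id]) simp
  show "additive N FC.T (\<lambda>n. tensor_map A NC C (tn n) (\<lambda>x. x) (comul C c))" if "c \<in> carrier
      (dual_bimod C)" for c
  proof -
    have c: "c \<in> carrier C" using that by simp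
    show ?thesis unfolding tensor_map_eq
    proof (rule CC.additive_lift_param[OF G N.M.abelian_group_axioms comul_closed[OF c] b])
      fix x y assume xy: "x \<in> carrier C" "y \<in> carrier C"
      have "additive N F.T (\<lambda>n. tn n x)" using balancedD(1)[OF F.tens_balanced] xy by simp
      moreover have "additive F.T FC.T (\<lambda>X. tens A NC C X y)" using balancedD(1)[OF
          FC.tens_balanced] xy by simp
      ultimately show "additive N FC.T (\<lambda>n. tens A NC C (tn n x) y)" by (rule additive_comp)
    qed
  qed
  show "additive (dual_bimod C) FC.T (\<lambda>c. tensor_map A NC C (tn n) (\<lambda>x. x) (comul C c))" if n: "n
      \<in> carrier N" for n
    using additive_comp[OF additive_comul tensor_map_left_additive[OF CC.tensor_product_axioms
        FC.tensor_product_axioms tn_hom[OF n]]]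
    by (simp add: additive_def)
  fix n f c assume n: "n \<in> carrier N" and f: "f \<in> carrier D" and "c \<in> carrier (dual_bimod C)"
  then have c: "c \<in> carrier C" and f': "f \<in> functionals" by simp_all
  have "tensor_map A NC C (tn n) (\<lambda>x. x) (comul C (dual_act C f c)) =
      tensor_map A NC C (tn n) (\<lambda>x. x) (tensor_map A C C (dual_act C f) (\<lambda>x. x) (comul C c))"
    using comul_dual_act[OF f' c] by (simp add: tensor_map_eq)
  also have "\<dots> = tensor_map A NC C (\<lambda>x. tn n (dual_act C f x)) (\<lambda>x. x) (comul C c)"
    by (rule tensor_map_left_comp[OF CC.tensor_product_axioms CC.tensor_product_axioms
        FC.tensor_product_axioms
          dual_act_rmod_hom[OF f'] tn_hom[OF n] comul_closed[OF c]])
  also have "\<dots> = tensor_map A NC C (tn (n \<triangleleft>\<^bsub>N\<^esub> f)) (\<lambda>x. x) (comul C c)"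
    by (rule tensor_map_left_cong[OF CC.tensor_product_axioms FC.tensor_product_axioms
          tn_hom[OF N.ract_closed[OF n f]] comul_closed[OF c]])
      (use n f F.tens_ract_left in simp)
  finally show "tensor_map A NC C (tn (n \<triangleleft>\<^bsub>N\<^esub> f)) (\<lambda>x. x) (comul C c) =
      tensor_map A NC C (tn n) (\<lambda>x. x) (comul C (f \<triangleright>\<^bsub>dual_bimod C\<^esub> c))" by simp
qed

lemma additive_coact_F: "additive F.T FC.T \<rho>F"
  unfolding coact_F_obj by (rule F.lift_additive[OF FC.abelian_group_tensor_group balanced_coact_F])

lemma coact_F_tens: "n \<in> carrier N \<Longrightarrow> c \<in> carrier C \<Longrightarrow>
    \<rho>F (tn n c) = tensor_map A NC C (tn n) (\<lambda>x. x) (comul C c)"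
  unfolding coact_F_obj by (rule F.lift_tens[OF FC.abelian_group_tensor_group balanced_coact_F])
      simp_all

lemma coact_F_hom: "\<rho>F \<in> rmod_hom A NC (tensor A NC C)"
proof (rule rmod_homI)
  show "additive NC (tensor A NC C) \<rho>F" using additive_coact_F by simp
  fix X a assume "X \<in> carrier NC" and a: "a \<in> carrier A"
  then have X: "X \<in> carrier F.T" by simp
  show "\<rho>F (X \<triangleleft>\<^bsub>NC\<^esub> a) = \<rho>F X \<triangleleft>\<^bsub>tensor A NC C\<^esub> a"
  proof (rule F.tensor_ext[OF additive_comp[OF F.additive_tensor_ract[OF a] additive_coact_F]
          additive_comp[OF additive_coact_F FC.additive_tensor_ract[OF a]] X])
    fix n c assume n: "n \<in> carrier N" and "c \<in> carrier (dual_bimod C)"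
    then have c: "c \<in> carrier C" by simp
    show "\<rho>F (tn n c \<triangleleft>\<^bsub>NC\<^esub> a) = \<rho>F (tn n c) \<triangleleft>\<^bsub>tensor A NC C\<^esub> a"
      using n c a rmod_hom_ract[OF tensor_map_left_hom[OF CC.tensor_product_axioms
          FC.tensor_product_axioms tn_hom[OF n]], of "comul C c" a]
      by (simp add: F.tens_ract coact_F_tens ract_closed comul_ract comul_closed)
  qed
qed

lemma right_comodule_F: "right_comodule A C (F_obj A C N)"
proof -
  interpret NCC: triple_tensor A A A NC C C
    by (rule triple_tensorI[OF F.right_module_tensor C.bimod_over_axioms C.bimod_over_axioms])
  note tp = CC.tensor_product_axioms FC.tensor_product_axioms
  note G = NCC.L_MN.abelian_group_tensor_group
  have id: "(\<lambda>x. x) \<in> rmod_hom A NC NC" by (auto simp: rmod_hom_def)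
  have b2: "balanced A NC C NCC.L_MN.T (\<lambda>x y. tens A NC (bitensor A C C) x (comul C y))"
    by (rule tensor_map_balanced[OF FC.tensor_product_axioms NCC.L_MN.tensor_product_axioms id])
      (simp_all add: additive_comul comul_lact)
  have b1: "balanced A NC C NCC.LM_N.T (\<lambda>x y. tens A (tensor A NC C) C (\<rho>F x) y)"
    by (rule tensor_map_balanced[OF FC.tensor_product_axioms NCC.LM_N.tensor_product_axioms
        coact_F_hom additive_id]) simp
  have module: "right_module A (F_obj A C N)"
  proof -
    show ?thesis
      by (rule right_moduleI[OF L.ring_axioms abelian_group_cong[OF F.abelian_group_tensor_group]])
        (use FC.M.additive_ract FC.M.additive_ract_right FC.M.ract_assoc FC.M.ract_one in
            \<open>simp_all add: additive_def\<close>)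
  qed
  have coassoc: "tensor_assoc A A NC C C (tensor_map A (tensor A NC C) C \<rho>F (\<lambda>x. x) (\<rho>F X)) =
      tensor_map A NC (bitensor A C C) (\<lambda>x. x) (comul C) (\<rho>F X)" if X: "X \<in> carrier F.T" for X
  proof (rule F.tensor_ext[OF _ _ X])
    have t1: "additive FC.T NCC.LM_N.T (tensor_map A (tensor A NC C) C \<rho>F (\<lambda>x. x))"
      unfolding tensor_map_eq by (rule FC.lift_additive[OF NCC.LM_N.abelian_group_tensor_group b1])
    show "additive F.T NCC.L_MN.T (\<lambda>X. tensor_assoc A A NC C C (tensor_map A (tensor A NC C) C \<rho>F
        (\<lambda>x. x) (\<rho>F X)))"
      by (rule additive_comp[OF additive_comp[OF additive_coact_F t1] NCC.additive_tensor_assoc])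
    show "additive F.T NCC.L_MN.T (\<lambda>X. tensor_map A NC (bitensor A C C) (\<lambda>x. x) (comul C) (\<rho>F X))"
      unfolding tensor_map_eq by (rule additive_comp[OF additive_coact_F FC.lift_additive[OF G b2]])
  next
    fix n c assume n: "n \<in> carrier N" and "c \<in> carrier (dual_bimod C)"
    then have c: "c \<in> carrier C" by simp
    note \<Delta> = comul_closed[OF c]
    \<comment> \<open>On \<open>n \<otimes> c\<close> the two sides are the two bracketings of
      \<open>(n \<otimes> c\<^sub>(\<^sub>1\<^sub>)) \<otimes> (c\<^sub>(\<^sub>2\<^sub>) \<otimes> c\<^sub>(\<^sub>3\<^sub>))\<close>.\<close>
    define t where "t x u v = tens A NC (bitensor A C C) (tn n x) (tens A C C u v)" for x u v
    have t: "trilinear A A C C C NCC.L_MN.T t"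
      using trilinear_left_comp[OF tn_hom[OF n] NCC.trilinear_tens] unfolding t_def .
    have \<rho>n: "(\<lambda>x. \<rho>F (tn n x)) \<in> rmod_hom A C (tensor A NC C)"
      by (rule rmod_hom_comp[OF tn_hom[OF n] coact_F_hom])
    have b3: "balanced A C C NCC.LM_N.T (\<lambda>x y. tens A (tensor A NC C) C (\<rho>F (tn n x)) y)"
      by (rule tensor_map_balanced[OF tp(1) NCC.LM_N.tensor_product_axioms \<rho>n additive_id]) simp
    have "tensor_assoc A A NC C C (tensor_map A (tensor A NC C) C \<rho>F (\<lambda>x. x) (\<rho>F (tn n c))) =
        tensor_assoc A A NC C C (tensor_map A (tensor A NC C) C (\<lambda>x. \<rho>F (tn n x)) (\<lambda>x. x) (comul C
            c))"
      unfolding coact_F_tens[OF n c]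
      by (simp only: tensor_map_left_comp[OF tp NCC.LM_N.tensor_product_axioms tn_hom[OF n]
          coact_F_hom \<Delta>])
    also have "\<dots> = tensor_lift NCC.L_MN.T (\<lambda>x y. tensor_assoc A A NC C C (tens A (tensor A NC C) C
        (\<rho>F (tn n x)) y)) (comul C c)"
      unfolding tensor_map_eq
      by (rule CC.lift_comp[OF NCC.LM_N.abelian_group_tensor_group G b3 NCC.additive_tensor_assoc
          \<Delta>])
    also have "\<dots> = tensor_lift NCC.L_MN.T (\<lambda>x y. tensor_lift NCC.L_MN.T (\<lambda>u v. t u v y) (comul C
        x)) (comul C c)"
    proof (rule CC.lift_cong[symmetric, OF G balanced_comp[OF b3 NCC.additive_tensor_assoc] \<Delta>])
      fix x y assume x: "x \<in> carrier C" and y: "y \<in> carrier C"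
      have "\<rho>F (tn n x) \<in> carrier FC.T" using rmod_hom_closed[OF \<rho>n x] by simp
      then have "tensor_assoc A A NC C C (tens A (tensor A NC C) C (\<rho>F (tn n x)) y) =
        tensor_lift NCC.L_MN.T (\<lambda>l m. tens A NC (bitensor A C C) l (tens A C C m y)) (tensor_map A
            NC C (tn n) (\<lambda>x. x) (comul C x))"
        using NCC.tensor_assoc_tens[of "\<rho>F (tn n x)" y] y coact_F_tens[OF n x] by simp
      also have "\<dots> = tensor_lift NCC.L_MN.T (\<lambda>u v. t u v y) (comul C x)"
        unfolding t_def
        by (rule lift_tensor_map_left[OF tp tn_hom[OF n] G trilinearD(1)[OF NCC.trilinear_tens y]
            comul_closed[OF x]])
      finally show "tensor_lift NCC.L_MN.T (\<lambda>u v. t u v y) (comul C x) =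
        tensor_assoc A A NC C C (tens A (tensor A NC C) C (\<rho>F (tn n x)) y)" by simp
    qed
    also have "\<dots> = tensor_lift NCC.L_MN.T (\<lambda>x y. tensor_lift NCC.L_MN.T (t x) (comul C y)) (comul
        C c)"
      by (rule sweedler_comul[OF c G t])
    also have "\<dots> = tensor_lift NCC.L_MN.T (\<lambda>x y. tens A NC (bitensor A C C) (tn n x) (comul C y))
        (comul C c)"
    proof (rule CC.lift_cong[OF G _ \<Delta>])
      show "balanced A C C NCC.L_MN.T (\<lambda>x y. tens A NC (bitensor A C C) (tn n x) (comul C y))"
        by (rule tensor_map_balanced[OF tp(1) NCC.L_MN.tensor_product_axioms tn_hom[OF n]])
          (simp_all add: additive_comul comul_lact)
      fix x y assume x: "x \<in> carrier C" and y: "y \<in> carrier C"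
      have "additive CC.T NCC.L_MN.T (tens A NC (bitensor A C C) (tn n x))"
        using balancedD(2)[OF NCC.L_MN.tens_balanced, of "tn n x"] rmod_hom_closed[OF tn_hom[OF n]
            x] by simp
      from CC.lift_comp[OF CC.abelian_group_tensor_group G CC.tens_balanced this comul_closed[OF y]]
      show "tensor_lift NCC.L_MN.T (t x) (comul C y) = tens A NC (bitensor A C C) (tn n x) (comul
          C y)"
        by (simp add: CC.lift_id comul_closed[OF y] t_def[abs_def])
    qed
    also have "\<dots> = tensor_map A NC (bitensor A C C) (\<lambda>x. x) (comul C) (\<rho>F (tn n c))"
      unfolding coact_F_tens[OF n c] tensor_map_eq[of A NC "bitensor A C C"]
      by (rule lift_tensor_map_left[symmetric, OF tp tn_hom[OF n] G b2 \<Delta>])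
    finally show "tensor_assoc A A NC C C (tensor_map A (tensor A NC C) C \<rho>F (\<lambda>x. x) (\<rho>F (tn n
        c))) =
        tensor_map A NC (bitensor A C C) (\<lambda>x. x) (comul C) (\<rho>F (tn n c))" .
  qed
  have counit: "tensor_lift F.T (\<lambda>x c. x \<triangleleft>\<^bsub>NC\<^esub> counit C c) (\<rho>F X) = X" if X: "X \<in> carrier F.T" for X
  proof -
    have b: "balanced A NC C F.T (\<lambda>x c. x \<triangleleft>\<^bsub>NC\<^esub> counit C c)"
      using additive_comp[OF functional_additive[OF counit_functional] FC.M.additive_ract_right]
          FC.M.additive_ract
        functional_closed[OF counit_functional]
      by (intro balancedI) (simp_all add: counit_lact FC.M.ract_assoc)
    show ?thesis
    proof (rule F.tensor_ext[OF additive_comp[OF additive_coact_F FC.lift_additive[OF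
        F.abelian_group_tensor_group b]] additive_id X])
      fix n c assume n: "n \<in> carrier N" and "c \<in> carrier (dual_bimod C)"
      then have c: "c \<in> carrier C" by simp
      note b' = balanced_counit_right
      have tna: "additive C F.T (tn n)" using rmod_hom_additive[OF tn_hom[OF n]] by simp
      have "tensor_lift F.T (\<lambda>x c. x \<triangleleft>\<^bsub>NC\<^esub> counit C c) (\<rho>F (tn n c)) =
          tensor_lift F.T (\<lambda>x y. tn n x \<triangleleft>\<^bsub>NC\<^esub> counit C y) (comul C c)"
        unfolding coact_F_tens[OF n c]
        by (rule lift_tensor_map_left[OF tp tn_hom[OF n] F.abelian_group_tensor_group b
            comul_closed[OF c]])
      also have "\<dots> = tensor_lift F.T (\<lambda>x y. tn n (x \<triangleleft>\<^bsub>C\<^esub> counit C y)) (comul C c)"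
        by (rule CC.lift_cong[OF F.abelian_group_tensor_group balanced_comp[OF b' tna]
            comul_closed[OF c]])
          (simp add: F.tens_ract n functional_closed[OF counit_functional])
      also have "\<dots> = tn n c"
        using CC.lift_comp[OF abelian_group_C F.abelian_group_tensor_group b' tna comul_closed[OF
            c]] counit_right[OF c] by simp
      finally show "tensor_lift F.T (\<lambda>x c. x \<triangleleft>\<^bsub>NC\<^esub> counit C c) (\<rho>F (tn n c)) = tn n c" .
    qed
  qed
  have lift: "tensor_lift (F_obj A C N) = tensor_lift F.T"
    by (rule tensor_lift_struct_cong) simp_all
  show ?thesis
    by (intro right_comodule.intro right_comodule_axioms.intro coring_axioms module)
      (use coact_F_hom in \<open>simp_all add: coassoc counit lift rmod_hom_def\<close>)
qed

end

section \<open>The functor from comodules to modules over the dual ring\<close>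

text \<open>A right comodule \<open>M\<close> over \<open>C\<close>; \<open>MC.T\<close> is \<open>M \<otimes>\<^sub>A C\<close>.\<close>

locale base_comodule = base_coring A C + X: right_comodule A C M
  for A :: "('a, 'z) ring_scheme" (structure) and C :: "('a, 'c) cor" (structure)
    and M :: "('a, 'c, 'm) comod" (structure)
begin

sublocale MC: tensor_product A A M C
  by (rule tensor_productI[OF X.M.right_module_axioms C.bimod_over_axioms])

lemmas abelian_group_M = X.M.M.abelian_group_axioms

lemma additive_coact: "additive M MC.T (coact M)"
  using rmod_hom_additive[OF X.coact_hom] by simp

lemma coact_closed: "m \<in> carrier M \<Longrightarrow> coact M m \<in> carrier MC.T"
  by (rule additive_closed[OF additive_coact])

lemma sweedler_coact:
  assumes "m \<in> carrier M" "abelian_group P" "trilinear A A M C C P t"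
  shows "tensor_lift P (\<lambda>x y. tensor_lift P (\<lambda>u v. t u v y) (coact M x)) (coact M m) =
    tensor_lift P (\<lambda>x y. tensor_lift P (t x) (comul C y)) (coact M m)"
  by (rule sweedler_coassoc[OF X.M.right_module_axioms X.coact_hom assms(1) X.coact_coassoc[OF
      assms(1)] assms(2,3)])

text \<open>Comodule maps \<open>C \<rightarrow> M\<close>, without the requirement that they be extensional.\<close>

definition colinear :: "('c \<Rightarrow> 'm) \<Rightarrow> bool" where
  "colinear h \<longleftrightarrow> h \<in> rmod_hom A C M \<and>
     (\<forall>c\<in>carrier C. coact M (h c) = tensor_map A M C h (\<lambda>x. x) (comul C c))"

lemma colinearI:
  assumes "h \<in> rmod_hom A C M"
    and "\<And>c. c \<in> carrier C \<Longrightarrow> coact M (h c) = tensor_map A M C h (\<lambda>x. x) (comul C c)"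
  shows "colinear h"
  using assms by (simp add: colinear_def)

lemma colinearD:
  assumes "colinear h"
  shows "h \<in> rmod_hom A C M"
    and "c \<in> carrier C \<Longrightarrow> coact M (h c) = tensor_map A M C h (\<lambda>x. x) (comul C c)"
    and "c \<in> carrier C \<Longrightarrow> h c \<in> carrier M"
  using assms by (auto simp: colinear_def rmod_hom_def)

abbreviation "GM \<equiv> G_obj A C M"

lemma G_obj_simps [simp]:
  "h \<in> carrier GM \<longleftrightarrow> colinear h \<and> h \<in> extensional (carrier C)"
  "h \<oplus>\<^bsub>GM\<^esub> k = (\<lambda>c\<in>carrier C. h c \<oplus>\<^bsub>M\<^esub> k c)"
  "\<zero>\<^bsub>GM\<^esub> = (\<lambda>c\<in>carrier C. \<zero>\<^bsub>M\<^esub>)"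
  "h \<triangleleft>\<^bsub>GM\<^esub> f = (\<lambda>c\<in>carrier C. h (dual_act C f c))"
  by (simp_all add: G_obj_def comod_hom_def rmod_hom_def regular_comod_def colinear_def)

lemma colinear_cong:
  assumes h: "colinear h" and g: "\<And>c. c \<in> carrier C \<Longrightarrow> g c = h c"
  shows "colinear g"
proof (rule colinearI)
  show "g \<in> rmod_hom A C M" by (rule rmod_hom_restrict[OF right_module_axioms colinearD(1)[OF h] g])
  show "coact M (g c) = tensor_map A M C g (\<lambda>x. x) (comul C c)" if c: "c \<in> carrier C" for c
    using colinearD(2)[OF h c] g[OF c]
      tensor_map_left_cong[OF CC.tensor_product_axioms MC.tensor_product_axioms colinearD(1)[OF h]
          comul_closed[OF c] g]
    by simp
qed

lemma restrict_in_G: "colinear h \<Longrightarrow> restrict h (carrier C) \<in> carrier GM"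
  using colinear_cong[of h "restrict h (carrier C)"] by simp

lemma colinear_dual_act:
  assumes h: "colinear h" and f: "f \<in> functionals"
  shows "colinear (\<lambda>c. h (dual_act C f c))"
proof (rule colinearI)
  show "(\<lambda>c. h (dual_act C f c)) \<in> rmod_hom A C M"
    by (rule rmod_hom_comp[OF dual_act_rmod_hom[OF f] colinearD(1)[OF h]])
  fix c assume c: "c \<in> carrier C"
  have "coact M (h (dual_act C f c)) = tensor_map A M C h (\<lambda>x. x) (tensor_map A C C (dual_act C f)
      (\<lambda>x. x) (comul C c))"
    using colinearD(2)[OF h dual_act_closed[OF f c]] comul_dual_act[OF f c] by (simp add:
        tensor_map_eq)
  also have "\<dots> = tensor_map A M C (\<lambda>c. h (dual_act C f c)) (\<lambda>x. x) (comul C c)"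
    by (rule tensor_map_left_comp[OF CC.tensor_product_axioms CC.tensor_product_axioms
        MC.tensor_product_axioms
          dual_act_rmod_hom[OF f] colinearD(1)[OF h] comul_closed[OF c]])
  finally show "coact M (h (dual_act C f c)) = tensor_map A M C (\<lambda>c. h (dual_act C f c)) (\<lambda>x. x)
      (comul C c)" .
qed

lemma balanced_colinear:
  assumes h: "h \<in> rmod_hom A C M"
  shows "balanced A C C MC.T (\<lambda>x y. tens A M C (h x) y)"
  by (rule tensor_map_balanced[OF CC.tensor_product_axioms MC.tensor_product_axioms h
      additive_id]) simp

lemma colinear_plus:
  assumes h: "colinear h" and k: "colinear k"
  shows "colinear (\<lambda>c. h c \<oplus>\<^bsub>M\<^esub> k c)"
proof (rule colinearI)
  note b = balanced_colinear[OF colinearD(1)[OF h]] balanced_colinear[OF colinearD(1)[OF k]]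
  note G = MC.abelian_group_tensor_group
  show "(\<lambda>c. h c \<oplus>\<^bsub>M\<^esub> k c) \<in> rmod_hom A C M"
    by (rule rmod_hom_plus[OF X.M.right_module_axioms colinearD(1)[OF h] colinearD(1)[OF k]])
  fix c assume c: "c \<in> carrier C"
  have "coact M (h c \<oplus>\<^bsub>M\<^esub> k c) = tensor_map A M C h (\<lambda>x. x) (comul C c) \<oplus>\<^bsub>MC.T\<^esub> tensor_map A M C k
      (\<lambda>x. x) (comul C c)"
    using c colinearD(2,3)[OF h] colinearD(2,3)[OF k] by (simp add: additive_add[OF additive_coact])
  also have "\<dots> = tensor_lift MC.T (\<lambda>x y. tens A M C (h x) y \<oplus>\<^bsub>MC.T\<^esub> tens A M C (k x) y) (comul C c)"
    by (simp add: tensor_map_eq CC.lift_plus[OF G b comul_closed[OF c]])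
  also have "\<dots> = tensor_map A M C (\<lambda>c. h c \<oplus>\<^bsub>M\<^esub> k c) (\<lambda>x. x) (comul C c)"
    unfolding tensor_map_eq
    by (rule CC.lift_cong[symmetric, OF G balanced_plus[OF G b] comul_closed[OF c]])
      (simp add: MC.tens_add_left colinearD(3)[OF h] colinearD(3)[OF k])
  finally show "coact M (h c \<oplus>\<^bsub>M\<^esub> k c) = tensor_map A M C (\<lambda>c. h c \<oplus>\<^bsub>M\<^esub> k c) (\<lambda>x. x) (comul C c)" .
qed

lemma colinear_zero: "colinear (\<lambda>c. \<zero>\<^bsub>M\<^esub>)"
proof (rule colinearI)
  have r: "\<zero>\<^bsub>M\<^esub> = \<zero>\<^bsub>M\<^esub> \<triangleleft>\<^bsub>M\<^esub> a" if "a \<in> carrier A" for a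
    using additive_zero[OF abelian_group_M abelian_group_M X.M.additive_ract[OF that]] by simp
  show z: "(\<lambda>c. \<zero>\<^bsub>M\<^esub>) \<in> rmod_hom A C M"
    by (rule rmod_homI) (simp_all add: additive_def r[symmetric])
  fix c assume c: "c \<in> carrier C"
  have "\<zero>\<^bsub>MC.T\<^esub> = tensor_map A M C (\<lambda>c. \<zero>\<^bsub>M\<^esub>) (\<lambda>x. x) (comul C c)"
    unfolding tensor_map_eq
    by (rule CC.lift_unique[OF MC.abelian_group_tensor_group balanced_colinear[OF z] _
        comul_closed[OF c], where f="\<lambda>_. \<zero>\<^bsub>MC.T\<^esub>"])
      (simp_all add: additive_def MC.tens_zero_left)
  then show "coact M \<zero>\<^bsub>M\<^esub> = tensor_map A M C (\<lambda>c. \<zero>\<^bsub>M\<^esub>) (\<lambda>x. x) (comul C c)"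
    using additive_zero[OF abelian_group_M MC.abelian_group_tensor_group additive_coact] by simp
qed

lemma abelian_group_G: "abelian_group GM"
proof (rule abelian_groupI)
  show "h \<oplus>\<^bsub>GM\<^esub> k \<in> carrier GM" if "h \<in> carrier GM" "k \<in> carrier GM" for h k
    using restrict_in_G[OF colinear_plus[of h k]] that by simp
  show "\<zero>\<^bsub>GM\<^esub> \<in> carrier GM"
    using restrict_in_G[OF colinear_zero] by simp
  fix h assume h: "h \<in> carrier GM"
  then have hc: "colinear h" by simp
  show "\<zero>\<^bsub>GM\<^esub> \<oplus>\<^bsub>GM\<^esub> h = h"
    using h by (auto intro!: extensionalityI[of _ "carrier C"] simp: colinearD(3))
  interpret D: bimod_over D A "dual_bimod C" by (rule bimod_over_dual)
  \<comment> \<open>The negative of \<open>h\<close> is \<open>h \<cdot> (- \<epsilon>)\<close>.\<close>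
  let ?e = "\<ominus>\<^bsub>D\<^esub> \<one>\<^bsub>D\<^esub>"
  have e: "?e \<in> carrier D" by (intro D.L.a_inv_closed D.L.one_closed)
  then have ef: "?e \<in> functionals" by simp
  have ee: "dual_act C ?e c \<oplus>\<^bsub>C\<^esub> c = \<zero>\<^bsub>C\<^esub>" if c: "c \<in> carrier C" for c
  proof -
    have "dual_act C ?e c \<oplus>\<^bsub>C\<^esub> dual_act C \<one>\<^bsub>D\<^esub> c = dual_act C \<zero>\<^bsub>D\<^esub> c"
      using D.lact_add_left[OF e D.L.one_closed, of c] c D.L.l_neg[OF D.L.one_closed] by simp
    moreover have "dual_act C \<zero>\<^bsub>D\<^esub> c = \<zero>\<^bsub>C\<^esub>"
      using additive_zero[OF D.L.abelian_group_axioms D.M.abelian_group_axioms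
          D.additive_lact_left[of c]] c by simp
    ultimately show ?thesis using dual_act_one[OF c] by simp
  qed
  have "h \<triangleleft>\<^bsub>GM\<^esub> ?e \<in> carrier GM"
    using restrict_in_G[OF colinear_dual_act[OF hc ef]] by simp
  moreover have "h \<triangleleft>\<^bsub>GM\<^esub> ?e \<oplus>\<^bsub>GM\<^esub> h = \<zero>\<^bsub>GM\<^esub>"
  proof -
    have "h (dual_act C ?e c) \<oplus>\<^bsub>M\<^esub> h c = \<zero>\<^bsub>M\<^esub>" if c: "c \<in> carrier C" for c
      using additive_add[OF rmod_hom_additive[OF colinearD(1)[OF hc]] dual_act_closed[OF ef c] c]
          ee[OF c]
        additive_zero[OF abelian_group_C abelian_group_M rmod_hom_additive[OF colinearD(1)[OF
            hc]]] by simp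
    then show ?thesis by auto
  qed
  ultimately show "\<exists>k\<in>carrier GM. k \<oplus>\<^bsub>GM\<^esub> h = \<zero>\<^bsub>GM\<^esub>" by blast
qed (auto simp: colinearD(3) X.M.M.a_ac)

lemma right_module_G: "right_module D GM"
proof (rule right_moduleI[OF ring_dual abelian_group_G])
  have cl: "h \<triangleleft>\<^bsub>GM\<^esub> f \<in> carrier GM" if "h \<in> carrier GM" "f \<in> carrier D" for h f
    using restrict_in_G[OF colinear_dual_act[of h f]] that by simp
  show "additive GM GM (\<lambda>h. h \<triangleleft>\<^bsub>GM\<^esub> f)" if f: "f \<in> carrier D" for f
    using f by (intro additiveI cl) (auto simp: dual_act_closed)
  show "additive D GM (\<lambda>f. h \<triangleleft>\<^bsub>GM\<^esub> f)" if h: "h \<in> carrier GM" for h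
  proof (rule additiveI[OF cl[OF h]])
    fix f g assume "f \<in> carrier D" "g \<in> carrier D"
    then show "h \<triangleleft>\<^bsub>GM\<^esub> (f \<oplus>\<^bsub>D\<^esub> g) = h \<triangleleft>\<^bsub>GM\<^esub> f \<oplus>\<^bsub>GM\<^esub> h \<triangleleft>\<^bsub>GM\<^esub> g"
      using h dual_act_add[of f g] additive_add[OF rmod_hom_additive[OF colinearD(1)[of h]]]
      by (auto simp: dual_act_closed simp del: dual_ring_simps(5))
  qed
  fix h f g assume "h \<in> carrier GM" "f \<in> carrier D" "g \<in> carrier D"
  then show "h \<triangleleft>\<^bsub>GM\<^esub> (f \<otimes>\<^bsub>D\<^esub> g) = h \<triangleleft>\<^bsub>GM\<^esub> f \<triangleleft>\<^bsub>GM\<^esub> g"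
    using dual_act_mult[of f g] by (auto simp: dual_act_closed simp del: dual_ring_simps(4))
next
  fix h assume "h \<in> carrier GM"
  then show "h \<triangleleft>\<^bsub>GM\<^esub> \<one>\<^bsub>D\<^esub> = h"
    by (auto intro!: extensionalityI[of _ "carrier C"] simp: dual_act_one simp del:
        dual_ring_simps(2))
qed

sublocale G: dual_module A C GM
  by (intro dual_module.intro base_coring_axioms right_module_G)

lemma balanced_eval: "balanced D GM (dual_bimod C) M (\<lambda>h c. h c)"
proof (rule balancedI)
  show "additive GM M (\<lambda>h. h c)" if "c \<in> carrier (dual_bimod C)" for c
    using that by (intro additiveI) (simp_all add: colinearD(3))
  show "additive (dual_bimod C) M h" if "h \<in> carrier GM" for h
    using rmod_hom_additive[OF colinearD(1)[of h]] that by (simp add: additive_def)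
qed simp

lemma additive_FG_counit: "additive G.F.T M (FG_counit M)"
  unfolding FG_counit_def by (rule G.F.lift_additive[OF abelian_group_M balanced_eval])

lemma FG_counit_tens: "h \<in> carrier GM \<Longrightarrow> c \<in> carrier C \<Longrightarrow> FG_counit M (G.tn h c) = h c"
  unfolding FG_counit_def by (rule G.F.lift_tens[OF abelian_group_M balanced_eval]) simp_all

lemma FG_counit_rmod_hom: "FG_counit M \<in> rmod_hom A G.NC M"
proof (rule rmod_homI)
  show "additive G.NC M (FG_counit M)" using additive_FG_counit by simp
  fix X a assume "X \<in> carrier G.NC" and a: "a \<in> carrier A"
  then have X: "X \<in> carrier G.F.T" by simp
  show "FG_counit M (X \<triangleleft>\<^bsub>G.NC\<^esub> a) = FG_counit M X \<triangleleft>\<^bsub>M\<^esub> a"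
  proof (rule G.F.tensor_ext[OF additive_comp[OF G.F.additive_tensor_ract[OF a] additive_FG_counit]
        additive_comp[OF additive_FG_counit X.M.additive_ract[OF a]] X])
    fix h c assume h: "h \<in> carrier GM" and "c \<in> carrier (dual_bimod C)"
    then show "FG_counit M (G.tn h c \<triangleleft>\<^bsub>G.NC\<^esub> a) = FG_counit M (G.tn h c) \<triangleleft>\<^bsub>M\<^esub> a"
      using a by (simp add: G.F.tens_ract FG_counit_tens ract_closed rmod_hom_ract[OF colinearD(1)])
  qed
qed

lemma FG_counit_comod_hom: "FG_counit M \<in> comod_hom A C (F_obj A C GM) M"
proof -
  note tp = G.FC.tensor_product_axioms MC.tensor_product_axioms
  note e = FG_counit_rmod_hom
  have "coact M (FG_counit M X) = tensor_map A M C (FG_counit M) (\<lambda>c. c) (coact (F_obj A C GM) X)"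
    if X: "X \<in> carrier G.F.T" for X
  proof (rule G.F.tensor_ext[OF additive_comp[OF additive_FG_counit additive_coact]
        additive_comp[OF G.additive_coact_F tensor_map_left_additive[OF tp e]] X])
    fix h c assume h: "h \<in> carrier GM" and "c \<in> carrier (dual_bimod C)"
    then have c: "c \<in> carrier C" and hc: "colinear h" by simp_all
    have "tensor_map A M C (FG_counit M) (\<lambda>c. c) (coact (F_obj A C GM) (G.tn h c)) =
        tensor_map A M C (\<lambda>x. FG_counit M (G.tn h x)) (\<lambda>x. x) (comul C c)"
      unfolding G.coact_F_tens[OF h c]
      by (rule tensor_map_left_comp[OF CC.tensor_product_axioms tp G.tn_hom[OF h] e
          comul_closed[OF c]])
    also have "\<dots> = tensor_map A M C h (\<lambda>x. x) (comul C c)"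
      by (rule tensor_map_left_cong[OF CC.tensor_product_axioms tp(2) colinearD(1)[OF hc]
          comul_closed[OF c]])
        (rule FG_counit_tens[OF h])
    also have "\<dots> = coact M (FG_counit M (G.tn h c))"
      using colinearD(2)[OF hc c] FG_counit_tens[OF h c] by simp
    finally show "coact M (FG_counit M (G.tn h c)) =
        tensor_map A M C (FG_counit M) (\<lambda>c. c) (coact (F_obj A C GM) (G.tn h c))" by simp
  qed
  then show ?thesis using FG_counit_rmod_hom by (simp add: comod_hom_def rmod_hom_def)
qed

end

section \<open>Functoriality, naturality and the triangle identities\<close>

context base_coring
begin

lemma base_comoduleI: "right_comodule A C M \<Longrightarrow> base_comodule A C M"
  by (intro base_comodule.intro base_coring_axioms)

lemma dual_moduleI: "right_module D N \<Longrightarrow> dual_module A C N"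
  by (intro dual_module.intro base_coring_axioms)

lemma F_map_eq: "F_map A C N' f = tensor_map D N' (dual_bimod C) f (\<lambda>x. x)"
  by (simp add: F_map_def)

lemma F_map_hom:
  assumes N: "right_module D N" and N': "right_module D N'" and f: "f \<in> rmod_hom D N N'"
  shows "F_map A C N' f \<in> comod_hom A C (F_obj A C N) (F_obj A C N')"
proof -
  interpret N: dual_module A C N by (rule dual_moduleI[OF N])
  interpret N': dual_module A C N' by (rule dual_moduleI[OF N'])
  note tpF = N.F.tensor_product_axioms N'.F.tensor_product_axioms
  note tp = N.FC.tensor_product_axioms N'.FC.tensor_product_axioms
  note h = tensor_map_left_hom[OF tpF f, folded F_map_eq]
  note a = tensor_map_left_additive[OF tpF f, folded F_map_eq]
  have ft: "F_map A C N' f (N.tn n c) = N'.tn (f n) c" if "n \<in> carrier N" "c \<in> carrier C" for n c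
    using tensor_map_left_tens[OF tpF f that(1), of c] that by (simp add: F_map_eq)
  have "coact (F_obj A C N') (F_map A C N' f X) = tensor_map A N'.NC C (F_map A C N' f) (\<lambda>c. c)
      (coact (F_obj A C N) X)"
    if X: "X \<in> carrier N.F.T" for X
  proof (rule N.F.tensor_ext[OF additive_comp[OF a N'.additive_coact_F]
        additive_comp[OF N.additive_coact_F tensor_map_left_additive[OF tp h]] X])
    fix n c assume n: "n \<in> carrier N" and "c \<in> carrier (dual_bimod C)"
    then have c: "c \<in> carrier C" by simp
    have fn: "f n \<in> carrier N'" by (rule rmod_hom_closed[OF f n])
    have "tensor_map A N'.NC C (F_map A C N' f) (\<lambda>c. c) (coact (F_obj A C N) (N.tn n c)) =
        tensor_map A N'.NC C (\<lambda>x. F_map A C N' f (N.tn n x)) (\<lambda>x. x) (comul C c)"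
      unfolding N.coact_F_tens[OF n c]
      by (rule tensor_map_left_comp[OF CC.tensor_product_axioms tp N.tn_hom[OF n] h
          comul_closed[OF c]])
    also have "\<dots> = tensor_map A N'.NC C (N'.tn (f n)) (\<lambda>x. x) (comul C c)"
      by (rule tensor_map_left_cong[OF CC.tensor_product_axioms tp(2) N'.tn_hom[OF fn]
          comul_closed[OF c]])
        (rule ft[OF n])
    also have "\<dots> = coact (F_obj A C N') (F_map A C N' f (N.tn n c))"
      using N'.coact_F_tens[OF fn c] ft[OF n c] by simp
    finally show "coact (F_obj A C N') (F_map A C N' f (N.tn n c)) =
        tensor_map A N'.NC C (F_map A C N' f) (\<lambda>c. c) (coact (F_obj A C N) (N.tn n c))" by simp
  qed
  then show ?thesis using h by (simp add: comod_hom_def rmod_hom_def)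
qed

lemma G_map_hom:
  assumes M: "right_comodule A C M" and M': "right_comodule A C M'" and f: "f \<in> comod_hom A C M M'"
  shows "G_map C f \<in> rmod_hom D (G_obj A C M) (G_obj A C M')"
proof -
  interpret M: base_comodule A C M by (rule base_comoduleI[OF M])
  interpret M': base_comodule A C M' by (rule base_comoduleI[OF M'])
  have fh: "f \<in> rmod_hom A M M'" and fc: "\<And>m. m \<in> carrier M \<Longrightarrow> coact M' (f m) = tensor_map A M' C f
      (\<lambda>c. c) (coact M m)"
    using f by (auto simp: comod_hom_def)
  have col: "M'.colinear (\<lambda>c. f (h c))" if h: "M.colinear h" for h
  proof (rule M'.colinearI[OF rmod_hom_comp[OF M.colinearD(1)[OF h] fh]])
    fix c assume c: "c \<in> carrier C"
    show "coact M' (f (h c)) = tensor_map A M' C (\<lambda>c. f (h c)) (\<lambda>x. x) (comul C c)"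
      using M.colinearD(2,3)[OF h c] fc
        tensor_map_left_comp[OF CC.tensor_product_axioms M.MC.tensor_product_axioms
            M'.MC.tensor_product_axioms
          M.colinearD(1)[OF h] fh comul_closed[OF c]] by simp
  qed
  show ?thesis
  proof (rule rmod_homI)
    show "additive (G_obj A C M) (G_obj A C M') (G_map C f)"
    proof (rule additiveI)
      show "G_map C f h \<in> carrier (G_obj A C M')" if "h \<in> carrier (G_obj A C M)" for h
        using M'.restrict_in_G[OF col[of h]] that by (simp add: G_map_def)
      show "G_map C f (h \<oplus>\<^bsub>G_obj A C M\<^esub> k) = G_map C f h \<oplus>\<^bsub>G_obj A C M'\<^esub> G_map C f k"
        if "h \<in> carrier (G_obj A C M)" "k \<in> carrier (G_obj A C M)" for h k
        using that additive_add[OF rmod_hom_additive[OF fh]] M.colinearD(3) by (auto simp: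
            G_map_def)
    qed
    show "G_map C f (h \<triangleleft>\<^bsub>G_obj A C M\<^esub> s) = G_map C f h \<triangleleft>\<^bsub>G_obj A C M'\<^esub> s"
      if "h \<in> carrier (G_obj A C M)" "s \<in> carrier D" for h s
      using that by (auto simp: G_map_def dual_act_closed)
  qed
qed

text \<open>A bijective comodule map is an isomorphism of comodules.\<close>

lemma comod_isoI:
  assumes M: "right_comodule A C M" and M': "right_comodule A C M'" and f: "f \<in> comod_hom A C M M'"
    and g: "\<And>n. n \<in> carrier M' \<Longrightarrow> g n \<in> carrier M"
    and gf: "\<And>m. m \<in> carrier M \<Longrightarrow> g (f m) = m" and fg: "\<And>n. n \<in> carrier M' \<Longrightarrow> f (g n) = n"
  shows "f \<in> comod_iso A C M M'"
proof -
  interpret M: base_comodule A C M by (rule base_comoduleI[OF M])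
  interpret M': base_comodule A C M' by (rule base_comoduleI[OF M'])
  note tp = M.MC.tensor_product_axioms M'.MC.tensor_product_axioms
  have fh: "f \<in> rmod_hom A M M'" and fc: "\<And>m. m \<in> carrier M \<Longrightarrow> coact M' (f m) = tensor_map A M' C f
      (\<lambda>c. c) (coact M m)"
    using f by (auto simp: comod_hom_def)
  have gh: "g \<in> rmod_hom A M' M"
    by (rule rmod_hom_inverse[OF M.X.M.right_module_axioms M'.X.M.right_module_axioms fh g gf fg])
  have "coact M (g n) = tensor_map A M C g (\<lambda>c. c) (coact M' n)" if n: "n \<in> carrier M'" for n
  proof -
    note gn = g[OF n]
    have id: "(\<lambda>x. x) \<in> rmod_hom A M M" by (auto simp: rmod_hom_def)
    have "tensor_map A M C g (\<lambda>c. c) (coact M' n) = tensor_map A M C g (\<lambda>c. c) (tensor_map A M' C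
        f (\<lambda>c. c) (coact M (g n)))"
      using fc[OF gn] fg[OF n] by simp
    also have "\<dots> = tensor_map A M C (\<lambda>x. g (f x)) (\<lambda>c. c) (coact M (g n))"
      by (rule tensor_map_left_comp[OF tp tp(1) fh gh M.coact_closed[OF gn]])
    also have "\<dots> = tensor_map A M C (\<lambda>x. x) (\<lambda>c. c) (coact M (g n))"
      by (rule tensor_map_left_cong[OF tp(1) tp(1) id M.coact_closed[OF gn] gf])
    also have "\<dots> = coact M (g n)" by (rule tensor_map_left_id[OF tp(1) M.coact_closed[OF gn]])
    finally show ?thesis by simp
  qed
  then have "g \<in> comod_hom A C M' M" using gh by (simp add: comod_hom_def)
  then show ?thesis using f gf fg by (auto simp: comod_iso_def)
qed

lemma FG_unit_hom:
  assumes N: "right_module D N"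
  shows "FG_unit A C N \<in> rmod_hom D N (G_obj A C (F_obj A C N))"
proof -
  interpret N: dual_module A C N by (rule dual_moduleI[OF N])
  interpret FN: base_comodule A C "F_obj A C N" by (rule base_comoduleI[OF N.right_comodule_F])
  have col: "FN.colinear (N.tn n)" if n: "n \<in> carrier N" for n
    using N.tn_hom[OF n] N.coact_F_tens[OF n] by (intro FN.colinearI) (simp_all add: rmod_hom_def)
  show ?thesis
  proof (rule rmod_homI)
    show "additive N (G_obj A C (F_obj A C N)) (FG_unit A C N)"
    proof (rule additiveI)
      show "FG_unit A C N n \<in> carrier (G_obj A C (F_obj A C N))" if "n \<in> carrier N" for n
        using FN.restrict_in_G[OF col[OF that]] by (simp add: FG_unit_def)
      show "FG_unit A C N (n \<oplus>\<^bsub>N\<^esub> m) = FG_unit A C N n \<oplus>\<^bsub>G_obj A C (F_obj A C N)\<^esub> FG_unit A C N m"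
        if "n \<in> carrier N" "m \<in> carrier N" for n m
        using that N.F.tens_add_left[of n m] by (auto simp: FG_unit_def fun_eq_iff)
    qed
    show "FG_unit A C N (n \<triangleleft>\<^bsub>N\<^esub> f) = FG_unit A C N n \<triangleleft>\<^bsub>G_obj A C (F_obj A C N)\<^esub> f"
      if "n \<in> carrier N" "f \<in> carrier D" for n f
      using that N.F.tens_ract_left[of n f] by (auto simp: FG_unit_def fun_eq_iff dual_act_closed)
  qed
qed

lemma F_map_id:
  assumes N: "right_module D N" and X: "X \<in> carrier (F_obj A C N)"
  shows "F_map A C N (\<lambda>n. n) X = X"
proof -
  interpret N: dual_module A C N by (rule dual_moduleI[OF N])
  show ?thesis using X unfolding F_map_eq by (intro tensor_map_left_id[OF
      N.F.tensor_product_axioms]) simp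
qed

lemma F_map_comp:
  assumes N: "right_module D N" and N': "right_module D N'" and N'': "right_module D N''"
    and f: "f \<in> rmod_hom D N N'" and g: "g \<in> rmod_hom D N' N''" and X: "X \<in> carrier (F_obj A C N)"
  shows "F_map A C N'' (\<lambda>n. g (f n)) X = F_map A C N'' g (F_map A C N' f X)"
proof -
  interpret N: dual_module A C N by (rule dual_moduleI[OF N])
  interpret N': dual_module A C N' by (rule dual_moduleI[OF N'])
  interpret N'': dual_module A C N'' by (rule dual_moduleI[OF N''])
  show ?thesis using X unfolding F_map_eq
    by (intro tensor_map_left_comp[symmetric, OF N.F.tensor_product_axioms
        N'.F.tensor_product_axioms N''.F.tensor_product_axioms f g]) simp
qed

lemma F_map_tens:
  fixes N :: "('c \<Rightarrow> 'a, 'n) rmod" and N' :: "('c \<Rightarrow> 'a, 'n1) rmod"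
  assumes N: "right_module D N" and N': "right_module D N'" and f: "f \<in> rmod_hom D N N'"
    and n: "n \<in> carrier N" and c: "c \<in> carrier C"
  shows "F_map A C N' f (tens D N (dual_bimod C) n c) = tens D N' (dual_bimod C) (f n) c"
proof -
  interpret N: dual_module A C N by (rule dual_moduleI[OF N])
  interpret N': dual_module A C N' by (rule dual_moduleI[OF N'])
  show ?thesis using c unfolding F_map_eq
    by (intro tensor_map_left_tens[OF N.F.tensor_product_axioms N'.F.tensor_product_axioms f n])
        simp
qed

lemma F_map_additive:
  fixes N :: "('c \<Rightarrow> 'a, 'n) rmod" and N' :: "('c \<Rightarrow> 'a, 'n1) rmod"
  assumes N: "right_module D N" and N': "right_module D N'" and f: "f \<in> rmod_hom D N N'"
  shows "additive (tensor_group D N (dual_bimod C)) (tensor_group D N' (dual_bimod C)) (F_map A C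
      N' f)"
proof -
  interpret N: dual_module A C N by (rule dual_moduleI[OF N])
  interpret N': dual_module A C N' by (rule dual_moduleI[OF N'])
  show ?thesis unfolding F_map_eq
    by (rule tensor_map_left_additive[OF N.F.tensor_product_axioms N'.F.tensor_product_axioms f])
qed

lemma FG_unit_natural:
  assumes N: "right_module D N" and N': "right_module D N'" and f: "f \<in> rmod_hom D N N'" and n: "n
      \<in> carrier N"
  shows "FG_unit A C N' (f n) = G_map C (F_map A C N' f) (FG_unit A C N n)"
  unfolding FG_unit_def G_map_def by (rule restrict_ext) (simp add: F_map_tens[OF N N' f n])

lemma FG_counit_natural:
  assumes M: "right_comodule A C M" and M': "right_comodule A C M'" and f: "f \<in> comod_hom A C M M'"
    and X: "X \<in> carrier (F_obj A C (G_obj A C M))"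
  shows "FG_counit M' (F_map A C (G_obj A C M') (G_map C f) X) = f (FG_counit M X)"
proof -
  interpret M: base_comodule A C M by (rule base_comoduleI[OF M])
  interpret M': base_comodule A C M' by (rule base_comoduleI[OF M'])
  note g = G_map_hom[OF M M' f]
  have fh: "f \<in> rmod_hom A M M'" using f by (simp add: comod_hom_def)
  have X': "X \<in> carrier M.G.F.T" using X by simp
  show ?thesis
  proof (rule M.G.F.tensor_ext[OF additive_comp[OF F_map_additive[OF M.right_module_G
      M'.right_module_G g] M'.additive_FG_counit]
        additive_comp[OF M.additive_FG_counit rmod_hom_additive[OF fh]] X'])
    fix h c assume h: "h \<in> carrier (G_obj A C M)" and "c \<in> carrier (dual_bimod C)"
    then have c: "c \<in> carrier C" by simp
    show "FG_counit M' (F_map A C (G_obj A C M') (G_map C f) (M.G.tn h c)) = f (FG_counit M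
        (M.G.tn h c))"
      using M'.FG_counit_tens[OF rmod_hom_closed[OF g h] c] M.FG_counit_tens[OF h c] c
      by (simp add: F_map_tens[OF M.right_module_G M'.right_module_G g h c] G_map_def)
  qed
qed

lemma triangle_F:
  assumes N: "right_module D N" and X: "X \<in> carrier (F_obj A C N)"
  shows "FG_counit (F_obj A C N) (F_map A C (G_obj A C (F_obj A C N)) (FG_unit A C N) X) = X"
proof -
  interpret N: dual_module A C N by (rule dual_moduleI[OF N])
  interpret FN: base_comodule A C "F_obj A C N" by (rule base_comoduleI[OF N.right_comodule_F])
  note u = FG_unit_hom[OF N]
  have X': "X \<in> carrier N.F.T" using X by simp
  have "additive FN.G.F.T N.F.T (FG_counit (F_obj A C N))"
    using FN.additive_FG_counit by (simp add: additive_def)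
  from additive_comp[OF F_map_additive[OF N FN.right_module_G u] this] show ?thesis
  proof (rule N.F.tensor_ext[OF _ additive_id X'])
    fix n c assume n: "n \<in> carrier N" and "c \<in> carrier (dual_bimod C)"
    then have c: "c \<in> carrier C" by simp
    show "FG_counit (F_obj A C N) (F_map A C (G_obj A C (F_obj A C N)) (FG_unit A C N) (N.tn n c))
        = N.tn n c"
      using FN.FG_counit_tens[OF rmod_hom_closed[OF u n] c] c
      by (simp add: F_map_tens[OF N FN.right_module_G u n c] FG_unit_def)
  qed
qed

lemma triangle_G:
  assumes M: "right_comodule A C M" and h: "h \<in> carrier (G_obj A C M)"
  shows "G_map C (FG_counit M) (FG_unit A C (G_obj A C M) h) = h"
proof -
  interpret M: base_comodule A C M by (rule base_comoduleI[OF M])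
  show ?thesis using h M.FG_counit_tens[OF h]
    by (auto intro!: extensionalityI[of _ "carrier C"] simp: G_map_def FG_unit_def)
qed

lemma G_obj_extensional: "h \<in> carrier (G_obj A C M) \<Longrightarrow> h \<in> extensional (carrier C)"
  by (simp add: G_obj_def)

lemma G_map_id: "h \<in> carrier (G_obj A C M) \<Longrightarrow> G_map C (\<lambda>m. m) h = h"
  using extensional_restrict[OF G_obj_extensional] by (simp add: G_map_def)

lemma G_map_comp: "G_map C (\<lambda>m. g (f m)) h = G_map C g (G_map C f h)"
  by (auto simp: G_map_def)

end

section \<open>Frobenius corings\<close>

text \<open>A coring with chosen Frobenius data \<open>z\<close> and \<open>\<theta>\<close>; \<open>th c d\<close> is \<open>\<theta>(c \<otimes> d)\<close>.\<close>

locale frobenius_data = base_coring A C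
  for A :: "('a, 'z) ring_scheme" (structure) and C :: "('a, 'c) cor" (structure) +
  fixes z :: 'c and \<theta> :: "('c, 'c) tensor \<Rightarrow> 'a"
  assumes z_closed: "z \<in> carrier C"
    and theta_hom: "\<theta> \<in> bimod_hom A A (bitensor A C C) (regular_bimod A)"
    and z_central: "a \<in> carrier A \<Longrightarrow> a \<triangleright>\<^bsub>C\<^esub> z = z \<triangleleft>\<^bsub>C\<^esub> a"
    and theta_comul: "\<lbrakk>c \<in> carrier C; d \<in> carrier C\<rbrakk> \<Longrightarrow>
       tensor_lift C (\<lambda>x y. x \<triangleleft>\<^bsub>C\<^esub> \<theta> (tens A C C y d)) (comul C c) =
       tensor_lift C (\<lambda>x y. \<theta> (tens A C C c x) \<triangleright>\<^bsub>C\<^esub> y) (comul C d)"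
    and theta_z_left: "c \<in> carrier C \<Longrightarrow> \<theta> (tens A C C z c) = counit C c"
    and theta_z_right: "c \<in> carrier C \<Longrightarrow> \<theta> (tens A C C c z) = counit C c"
begin

abbreviation "th c d \<equiv> \<theta> (tens A C C c d)"

lemma additive_theta: "additive CC.T A \<theta>"
  using rmod_hom_additive[OF bimod_homD(1)[OF theta_hom]] by (simp add: additive_def)

lemma balanced_th: "balanced A C C A th"
  by (rule balanced_comp[OF CC.tens_balanced additive_theta])

lemma th_closed: "\<lbrakk>c \<in> carrier C; d \<in> carrier C\<rbrakk> \<Longrightarrow> th c d \<in> carrier A"
  by (rule balancedD(4)[OF balanced_th])

lemma th_ract: "\<lbrakk>c \<in> carrier C; d \<in> carrier C; a \<in> carrier A\<rbrakk> \<Longrightarrow> th c (d \<triangleleft>\<^bsub>C\<^esub> a) = th c d \<otimes>\<^bsub>A\<^esub> a"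
  using rmod_hom_ract[OF bimod_homD(1)[OF theta_hom], of "tens A C C c d" a] by (simp add:
      CC.tens_closed CC.tens_ract)

lemma th_lact: "\<lbrakk>c \<in> carrier C; d \<in> carrier C; a \<in> carrier A\<rbrakk> \<Longrightarrow> th (a \<triangleright>\<^bsub>C\<^esub> c) d = a \<otimes>\<^bsub>A\<^esub> th c d"
  using bimod_homD(2)[OF theta_hom, of a "tens A C C c d"] by (simp add: CC.tens_closed
      CC.tens_lact)

lemma th_functional: "c \<in> carrier C \<Longrightarrow> th c \<in> functionals"
  using balancedD(2)[OF balanced_th] by (intro rmod_homI) (simp_all add: additive_def th_ract)

text \<open>The Casimir identity at \<open>(z, c)\<close>: \<open>z\<^sub>(\<^sub>1\<^sub>) \<theta>(z\<^sub>(\<^sub>2\<^sub>) \<otimes> c) = \<theta>(z \<otimes> c\<^sub>(\<^sub>1\<^sub>)) c\<^sub>(\<^sub>2\<^sub>) = c\<close>.\<close>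

lemma th_z_comul:
  assumes c: "c \<in> carrier C"
  shows "tensor_lift C (\<lambda>x y. x \<triangleleft>\<^bsub>C\<^esub> th y c) (comul C z) = c"
proof -
  have "tensor_lift C (\<lambda>x y. x \<triangleleft>\<^bsub>C\<^esub> th y c) (comul C z) = tensor_lift C (\<lambda>x y. th z x \<triangleright>\<^bsub>C\<^esub> y)
      (comul C c)"
    by (rule theta_comul[OF z_closed c])
  also have "\<dots> = tensor_lift C (\<lambda>x y. counit C x \<triangleright>\<^bsub>C\<^esub> y) (comul C c)"
    by (rule CC.lift_cong[OF abelian_group_C balanced_dual_act[OF counit_functional]
        comul_closed[OF c]])
      (simp add: theta_z_left)
  finally show ?thesis using counit_left[OF c] by simp
qed

text \<open>The Casimir identity at \<open>(c, z)\<close>: \<open>\<phi>\<^sub>c \<cdot> z = c\<close>.\<close>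

lemma dual_act_th_z:
  assumes c: "c \<in> carrier C"
  shows "dual_act C (th c) z = c"
proof -
  have "dual_act C (th c) z = tensor_lift C (\<lambda>x y. x \<triangleleft>\<^bsub>C\<^esub> th y z) (comul C c)"
    unfolding dual_act_def by (rule theta_comul[symmetric, OF c z_closed])
  also have "\<dots> = tensor_lift C (\<lambda>x y. x \<triangleleft>\<^bsub>C\<^esub> counit C y) (comul C c)"
    by (rule CC.lift_cong[OF abelian_group_C balanced_counit_right comul_closed[OF c]])
      (simp add: theta_z_right)
  finally show ?thesis using counit_right[OF c] by simp
qed

lemma balanced_ract_th:
  assumes c: "c \<in> carrier C" and M: "right_module A M"
  shows "balanced A M C M (\<lambda>x y. x \<triangleleft>\<^bsub>M\<^esub> th y c)"
proof -
  interpret r: right_module A M by fact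
  show ?thesis
    using additive_comp[OF balancedD(1)[OF balanced_th c] r.additive_ract_right] r.additive_ract
    by (intro balancedI) (simp_all add: th_closed c th_lact r.ract_assoc)
qed

text \<open>Conversely \<open>\<phi>\<^bsub>f \<cdot> z\<^esub> = f\<close>, since
  \<open>\<theta>(f(z\<^sub>(\<^sub>1\<^sub>)) z\<^sub>(\<^sub>2\<^sub>) \<otimes> c) = f(z\<^sub>(\<^sub>1\<^sub>) \<theta>(z\<^sub>(\<^sub>2\<^sub>) \<otimes> c)) = f(c)\<close>.\<close>

lemma th_dual_act_z:
  assumes f: "f \<in> functionals" and c: "c \<in> carrier C"
  shows "th (dual_act C f z) c = f c"
proof -
  note \<Delta> = comul_closed[OF z_closed]
  note b = balanced_ract_th[OF c right_module_axioms]
  have "th (dual_act C f z) c = tensor_lift A (\<lambda>x y. th (f x \<triangleright>\<^bsub>C\<^esub> y) c) (comul C z)"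
    unfolding dual_act_def
    by (rule CC.lift_comp[OF abelian_group_C abelian_group_A balanced_dual_act[OF f]
        balancedD(1)[OF balanced_th c] \<Delta>])
  also have "\<dots> = tensor_lift A (\<lambda>x y. f (x \<triangleleft>\<^bsub>C\<^esub> th y c)) (comul C z)"
    by (rule CC.lift_cong[OF abelian_group_A balanced_comp[OF b functional_additive[OF f]] \<Delta>])
      (simp add: th_lact functional_closed[OF f] functional_ract[OF f] th_closed c)
  also have "\<dots> = f (tensor_lift C (\<lambda>x y. x \<triangleleft>\<^bsub>C\<^esub> th y c) (comul C z))"
    by (rule CC.lift_comp[symmetric, OF abelian_group_C abelian_group_A b functional_additive[OF
        f] \<Delta>])
  finally show ?thesis using th_z_comul[OF c] by simp
qed

text \<open>The coordinate of \<open>c\<close> with respect to the basis \<open>z\<close> of the left \<open>C\<^sup>*\<close>-module \<open>C\<close>.\<close>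

definition coord :: "'c \<Rightarrow> 'c \<Rightarrow> 'a" where
  "coord c = restrict (th c) (carrier C)"

lemma coord_closed: "c \<in> carrier C \<Longrightarrow> coord c \<in> carrier D"
  unfolding coord_def using restrict_functional[OF th_functional] by simp

lemma coord_act_z: "c \<in> carrier C \<Longrightarrow> dual_act C (coord c) z = c"
  using dual_act_restrict[OF th_functional z_closed, of c "coord c"] dual_act_th_z by (simp add:
      coord_def)

lemma coord_dual_act_z:
  assumes "f \<in> carrier D" shows "coord (dual_act C f z) = f"
  using assms by (auto intro!: extensionalityI[of _ "carrier C"] simp: coord_def th_dual_act_z)

lemma coord_z: "coord z = \<one>\<^bsub>D\<^esub>"
  by (auto simp: coord_def theta_z_left)

text \<open>Taking coordinates is left \<open>C\<^sup>*\<close>-linear, because its inverse \<open>f \<mapsto> f \<cdot> z\<close> is.\<close>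

lemma coord_dual_act:
  assumes f: "f \<in> carrier D" and c: "c \<in> carrier C"
  shows "coord (dual_act C f c) = f \<otimes>\<^bsub>D\<^esub> coord c"
proof -
  interpret D: ring D by (rule ring_dual)
  have "dual_act C f c = dual_act C (f \<otimes>\<^bsub>D\<^esub> coord c) z"
    using f coord_closed[OF c] by (simp add: dual_act_mult z_closed coord_act_z[OF c] del:
        dual_ring_simps(4))
  then show ?thesis using coord_dual_act_z[OF D.m_closed[OF f coord_closed[OF c]]] by (simp only:)
qed

lemma additive_coord: "additive C D coord"
  using balancedD(1)[OF balanced_th] coord_closed
  by (intro additiveI) (auto simp: coord_def additive_def)

text \<open>Every element of \<open>N \<otimes> C\<close> over \<open>C\<^sup>*\<close> is \<open>n \<otimes> z\<close> for a unique \<open>n\<close>; \<open>first_coord\<close> is that \<open>n\<close>.\<close>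

definition first_coord :: "('c \<Rightarrow> 'a, 'n) rmod \<Rightarrow> ('n, 'c) tensor \<Rightarrow> 'n" where
  "first_coord N = tensor_lift N (\<lambda>n c. n \<triangleleft>\<^bsub>N\<^esub> coord c)"

context
  fixes N :: "('c \<Rightarrow> 'a, 'n) rmod"
  assumes N: "right_module D N"
begin

interpretation N: dual_module A C N by (rule dual_moduleI[OF N])

lemma balanced_ract_coord: "balanced D N (dual_bimod C) N (\<lambda>n c. n \<triangleleft>\<^bsub>N\<^esub> coord c)"
proof (rule balancedI)
  show "additive N N (\<lambda>n. n \<triangleleft>\<^bsub>N\<^esub> coord c)" if "c \<in> carrier (dual_bimod C)" for c
    using that N.N.additive_ract coord_closed by simp
  show "additive (dual_bimod C) N (\<lambda>c. n \<triangleleft>\<^bsub>N\<^esub> coord c)" if "n \<in> carrier N" for n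
    using additive_comp[OF additive_coord N.N.additive_ract_right[OF that]] by (simp add:
        additive_def)
  show "n \<triangleleft>\<^bsub>N\<^esub> f \<triangleleft>\<^bsub>N\<^esub> coord c = n \<triangleleft>\<^bsub>N\<^esub> coord (f \<triangleright>\<^bsub>dual_bimod C\<^esub> c)"
    if "n \<in> carrier N" "f \<in> carrier D" "c \<in> carrier (dual_bimod C)" for n f c
    using that coord_dual_act[of f c] coord_closed[of c] N.N.ract_assoc[of n f "coord c"]
    by (simp del: dual_ring_simps)
qed

lemma additive_first_coord: "additive N.F.T N (first_coord N)"
  unfolding first_coord_def by (rule N.F.lift_additive[OF N.N.M.abelian_group_axioms
      balanced_ract_coord])

lemma first_coord_tens: "n \<in> carrier N \<Longrightarrow> c \<in> carrier C \<Longrightarrow> first_coord N (N.tn n c) = n \<triangleleft>\<^bsub>N\<^esub> coord c"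
  unfolding first_coord_def by (rule N.F.lift_tens[OF N.N.M.abelian_group_axioms
      balanced_ract_coord]) simp_all

lemma first_coord_tens_z: "n \<in> carrier N \<Longrightarrow> first_coord N (N.tn n z) = n"
  using first_coord_tens[OF _ z_closed] N.N.ract_one by (simp add: coord_z del: dual_ring_simps)

lemma first_coord_closed: "X \<in> carrier N.F.T \<Longrightarrow> first_coord N X \<in> carrier N"
  by (rule additive_closed[OF additive_first_coord])

lemma tens_first_coord:
  assumes X: "X \<in> carrier N.F.T"
  shows "N.tn (first_coord N X) z = X"
proof (rule N.F.tensor_ext[OF additive_comp[OF additive_first_coord balancedD(1)[OF
    N.F.tens_balanced]] additive_id X])
  show "z \<in> carrier (dual_bimod C)" using z_closed by simp
  fix n c assume n: "n \<in> carrier N" and "c \<in> carrier (dual_bimod C)"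
  then have c: "c \<in> carrier C" by simp
  show "N.tn (first_coord N (N.tn n c)) z = N.tn n c"
    using N.F.tens_ract_left[OF n coord_closed[OF c], of z] first_coord_tens[OF n c]
        coord_act_z[OF c] z_closed by simp
qed

end

text \<open>The comodule map \<open>C \<rightarrow> M\<close> with value \<open>m\<close> at \<open>z\<close>: \<open>c \<mapsto> m\<^sub>(\<^sub>0\<^sub>) \<theta>(m\<^sub>(\<^sub>1\<^sub>) \<otimes> c)\<close>.\<close>

definition colin_at :: "('a, 'c, 'm) comod \<Rightarrow> 'm \<Rightarrow> 'c \<Rightarrow> 'm" where
  "colin_at M m = (\<lambda>c\<in>carrier C. tensor_lift M (\<lambda>x y. x \<triangleleft>\<^bsub>M\<^esub> th y c) (coact M m))"

context
  fixes M :: "('a, 'c, 'm) comod"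
  assumes M: "right_comodule A C M"
begin

interpretation M: base_comodule A C M by (rule base_comoduleI[OF M])

lemma colin_at_z:
  assumes m: "m \<in> carrier M"
  shows "colin_at M m z = m"
proof -
  have b: "balanced A M C M (\<lambda>x y. x \<triangleleft>\<^bsub>M\<^esub> counit C y)"
    by (rule M.MC.balanced_cong[OF balanced_ract_th[OF z_closed M.X.M.right_module_axioms]]) (simp
        add: theta_z_right)
  have "colin_at M m z = tensor_lift M (\<lambda>x y. x \<triangleleft>\<^bsub>M\<^esub> counit C y) (coact M m)"
    unfolding colin_at_def using z_closed
    by (simp, intro M.MC.lift_cong[OF M.abelian_group_M b M.coact_closed[OF m]]) (simp add:
        theta_z_right)
  then show ?thesis using M.X.coact_counit[OF m] by simp
qed

text \<open>A comodule map \<open>h\<close> is determined by \<open>h z\<close>: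
  \<open>h(z)\<^sub>(\<^sub>0\<^sub>) \<theta>(h(z)\<^sub>(\<^sub>1\<^sub>) \<otimes> c) = h(z\<^sub>(\<^sub>1\<^sub>)) \<theta>(z\<^sub>(\<^sub>2\<^sub>) \<otimes> c) = h(z\<^sub>(\<^sub>1\<^sub>) \<theta>(z\<^sub>(\<^sub>2\<^sub>) \<otimes> c)) = h(c)\<close>.\<close>

lemma colin_at_eval_z:
  assumes h: "h \<in> carrier (G_obj A C M)"
  shows "colin_at M (h z) = h"
proof (rule extensionalityI[of _ "carrier C"])
  from h have hc: "M.colinear h" and he: "h \<in> extensional (carrier C)" by simp_all
  show "h \<in> extensional (carrier C)" by (rule he)
  show "colin_at M (h z) \<in> extensional (carrier C)" by (simp add: colin_at_def)
  fix c assume c: "c \<in> carrier C"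
  note \<Delta> = comul_closed[OF z_closed]
  note b = balanced_ract_th[OF c right_module_axioms]
  note bM = balanced_ract_th[OF c M.X.M.right_module_axioms]
  note ha = rmod_hom_additive[OF M.colinearD(1)[OF hc]]
  have "colin_at M (h z) c = tensor_lift M (\<lambda>x y. x \<triangleleft>\<^bsub>M\<^esub> th y c) (tensor_map A M C h (\<lambda>x. x)
      (comul C z))"
    using c M.colinearD(2)[OF hc z_closed] by (simp add: colin_at_def)
  also have "\<dots> = tensor_lift M (\<lambda>x y. h x \<triangleleft>\<^bsub>M\<^esub> th y c) (comul C z)"
    by (rule lift_tensor_map_left[OF CC.tensor_product_axioms M.MC.tensor_product_axioms
        M.colinearD(1)[OF hc] M.abelian_group_M bM \<Delta>])
  also have "\<dots> = tensor_lift M (\<lambda>x y. h (x \<triangleleft>\<^bsub>C\<^esub> th y c)) (comul C z)"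
    by (rule CC.lift_cong[OF M.abelian_group_M balanced_comp[OF b ha] \<Delta>])
      (simp add: rmod_hom_ract[OF M.colinearD(1)[OF hc]] th_closed c)
  also have "\<dots> = h (tensor_lift C (\<lambda>x y. x \<triangleleft>\<^bsub>C\<^esub> th y c) (comul C z))"
    by (rule CC.lift_comp[symmetric, OF abelian_group_C M.abelian_group_M b ha \<Delta>])
  also have "\<dots> = h c" by (simp only: th_z_comul[OF c])
  finally show "colin_at M (h z) c = h c" .
qed

text \<open>Colinearity: with \<open>h(c) = m\<^sub>(\<^sub>0\<^sub>) \<theta>(m\<^sub>(\<^sub>1\<^sub>) \<otimes> c)\<close>, the coaction of \<open>h(c)\<close> is
  \<open>m\<^sub>(\<^sub>0\<^sub>) \<otimes> m\<^sub>(\<^sub>1\<^sub>) \<theta>(m\<^sub>(\<^sub>2\<^sub>) \<otimes> c) = m\<^sub>(\<^sub>0\<^sub>) \<otimes> \<theta>(m\<^sub>(\<^sub>1\<^sub>) \<otimes> c\<^sub>(\<^sub>1\<^sub>)) c\<^sub>(\<^sub>2\<^sub>) = h(c\<^sub>(\<^sub>1\<^sub>)) \<otimes>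
      c\<^sub>(\<^sub>2\<^sub>)\<close>.\<close>

lemma colin_at_colinear:
  assumes m: "m \<in> carrier M"
  shows "colin_at M m \<in> carrier (G_obj A C M)"
proof -
  define H where "H c = tensor_lift M (\<lambda>x y. x \<triangleleft>\<^bsub>M\<^esub> th y c) (coact M m)" for c
  note \<rho> = M.coact_closed[OF m]
  note bM = balanced_ract_th[OF _ M.X.M.right_module_axioms]
  note GM = M.abelian_group_M
  note G = M.MC.abelian_group_tensor_group
  have x_th: "(\<lambda>u. x \<triangleleft>\<^bsub>M\<^esub> th y u) \<in> rmod_hom A C M" if "x \<in> carrier M" "y \<in> carrier C" for x y
    by (rule rmod_homI[OF additive_comp[OF balancedD(2)[OF balanced_th that(2)]
        M.X.M.additive_ract_right[OF that(1)]]])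
      (simp add: th_ract that th_closed M.X.M.ract_assoc)
  have H: "H \<in> rmod_hom A C M"
  proof (rule rmod_homI)
    show "additive C M H" unfolding H_def
      by (rule M.MC.additive_lift_param[OF GM abelian_group_C \<rho> bM]) (simp_all add:
          rmod_hom_additive[OF x_th])
    fix c a assume c: "c \<in> carrier C" and a: "a \<in> carrier A"
    have "H (c \<triangleleft>\<^bsub>C\<^esub> a) = tensor_lift M (\<lambda>x y. (x \<triangleleft>\<^bsub>M\<^esub> th y c) \<triangleleft>\<^bsub>M\<^esub> a) (coact M m)"
      unfolding H_def
      by (rule M.MC.lift_cong[OF GM balanced_comp[OF bM[OF c] M.X.M.additive_ract[OF a]] \<rho>])
        (rule rmod_hom_ract[OF x_th _ a]; simp add: c)
    then show "H (c \<triangleleft>\<^bsub>C\<^esub> a) = H c \<triangleleft>\<^bsub>M\<^esub> a"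
      unfolding H_def
      by (simp add: M.MC.lift_comp[OF GM GM bM[OF c] M.X.M.additive_ract[OF a] \<rho>])
  qed
  have "M.colinear H"
  proof (rule M.colinearI[OF H])
    fix c assume c: "c \<in> carrier C"
    note \<Delta> = comul_closed[OF c]
    define t where "t u v y = tens A M C u (v \<triangleleft>\<^bsub>C\<^esub> th y c)" for u v y
    have tn_add: "additive C M.MC.T (tens A M C x)" if "x \<in> carrier M" for x
      by (rule balancedD(2)[OF M.MC.tens_balanced that])
    have t: "trilinear A A M C C M.MC.T t"
      unfolding t_def
    proof (rule trilinearI)
      show "additive M M.MC.T (\<lambda>u. tens A M C u (v \<triangleleft>\<^bsub>C\<^esub> th y c))" if "v \<in> carrier C" "y \<in> carrier
          C" for v y
        using that c by (intro balancedD(1)[OF M.MC.tens_balanced] ract_closed th_closed)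
      show "additive C M.MC.T (\<lambda>v. tens A M C u (v \<triangleleft>\<^bsub>C\<^esub> th y c))" if "u \<in> carrier M" "y \<in> carrier
          C" for u y
        by (rule additive_comp[OF additive_ract[OF th_closed[OF that(2) c]] tn_add[OF that(1)]])
      show "additive C M.MC.T (\<lambda>y. tens A M C u (v \<triangleleft>\<^bsub>C\<^esub> th y c))" if "u \<in> carrier M" "v \<in> carrier
          C" for u v
        by (rule additive_comp[OF additive_comp[OF balancedD(1)[OF balanced_th c]
            additive_ract_right[OF that(2)]] tn_add[OF that(1)]])
    qed (simp_all add: M.MC.tens_ract_left ract_closed th_closed c lact_ract th_lact ract_assoc)
    let ?\<gamma> = "\<lambda>x y u v. tens A M C (x \<triangleleft>\<^bsub>M\<^esub> th y u) v"
    have bc: "balanced A C C M.MC.T (?\<gamma> x y)" if "x \<in> carrier M" "y \<in> carrier C" for x y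
      by (rule M.balanced_colinear[OF x_th[OF that]])
    have bm: "balanced A M C M.MC.T (\<lambda>x y. ?\<gamma> x y u v)" if "u \<in> carrier C" "v \<in> carrier C" for u v
      by (rule balanced_comp[OF bM[OF that(1)] balancedD(1)[OF M.MC.tens_balanced that(2)]])
    have bmc: "balanced A M C M.MC.T (\<lambda>x y. tensor_lift M.MC.T (?\<gamma> x y) (comul C c))"
      by (rule balanced_lift_param[OF CC.tensor_product_axioms M.MC.tensor_product_axioms G \<Delta> bc
          bm])
    have eq: "tensor_lift M.MC.T (t x) (comul C y) = tensor_lift M.MC.T (?\<gamma> x y) (comul C c)"
      if x: "x \<in> carrier M" and y: "y \<in> carrier C" for x y
    proof -
      have "tensor_lift M.MC.T (t x) (comul C y) = tens A M C x (tensor_lift C (\<lambda>u v. u \<triangleleft>\<^bsub>C\<^esub> th v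
          c) (comul C y))"
        unfolding t_def
        by (rule CC.lift_comp[symmetric, OF abelian_group_C G balanced_ract_th[OF c
            right_module_axioms] tn_add[OF x] comul_closed[OF y]])
      also have "\<dots> = tens A M C x (tensor_lift C (\<lambda>u v. th y u \<triangleright>\<^bsub>C\<^esub> v) (comul C c))"
        by (simp only: theta_comul[OF y c])
      also have "\<dots> = tensor_lift M.MC.T (\<lambda>u v. tens A M C x (th y u \<triangleright>\<^bsub>C\<^esub> v)) (comul C c)"
        by (rule CC.lift_comp[OF abelian_group_C G balanced_dual_act[OF th_functional[OF y]]
            tn_add[OF x] \<Delta>])
      also have "\<dots> = tensor_lift M.MC.T (?\<gamma> x y) (comul C c)"
        by (rule CC.lift_cong[OF G bc[OF x y] \<Delta>]) (simp add: M.MC.tens_ract_left x y th_closed)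
      finally show ?thesis .
    qed
    have "coact M (H c) = tensor_lift M.MC.T (\<lambda>x y. coact M (x \<triangleleft>\<^bsub>M\<^esub> th y c)) (coact M m)"
      unfolding H_def by (rule M.MC.lift_comp[OF GM G bM[OF c] M.additive_coact \<rho>])
    also have "\<dots> = tensor_lift M.MC.T (\<lambda>x y. tensor_lift M.MC.T (\<lambda>u v. t u v y) (coact M x))
        (coact M m)"
      by (rule M.MC.lift_cong[symmetric, OF G balanced_comp[OF bM[OF c] M.additive_coact] \<rho>])
        (simp add: rmod_hom_ract[OF M.X.coact_hom] th_closed c tensor_ract t_def)
    also have "\<dots> = tensor_lift M.MC.T (\<lambda>x y. tensor_lift M.MC.T (t x) (comul C y)) (coact M m)"
      by (rule M.sweedler_coact[OF m G t])
    also have "\<dots> = tensor_lift M.MC.T (\<lambda>x y. tensor_lift M.MC.T (?\<gamma> x y) (comul C c)) (coact M m)"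
      by (rule M.MC.lift_cong[OF G bmc \<rho> eq])
    also have "\<dots> = tensor_lift M.MC.T (\<lambda>u v. tensor_lift M.MC.T (\<lambda>x y. ?\<gamma> x y u v) (coact M m))
        (comul C c)"
      by (rule lift_swap[OF M.MC.tensor_product_axioms CC.tensor_product_axioms G \<rho> \<Delta> bm bc])
    also have "\<dots> = tensor_map A M C H (\<lambda>x. x) (comul C c)"
      unfolding tensor_map_eq
      by (rule CC.lift_cong[OF G M.balanced_colinear[OF H] \<Delta>])
        (simp add: H_def M.MC.lift_comp[OF GM G bM balancedD(1)[OF M.MC.tens_balanced] \<rho>])
    finally show "coact M (H c) = tensor_map A M C H (\<lambda>x. x) (comul C c)" .
  qed
  then show ?thesis using M.restrict_in_G[of H] by (simp add: colin_at_def H_def[abs_def])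
qed

lemma FG_counit_iso: "FG_counit M \<in> comod_iso A C (F_obj A C (G_obj A C M)) M"
proof (rule comod_isoI[OF M.G.right_comodule_F M M.FG_counit_comod_hom])
  show "M.G.tn (colin_at M m) z \<in> carrier (F_obj A C (G_obj A C M))" if "m \<in> carrier M" for m
    using M.G.F.tens_closed[OF colin_at_colinear[OF that]] z_closed by simp
  show "FG_counit M (M.G.tn (colin_at M m) z) = m" if "m \<in> carrier M" for m
    using M.FG_counit_tens[OF colin_at_colinear[OF that] z_closed] colin_at_z[OF that] by simp
  fix X assume "X \<in> carrier (F_obj A C (G_obj A C M))"
  then have X: "X \<in> carrier M.G.F.T" by simp
  \<comment> \<open>\<open>X = h \<otimes> z\<close> is evaluated to \<open>h(z)\<close>, and \<open>h\<close> is the comodule map with that value at \<open>z\<close>.\<close>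
  let ?h = "first_coord (G_obj A C M) X"
  note h = first_coord_closed[OF M.right_module_G X]
  have "FG_counit M X = ?h z"
    using M.FG_counit_tens[OF h z_closed] tens_first_coord[OF M.right_module_G X] by simp
  then show "M.G.tn (colin_at M (FG_counit M X)) z = X"
    using colin_at_eval_z[OF h] tens_first_coord[OF M.right_module_G X] by simp
qed

end

lemma FG_unit_iso:
  assumes N: "right_module D N"
  shows "FG_unit A C N \<in> rmod_iso D N (G_obj A C (F_obj A C N))"
proof -
  interpret N: dual_module A C N by (rule dual_moduleI[OF N])
  interpret FN: base_comodule A C "F_obj A C N" by (rule base_comoduleI[OF N.right_comodule_F])
  have kz: "k z \<in> carrier N.F.T" if "k \<in> carrier (G_obj A C (F_obj A C N))" for k
    using FN.colinearD(3)[of k z] that z_closed by simp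
  show ?thesis
  proof (rule rmod_isoI[OF N FN.right_module_G FG_unit_hom[OF N], where g = "\<lambda>k. first_coord N (k
      z)"])
    show "first_coord N (k z) \<in> carrier N" if "k \<in> carrier (G_obj A C (F_obj A C N))" for k
      by (rule first_coord_closed[OF N kz[OF that]])
    show "first_coord N (FG_unit A C N n z) = n" if "n \<in> carrier N" for n
      using first_coord_tens_z[OF N that] z_closed by (simp add: FG_unit_def)
    fix k assume k: "k \<in> carrier (G_obj A C (F_obj A C N))"
    \<comment> \<open>\<open>k(z) = n \<otimes> z\<close>, so \<open>k\<close> and the unit at \<open>n\<close> are comodule maps that agree at \<open>z\<close>.\<close>
    let ?u = "FG_unit A C N (first_coord N (k z))"
    have "?u z = k z" using tens_first_coord[OF N kz[OF k]] z_closed by (simp add: FG_unit_def)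
    moreover have "?u \<in> carrier (G_obj A C (F_obj A C N))"
      by (rule rmod_hom_closed[OF FG_unit_hom[OF N] first_coord_closed[OF N kz[OF k]]])
    ultimately show "?u = k"
      using colin_at_eval_z[OF N.right_comodule_F, of ?u] colin_at_eval_z[OF N.right_comodule_F k]
          by simp
  qed
qed

end

lemma frobenius_coring_data:
  assumes "frobenius_coring A C"
  shows "\<exists>z \<theta>. frobenius_data A C z \<theta>"
proof -
  from assms obtain z \<theta> where C: "coring A C" and z: "z \<in> carrier C"
    and \<theta>: "\<theta> \<in> bimod_hom A A (bitensor A C C) (regular_bimod A)"
    and ax: "\<forall>a\<in>carrier A. a \<triangleright>\<^bsub>C\<^esub> z = z \<triangleleft>\<^bsub>C\<^esub> a"
      "\<forall>c\<in>carrier C. \<forall>d\<in>carrier C.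
           tensor_lift C (\<lambda>x y. x \<triangleleft>\<^bsub>C\<^esub> \<theta> (tens A C C y d)) (comul C c) =
           tensor_lift C (\<lambda>x y. \<theta> (tens A C C c x) \<triangleright>\<^bsub>C\<^esub> y) (comul C d)"
      "\<forall>c\<in>carrier C. \<theta> (tens A C C z c) = counit C c \<and> \<theta> (tens A C C c z) = counit C c"
    unfolding frobenius_coring_def by (elim conjE bexE)
  have "frobenius_data A C z \<theta>"
    by (intro frobenius_data.intro base_coring.intro C frobenius_data_axioms.intro z \<theta>)
      (simp_all only: ax[rule_format] ax(3)[rule_format, THEN conjunct1] ax(3)[rule_format, THEN
          conjunct2])
  then show ?thesis by blast
qed

theorem theorem7p4:
  fixes A :: "('a, 'z) ring_scheme" and C :: "('a, 'c) cor"
  assumes "ring A" and "frobenius_coring A C"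
  shows
    \<comment> \<open>\<open>F\<close> and \<open>G\<close> are functors\<close>
    "(\<forall>N :: ('c \<Rightarrow> 'a, 'n) rmod. right_module (dual_ring A C) N \<longrightarrow>
        right_comodule A C (F_obj A C N) \<and>
        (\<forall>x\<in>carrier (F_obj A C N). F_map A C N (\<lambda>n. n) x = x)) \<and>
     (\<forall>(N :: ('c \<Rightarrow> 'a, 'n) rmod) (N' :: ('c \<Rightarrow> 'a, 'n1) rmod) f.
        right_module (dual_ring A C) N \<and> right_module (dual_ring A C) N' \<and>
        f \<in> rmod_hom (dual_ring A C) N N' \<longrightarrow>
        F_map A C N' f \<in> comod_hom A C (F_obj A C N) (F_obj A C N')) \<and>
     (\<forall>(N :: ('c \<Rightarrow> 'a, 'n) rmod) (N' :: ('c \<Rightarrow> 'a, 'n1) rmod) (N'' :: ('c \<Rightarrow> 'a, 'n2) rmod) f g.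
        right_module (dual_ring A C) N \<and> right_module (dual_ring A C) N' \<and>
        right_module (dual_ring A C) N'' \<and>
        f \<in> rmod_hom (dual_ring A C) N N' \<and> g \<in> rmod_hom (dual_ring A C) N' N'' \<longrightarrow>
        (\<forall>x\<in>carrier (F_obj A C N).
          F_map A C N'' (\<lambda>n. g (f n)) x = F_map A C N'' g (F_map A C N' f x))) \<and>
     (\<forall>M :: ('a, 'c, 'm) comod. right_comodule A C M \<longrightarrow>
        right_module (dual_ring A C) (G_obj A C M) \<and>
        (\<forall>h\<in>carrier (G_obj A C M). G_map C (\<lambda>m. m) h = h)) \<and>
     (\<forall>(M :: ('a, 'c, 'm) comod) (M' :: ('a, 'c, 'm1) comod) f.
        right_comodule A C M \<and> right_comodule A C M' \<and> f \<in> comod_hom A C M M' \<longrightarrow>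
        G_map C f \<in> rmod_hom (dual_ring A C) (G_obj A C M) (G_obj A C M')) \<and>
     (\<forall>(M :: ('a, 'c, 'm) comod) (M' :: ('a, 'c, 'm1) comod) (M'' :: ('a, 'c, 'm2) comod) f g.
        right_comodule A C M \<and> right_comodule A C M' \<and> right_comodule A C M'' \<and>
        f \<in> comod_hom A C M M' \<and> g \<in> comod_hom A C M' M'' \<longrightarrow>
        (\<forall>h\<in>carrier (G_obj A C M). G_map C (\<lambda>m. g (f m)) h = G_map C g (G_map C f h))) \<and>
    \<comment> \<open>naturality of unit and counit\<close>
     (\<forall>(N :: ('c \<Rightarrow> 'a, 'n) rmod) (N' :: ('c \<Rightarrow> 'a, 'n1) rmod) f.
        right_module (dual_ring A C) N \<and> right_module (dual_ring A C) N' \<and>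
        f \<in> rmod_hom (dual_ring A C) N N' \<longrightarrow>
        (\<forall>n\<in>carrier N. FG_unit A C N' (f n) = G_map C (F_map A C N' f) (FG_unit A C N n))) \<and>
     (\<forall>(M :: ('a, 'c, 'm) comod) (M' :: ('a, 'c, 'm1) comod) f.
        right_comodule A C M \<and> right_comodule A C M' \<and> f \<in> comod_hom A C M M' \<longrightarrow>
        (\<forall>x\<in>carrier (F_obj A C (G_obj A C M)).
          FG_counit M' (F_map A C (G_obj A C M') (G_map C f) x) = f (FG_counit M x))) \<and>
    \<comment> \<open>triangle identities\<close>
     (\<forall>N :: ('c \<Rightarrow> 'a, 'n) rmod. right_module (dual_ring A C) N \<longrightarrow>
        (\<forall>x\<in>carrier (F_obj A C N).
          FG_counit (F_obj A C N) (F_map A C (G_obj A C (F_obj A C N)) (FG_unit A C N) x) = x)) \<and>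
     (\<forall>M :: ('a, 'c, 'm) comod. right_comodule A C M \<longrightarrow>
        (\<forall>h\<in>carrier (G_obj A C M).
          G_map C (FG_counit M) (FG_unit A C (G_obj A C M) h) = h)) \<and>
    \<comment> \<open>unit and counit are isomorphisms\<close>
     (\<forall>N :: ('c \<Rightarrow> 'a, 'n) rmod. right_module (dual_ring A C) N \<longrightarrow>
        FG_unit A C N \<in> rmod_iso (dual_ring A C) N (G_obj A C (F_obj A C N))) \<and>
     (\<forall>M :: ('a, 'c, 'm) comod. right_comodule A C M \<longrightarrow>
        FG_counit M \<in> comod_iso A C (F_obj A C (G_obj A C M)) M)"
proof -
  obtain z \<theta> where "frobenius_data A C z \<theta>"
    using frobenius_coring_data[OF assms(2)] by blast
  then interpret frobenius_data A C z \<theta> .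
  show ?thesis
    by (intro conjI allI impI ballI; (elim conjE)?;
      rule dual_module.right_comodule_F[OF dual_moduleI] F_map_id F_map_hom F_map_comp
        base_comodule.right_module_G[OF base_comoduleI] G_map_id G_map_hom G_map_comp
        FG_unit_natural FG_counit_natural triangle_F triangle_G FG_unit_iso FG_counit_iso;
      assumption)
qed

end
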